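(* Let $F$ be a perfect field, let $O(F)$ be the split octonion algebra over $F$ with norm $N$, and let $M(F)=\{x\in O(F): N(x)=1\}/\{\pm 1\}$ be the associated nonassociative simple Moufang loop. Then the automorphism group of the loop $M(F)$ is isomorphic to the semidirect product $G_2(F)\rtimes \mathrm{Aut}(F)$. Moreover, every automorphism of $M(F)$ is induced by a semilinear automorphism of $O(F)$.
   Context: A loop is a set with a binary operation having a neutral element $1$ such that the equation $xy=z$ has a unique solution whenever two of the three elements $x,y,z$ are given. A Moufang loop is a loop satisfying $((xy)x)z=x(y(xz))$. Automorphisms of a loop are bijections preserving the multiplication. A composition algebra over a field $F$ is an $F$-vector space $C$ with a bilinear, not necessarily associative, multiplication with identity element and a nondegenerate quadratic form $N:C\to F$ (the norm; nondegenerate means that the associated bilinear form $N(u+v)-N(u)-N(v)$ is nondegenerate when $\dim C>1$) such that $N(uv)=N(u)N(v)$ for all $u,v\in C$. It is an octonion algebra if $\dim C=8$, and it is split if it has nontrivial zero divisors. Over every field $F$ there is, up to isomorphism, a unique split octonion algebra, denoted $O(F)$. Let $O(F)^*$ be the set of elements of norm $1$ in $O(F)$. It is a Moufang loop under multiplication, with center $\{\pm1\}$ (equal to $\{1\}$ in characteristic $2$), and $M(F)=O(F)^*/\{\pm1\}$. It is known that $M(F)$ is a nonassociative simple Moufang loop. A linear (resp. semilinear) automorphism of $O(F)$ is a bijective $F$-linear (resp. $F$-semilinear, i.e. additive with $\alpha(\lambda u)=\theta(\lambda)\alpha(u)$ for some $\theta\in\mathrm{Aut}(F)$ and all $\lambda\in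 F$) map $\alpha:O(F)\to O(F)$ satisfying $\alpha(uv)=\alpha(u)\alpha(v)$ for all $u,v$. An automorphism of $M(F)$ is induced by a semilinear automorphism $\alpha$ of $O(F)$ if it is the map $\pm x\mapsto \pm\alpha(x)$ for $x\in O(F)^*$. $G_2(F)$ is the Chevalley group of type $G_2$ over $F$; it is well known that it is isomorphic to the group of linear automorphisms of $O(F)$. $\mathrm{Aut}(F)$ is the group of field automorphisms of $F$, acting on $G_2(F)$ by field automorphisms; with this action $G_2(F)\rtimes\mathrm{Aut}(F)$ is isomorphic to the group of all semilinear automorphisms of $O(F)$. *)

theory Defs
  imports
    "HOL-Analysis.Analysis"
    "HOL-Algebra.Bij"
    "HOL-Algebra.Coset"
    "HOL-Algebra.Generated_Groups"
begin

section \<open>Fields\<close>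

definition perfect_field :: "'f::field itself \<Rightarrow> bool" where
  "perfect_field _ \<longleftrightarrow> CHAR('f) = 0 \<or> surj (\<lambda>x::'f. x ^ CHAR('f))"

definition field_automorphisms :: "('f::field \<Rightarrow> 'f) set" where
  "field_automorphisms =
     {\<theta>. bij \<theta> \<and> (\<forall>x y. \<theta> (x + y) = \<theta> x + \<theta> y) \<and> (\<forall>x y. \<theta> (x * y) = \<theta> x * \<theta> y)}"

definition field_Aut :: "('f::field \<Rightarrow> 'f) monoid" where
  "field_Aut = \<lparr>carrier = field_automorphisms, monoid.mult = (\<circ>), one = id\<rparr>"


section \<open>Split octonion algebras\<close>

text \<open>
  The nondegeneracy condition is guarded by \<open>dim UNIV \<noteq> 1\<close> rather than \<open>dim UNIV > 1\<close>, because
  the library sets the dimension of an infinite-dimensional space to 0.  In dimension 1, where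
  the polar form vanishes in characteristic 2, a nonzero norm is required instead.
\<close>

locale composition_algebra = vector_space smul
  for smul :: "'f::field \<Rightarrow> 'c::ab_group_add \<Rightarrow> 'c" +
  fixes mul :: "'c \<Rightarrow> 'c \<Rightarrow> 'c" and unit :: 'c and N :: "'c \<Rightarrow> 'f"
  assumes mul_linear_right: "Vector_Spaces.linear smul smul (\<lambda>v. mul u v)"
    and mul_linear_left: "Vector_Spaces.linear smul smul (\<lambda>u. mul u v)"
    and unit_left: "mul unit u = u"
    and unit_right: "mul u unit = u"
    and norm_scale: "N (smul a u) = a\<^sup>2 * N u"
    and polar_linear: "Vector_Spaces.linear smul (*) (\<lambda>u. N (u + v) - N u - N v)"
    and nondegenerate:
      "dim UNIV \<noteq> 1 \<Longrightarrow> (\<And>v. N (u + v) - N u - N v = 0) \<Longrightarrow> u = 0"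
    and nondegenerate_dim_1: "dim UNIV = 1 \<Longrightarrow> N u = 0 \<Longrightarrow> u = 0"
    and norm_mul: "N (mul u v) = N u * N v"

locale octonion_algebra = composition_algebra +
  assumes dim_8: "dim UNIV = 8"

locale split_octonion_algebra = octonion_algebra +
  assumes zero_divisors: "\<exists>u v. u \<noteq> 0 \<and> v \<noteq> 0 \<and> mul u v = 0"

definition semilinear_automorphism ::
  "('f::field \<Rightarrow> 'c::ab_group_add \<Rightarrow> 'c) \<Rightarrow> ('c \<Rightarrow> 'c \<Rightarrow> 'c) \<Rightarrow> ('c \<Rightarrow> 'c) \<Rightarrow> bool" where
  "semilinear_automorphism smul mul \<alpha> \<longleftrightarrow>
     bij \<alpha> \<and> (\<forall>u v. \<alpha> (u + v) = \<alpha> u + \<alpha> v) \<and>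
     (\<exists>\<theta>\<in>field_automorphisms. \<forall>a u. \<alpha> (smul a u) = smul (\<theta> a) (\<alpha> u)) \<and>
     (\<forall>u v. \<alpha> (mul u v) = mul (\<alpha> u) (\<alpha> v))"


section \<open>The Moufang loop of norm-one elements modulo sign\<close>

text \<open>
  Loops are stored in the record type \<open>monoid\<close>, which imposes no axioms.  The operators
  \<open>Mod\<close> and \<open>AutoGroup\<close> from HOL-Algebra make sense for arbitrary magmas: the carrier of
  \<open>moufang_loop mul unit N\<close> consists of the sets \<open>{x, - x}\<close> with \<open>N x = 1\<close>, multiplied
  elementwise, and the elements of \<open>AutoGroup\<close> are the bijections of the carrier preserving
  the multiplication (extended by \<open>undefined\<close> outside the carrier).
\<close>

definition norm_one_loop :: "('c \<Rightarrow> 'c \<Rightarrow> 'c) \<Rightarrow> 'c \<Rightarrow> ('c \<Rightarrow> 'f::field) \<Rightarrow> 'c monoid" where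
  "norm_one_loop mul unit N = \<lparr>carrier = {x. N x = 1}, monoid.mult = mul, one = unit\<rparr>"

definition moufang_loop ::
  "('c::ab_group_add \<Rightarrow> 'c \<Rightarrow> 'c) \<Rightarrow> 'c \<Rightarrow> ('c \<Rightarrow> 'f::field) \<Rightarrow> 'c set monoid" where
  "moufang_loop mul unit N = norm_one_loop mul unit N Mod {unit, - unit}"

definition induced_by ::
  "('c::ab_group_add \<Rightarrow> 'f::field) \<Rightarrow> ('c \<Rightarrow> 'c) \<Rightarrow> ('c set \<Rightarrow> 'c set) \<Rightarrow> bool" where
  "induced_by N \<alpha> f \<longleftrightarrow> (\<forall>x. N x = 1 \<longrightarrow> f {x, - x} = {\<alpha> x, - \<alpha> x})"


section \<open>The Chevalley group of type \<open>G\<^sub>2\<close>\<close>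

text \<open>
  A root \<open>a \<alpha> + b \<beta>\<close>, with \<open>\<alpha>\<close> the short and \<open>\<beta>\<close> the long simple root, has coordinates
  \<open>(a, b)\<close>; the positive root \<open>a \<alpha> + b \<beta>\<close> is named \<open>Rab\<close>.
\<close>

datatype g2_pos_root = R10 | R01 | R11 | R21 | R31 | R32
datatype g2_root = Pos g2_pos_root | Neg g2_pos_root
datatype g2_simple = Short | Long
datatype g2_basis = H g2_simple | E g2_root

instance g2_pos_root :: finite
proof
  have "(UNIV :: g2_pos_root set) = {R10, R01, R11, R21, R31, R32}"
    using g2_pos_root.exhaust by blast
  then show "finite (UNIV :: g2_pos_root set)"
    by (metis finite.emptyI finite_insert)
qed

instance g2_root :: finite
proof
  have "(UNIV :: g2_root set) = range Pos \<union> range Neg"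
    using g2_root.exhaust by blast
  then show "finite (UNIV :: g2_root set)"
    by (metis finite_Un finite_imageI finite)
qed

instance g2_simple :: finite
proof
  have "(UNIV :: g2_simple set) = {Short, Long}"
    using g2_simple.exhaust by blast
  then show "finite (UNIV :: g2_simple set)"
    by (metis finite.emptyI finite_insert)
qed

instance g2_basis :: finite
proof
  have "(UNIV :: g2_basis set) = range H \<union> range E"
    using g2_basis.exhaust by blast
  then show "finite (UNIV :: g2_basis set)"
    by (metis finite_Un finite_imageI finite)
qed

fun pos_coords :: "g2_pos_root \<Rightarrow> int \<times> int" where
  "pos_coords R10 = (1, 0)"
| "pos_coords R01 = (0, 1)"
| "pos_coords R11 = (1, 1)"
| "pos_coords R21 = (2, 1)"
| "pos_coords R31 = (3, 1)"
| "pos_coords R32 = (3, 2)"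

fun coords :: "g2_root \<Rightarrow> int \<times> int" where
  "coords (Pos r) = pos_coords r"
| "coords (Neg r) = - pos_coords r"

fun simple_coords :: "g2_simple \<Rightarrow> int \<times> int" where
  "simple_coords Short = (1, 0)"
| "simple_coords Long = (0, 1)"

text \<open>The invariant form, normalised by \<open>(\<alpha>, \<alpha>) = 2\<close>, \<open>(\<beta>, \<beta>) = 6\<close>, \<open>(\<alpha>, \<beta>) = -3\<close>.\<close>

fun g2_form :: "int \<times> int \<Rightarrow> int \<times> int \<Rightarrow> int" where
  "g2_form (a, b) (c, d) = 2 * a * c + 6 * b * d - 3 * (a * d + b * c)"

text \<open>
  Structure constants \<open>N\<^sub>r\<^sub>s\<close> with \<open>[e\<^sub>r, e\<^sub>s] = N\<^sub>r\<^sub>s e\<^sub>r\<^sub>+\<^sub>s\<close> in a Chevalley basis.  Each is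
  \<open>\<plusminus>(p + 1)\<close>, where \<open>p\<close> is the largest integer such that \<open>s - p r\<close> is a root.  The signs are \<open>+\<close>
  on the extraspecial pairs (the first four entries below); Jacobi then determines the fifth.  All
  other constants follow from \<open>N\<^sub>s\<^sub>r = - N\<^sub>r\<^sub>s\<close>, \<open>N\<^sub>-\<^sub>r\<^sub>,\<^sub>-\<^sub>s = - N\<^sub>r\<^sub>s\<close> and
  \<open>N\<^sub>r\<^sub>s / (t, t) = N\<^sub>s\<^sub>t / (r, r)\<close> for roots with \<open>r + s + t = 0\<close>.
\<close>

definition special_pair_const :: "int \<times> int \<Rightarrow> int \<times> int \<Rightarrow> int" where
  "special_pair_const r s =
     (if (r, s) = ((1, 0), (0, 1)) then 1
      else if (r, s) = ((1, 0), (1, 1)) then 2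
      else if (r, s) = ((1, 0), (2, 1)) then 3
      else if (r, s) = ((0, 1), (3, 1)) then 1
      else if (r, s) = ((1, 1), (2, 1)) then - 3
      else 0)"

definition pos_const :: "int \<times> int \<Rightarrow> int \<times> int \<Rightarrow> int" where
  "pos_const r s = special_pair_const r s - special_pair_const s r"

text \<open>The case of \<open>r\<close> positive, \<open>s\<close> negative and \<open>r + s\<close> a root.\<close>

definition mixed_const :: "int \<times> int \<Rightarrow> int \<times> int \<Rightarrow> int" where
  "mixed_const r s =
     (let d = r + s in
      if d \<in> range pos_coords
      then (- pos_const (- s) d * g2_form d d) div g2_form r r
      else (pos_const (- d) r * g2_form d d) div g2_form s s)"

fun g2_const :: "g2_root \<Rightarrow> g2_root \<Rightarrow> int" where
  "g2_const (Pos r) (Pos s) = pos_const (pos_coords r) (pos_coords s)"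
| "g2_const (Neg r) (Neg s) = - pos_const (pos_coords r) (pos_coords s)"
| "g2_const (Pos r) (Neg s) = mixed_const (pos_coords r) (- pos_coords s)"
| "g2_const (Neg r) (Pos s) = - mixed_const (pos_coords s) (- pos_coords r)"

text \<open>
  \<open>g2_cartan s r = 2 (s, r) / (s, s)\<close>, so that \<open>[h\<^sub>s, e\<^sub>r] = g2_cartan s r e\<^sub>r\<close>; and
  \<open>g2_coroot r s\<close> is the coefficient of the simple coroot \<open>h\<^sub>s\<close> in \<open>h\<^sub>r = [e\<^sub>r, e\<^sub>-\<^sub>r]\<close>.
\<close>

definition g2_cartan :: "g2_simple \<Rightarrow> g2_root \<Rightarrow> int" where
  "g2_cartan s r =
     (2 * g2_form (simple_coords s) (coords r)) div g2_form (simple_coords s) (simple_coords s)"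

definition g2_coroot :: "g2_root \<Rightarrow> g2_simple \<Rightarrow> int" where
  "g2_coroot r s =
     (case s of Short \<Rightarrow> fst (coords r) | Long \<Rightarrow> snd (coords r)) *
     g2_form (simple_coords s) (simple_coords s) div g2_form (coords r) (coords r)"

text \<open>\<open>g2_bracket x y z\<close> is the coefficient of \<open>z\<close> in \<open>[x, y]\<close>.\<close>

fun g2_bracket :: "g2_basis \<Rightarrow> g2_basis \<Rightarrow> g2_basis \<Rightarrow> int" where
  "g2_bracket (H s) (H t) z = 0"
| "g2_bracket (H s) (E r) z = (if z = E r then g2_cartan s r else 0)"
| "g2_bracket (E r) (H s) z = (if z = E r then - g2_cartan s r else 0)"
| "g2_bracket (E r) (E s) z =
     (case z of
        H t \<Rightarrow> if coords r + coords s = 0 then g2_coroot r t else 0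
      | E u \<Rightarrow> if coords u = coords r + coords s then g2_const r s else 0)"

definition g2_ad :: "g2_basis \<Rightarrow> int ^ g2_basis ^ g2_basis" where
  "g2_ad x = (\<chi> z y. g2_bracket x y z)"

text \<open>
  The endomorphism \<open>(ad e\<^sub>r)\<^sup>k / k!\<close> preserves the \<open>\<int>\<close>-span of the Chevalley basis, so the integer
  divisions below are exact, and \<open>(ad e\<^sub>r)\<^sup>4 = 0\<close>.  Hence \<open>g2_root_element r t\<close> is
  \<open>x\<^sub>r(t) = exp(t ad e\<^sub>r)\<close>, transported to an arbitrary field by reducing the divided powers.
\<close>

definition g2_divided_power :: "g2_root \<Rightarrow> nat \<Rightarrow> int ^ g2_basis ^ g2_basis" where
  "g2_divided_power r k = map_matrix (\<lambda>z. z div fact k) (((**) (g2_ad (E r)) ^^ k) (mat 1))"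

definition g2_root_element :: "g2_root \<Rightarrow> 'f::field \<Rightarrow> 'f ^ g2_basis ^ g2_basis" where
  "g2_root_element r t = (\<Sum>k\<le>3. map_matrix (\<lambda>z. t ^ k * of_int z) (g2_divided_power r k))"

definition GL_group :: "('f::field ^ 'n ^ 'n) monoid" where
  "GL_group = \<lparr>carrier = {A. invertible A}, monoid.mult = (**), one = mat 1\<rparr>"

definition G2_group :: "('f::field ^ g2_basis ^ g2_basis) monoid" where
  "G2_group = GL_group\<lparr>carrier := generate GL_group {g2_root_element r t | r t. True}\<rparr>"


section \<open>Semidirect products\<close>

definition semidirect_product ::
  "'g monoid \<Rightarrow> 'h monoid \<Rightarrow> ('h \<Rightarrow> 'g \<Rightarrow> 'g) \<Rightarrow> ('g \<times> 'h) monoid" where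
  "semidirect_product G K \<phi> =
     \<lparr>carrier = carrier G \<times> carrier K,
      monoid.mult = (\<lambda>(g, a) (h, b). (g \<otimes>\<^bsub>G\<^esub> \<phi> a h, a \<otimes>\<^bsub>K\<^esub> b)),
      one = (\<one>\<^bsub>G\<^esub>, \<one>\<^bsub>K\<^esub>)\<rparr>"

text \<open>
  A field automorphism acts on \<open>G\<^sub>2(F)\<close> by applying it to all matrix entries; it maps \<open>x\<^sub>r(t)\<close> to
  \<open>x\<^sub>r(\<theta> t)\<close>.
\<close>

definition G2_semidirect_Aut ::
  "(('f::field ^ g2_basis ^ g2_basis) \<times> ('f \<Rightarrow> 'f)) monoid" where
  "G2_semidirect_Aut = semidirect_product G2_group field_Aut map_matrix"

end

(*
  An automorphism of M(F) permutes the classes of the elements 1 + n with n nilpotent, since these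
  are recognised by loop equations.  The resulting map rho on nilpotent elements preserves the
  relations B(n, m) = 0 (products with 1 + m and 1 - m stay unipotent) and B(n, m) = 1 (the braid
  relation for 1 + n and 1 + m), where B is the polar form.  Together with the products
  (1 + n) (1 + m) for B(n, m) = 0 this shows that rho carries the six nilpotent elements of a Zorn
  basis to those of another one, up to a single field automorphism acting on all six coordinate
  lines.  The corresponding semilinear automorphism of O(F) agrees with the given one on the
  elements 1 + c x with x in the Zorn basis, which generate the loop.

  The group of semilinear automorphisms acts by conjugation on the span of a Chevalley basis of the
  derivations of the Zorn algebra; in the fixed basis the root automorphisms act by the matrices
  x_r(t).  The representation is faithful, and Gaussian elimination on idempotents and on the
  images of u_1, u_2, u_3 shows that the root automorphisms generate all linear automorphisms.
*)
theory Submission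
  imports Defs
begin

text \<open>The obstacle is that nothing makes \<open>rho\<close> additive: a loop automorphism
  controls only products modulo sign. It does preserve the values 0 and 1 of the polar form, and
  scaling one argument turns any nonzero value into 1, so the coordinates of \<open>rho m\<close> in
  a transported hexad are governed by coordinate maps. A vector of trace and norm zero that is
  orthogonal to a hexad vanishes; hence, under an isotropy condition, these coordinates recover
  \<open>rho m\<close> completely. Evaluating \<open>rho\<close> at n + m + n m in two ways then
  gives the Zorn relations of the image and the additivity and multiplicativity of the coordinate
  maps.

  On the group side, a map \<alpha> of the octonions and a 14 by 14 matrix A are tied together by
  the identity \<alpha> D_b = (sum of A_zb D_z) \<alpha> for the derivations D_b. The uniqueness of
  A for given \<alpha>, and of \<alpha> for given A, is read off from how the D_b move the Zorn
  basis. The tables involved are integral, which keeps this part uniform in characteristics 2 and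
  3.\<close>

section \<open>The Zorn algebra and its derivations\<close>

text \<open>
  The tuple \<open>(a, d, p1, p2, p3, q1, q2, q3)\<close> stands for
  \<open>a e + d (1 - e) + \<Sum> p\<^sub>i u\<^sub>i + \<Sum> q\<^sub>i v\<^sub>i\<close> with an idempotent \<open>e\<close> of trace 1 and
  \<open>u\<^sub>1 u\<^sub>2 = v\<^sub>3\<close>, \<open>v\<^sub>1 v\<^sub>2 = u\<^sub>3\<close> (cyclically), \<open>u\<^sub>i v\<^sub>i = - e\<close>, \<open>u\<^sub>i v\<^sub>j = 0\<close> for \<open>i \<noteq> j\<close>.
\<close>

type_synonym 'f oct = "'f \<times> 'f \<times> 'f \<times> 'f \<times> 'f \<times> 'f \<times> 'f \<times> 'f"

fun oscale :: "'f::field \<Rightarrow> 'f oct \<Rightarrow> 'f oct" where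
  "oscale c (a, d, p1, p2, p3, q1, q2, q3) =
     (c * a, c * d, c * p1, c * p2, c * p3, c * q1, c * q2, c * q3)"

fun omul :: "'f::field oct \<Rightarrow> 'f oct \<Rightarrow> 'f oct" where
  "omul (a, d, p1, p2, p3, q1, q2, q3) (a', d', p1', p2', p3', q1', q2', q3') =
     (a * a' - (p1 * q1' + p2 * q2' + p3 * q3'),
      d * d' - (q1 * p1' + q2 * p2' + q3 * p3'),
      a * p1' + d' * p1 + (q2 * q3' - q3 * q2'),
      a * p2' + d' * p2 + (q3 * q1' - q1 * q3'),
      a * p3' + d' * p3 + (q1 * q2' - q2 * q1'),
      d * q1' + a' * q1 + (p2 * p3' - p3 * p2'),
      d * q2' + a' * q2 + (p3 * p1' - p1 * p3'),
      d * q3' + a' * q3 + (p1 * p2' - p2 * p1'))"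

fun oct_norm :: "'f::field oct \<Rightarrow> 'f" where
  "oct_norm (a, d, p1, p2, p3, q1, q2, q3) = a * d + (p1 * q1 + p2 * q2 + p3 * q3)"

text \<open>
  The roots are weights: \<open>u\<^sub>1, u\<^sub>2, u\<^sub>3\<close> have weights \<open>\<alpha> + \<beta>\<close>, \<open>\<alpha>\<close>, \<open>- 2 \<alpha> - \<beta>\<close>, and \<open>v\<^sub>i\<close> has the weight
  opposite to that of \<open>u\<^sub>i\<close>.  The signs are chosen to match the structure constants \<open>g2_const\<close>.
\<close>

fun der :: "g2_basis \<Rightarrow> 'f::field oct \<Rightarrow> 'f oct" where
  "der (H Short) (a, d, p1, p2, p3, q1, q2, q3) =
     (0, 0, - p1, 2 * p2, - p3, q1, - 2 * q2, q3)"
| "der (H Long) (a, d, p1, p2, p3, q1, q2, q3) =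
     (0, 0, p1, - p2, 0, - q1, q2, 0)"
| "der (E (Pos R10)) (a, d, p1, p2, p3, q1, q2, q3) =
     (q2, - q2, 0, a - d, 0, p3, 0, - p1)"
| "der (E (Pos R01)) (a, d, p1, p2, p3, q1, q2, q3) =
     (0, 0, p2, 0, 0, 0, - q1, 0)"
| "der (E (Pos R11)) (a, d, p1, p2, p3, q1, q2, q3) =
     (- q1, q1, - a + d, 0, 0, 0, p3, - p2)"
| "der (E (Pos R21)) (a, d, p1, p2, p3, q1, q2, q3) =
     (p3, - p3, q2, - q1, 0, 0, 0, a - d)"
| "der (E (Pos R31)) (a, d, p1, p2, p3, q1, q2, q3) =
     (0, 0, 0, p3, 0, 0, 0, - q2)"
| "der (E (Pos R32)) (a, d, p1, p2, p3, q1, q2, q3) =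
     (0, 0, p3, 0, 0, 0, 0, - q1)"
| "der (E (Neg R10)) (a, d, p1, p2, p3, q1, q2, q3) =
     (p2, - p2, - q3, 0, q1, 0, a - d, 0)"
| "der (E (Neg R01)) (a, d, p1, p2, p3, q1, q2, q3) =
     (0, 0, 0, p1, 0, - q2, 0, 0)"
| "der (E (Neg R11)) (a, d, p1, p2, p3, q1, q2, q3) =
     (- p1, p1, 0, - q3, q2, - a + d, 0, 0)"
| "der (E (Neg R21)) (a, d, p1, p2, p3, q1, q2, q3) =
     (q3, - q3, 0, 0, a - d, - p2, p1, 0)"
| "der (E (Neg R31)) (a, d, p1, p2, p3, q1, q2, q3) =
     (0, 0, 0, 0, p2, 0, - q3, 0)"
| "der (E (Neg R32)) (a, d, p1, p2, p3, q1, q2, q3) =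
     (0, 0, 0, 0, p1, - q3, 0, 0)"

text \<open>\<open>root_map r t\<close> is \<open>exp (t D) = 1 + t D + t\<^sup>2 D\<^sup>2 / 2\<close> for the derivation \<open>D = der (E r)\<close>.\<close>

fun root_map :: "g2_root \<Rightarrow> 'f::field \<Rightarrow> 'f oct \<Rightarrow> 'f oct" where
  "root_map (Pos R10) t (a, d, p1, p2, p3, q1, q2, q3) =
     (a + t * q2, d - t * q2, p1, p2 + t * (a - d) + t\<^sup>2 * q2, p3, q1 + t * p3, q2, q3 - t * p1)"
| "root_map (Pos R01) t (a, d, p1, p2, p3, q1, q2, q3) =
     (a, d, p1 + t * p2, p2, p3, q1, q2 - t * q1, q3)"
| "root_map (Pos R11) t (a, d, p1, p2, p3, q1, q2, q3) =
     (a - t * q1, d + t * q1, p1 + t * (d - a) + t\<^sup>2 * q1, p2, p3, q1, q2 + t * p3, q3 - t * p2)"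
| "root_map (Pos R21) t (a, d, p1, p2, p3, q1, q2, q3) =
     (a + t * p3, d - t * p3, p1 + t * q2, p2 - t * q1, p3, q1, q2, q3 + t * (a - d) + t\<^sup>2 * p3)"
| "root_map (Pos R31) t (a, d, p1, p2, p3, q1, q2, q3) =
     (a, d, p1, p2 + t * p3, p3, q1, q2, q3 - t * q2)"
| "root_map (Pos R32) t (a, d, p1, p2, p3, q1, q2, q3) =
     (a, d, p1 + t * p3, p2, p3, q1, q2, q3 - t * q1)"
| "root_map (Neg R10) t (a, d, p1, p2, p3, q1, q2, q3) =
     (a + t * p2, d - t * p2, p1 - t * q3, p2, p3 + t * q1, q1, q2 + t * (a - d) + t\<^sup>2 * p2, q3)"
| "root_map (Neg R01) t (a, d, p1, p2, p3, q1, q2, q3) =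
     (a, d, p1, p2 + t * p1, p3, q1 - t * q2, q2, q3)"
| "root_map (Neg R11) t (a, d, p1, p2, p3, q1, q2, q3) =
     (a - t * p1, d + t * p1, p1, p2 - t * q3, p3 + t * q2, q1 + t * (d - a) + t\<^sup>2 * p1, q2, q3)"
| "root_map (Neg R21) t (a, d, p1, p2, p3, q1, q2, q3) =
     (a + t * q3, d - t * q3, p1, p2, p3 + t * (a - d) + t\<^sup>2 * q3, q1 - t * p2, q2 + t * p1, q3)"
| "root_map (Neg R31) t (a, d, p1, p2, p3, q1, q2, q3) =
     (a, d, p1, p2, p3 + t * p2, q1, q2 - t * q3, q3)"
| "root_map (Neg R32) t (a, d, p1, p2, p3, q1, q2, q3) =
     (a, d, p1, p2, p3 + t * p1, q1 - t * q3, q2, q3)"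

lemma oct_cases:
  fixes x :: "'f oct"
  obtains a d p1 p2 p3 q1 q2 q3 where "x = (a, d, p1, p2, p3, q1, q2, q3)"
  by (metis surj_pair)

text \<open>Checked in coordinates, because the usual proof that the exponential of a nilpotent
  derivation is multiplicative divides by 2.\<close>

lemma root_map_mul: "root_map r t (omul x y) = omul (root_map r t x) (root_map r t y)"
proof (cases r)
  case (Pos s)
  then show ?thesis
    by (cases x rule: oct_cases, cases y rule: oct_cases, cases s)
      (simp_all add: algebra_simps power2_eq_square)
next
  case (Neg s)
  then show ?thesis
    by (cases x rule: oct_cases, cases y rule: oct_cases, cases s)
      (simp_all add: algebra_simps power2_eq_square)
qed

section \<open>Evaluation of iterated brackets on sparse lists\<close>

definition basis_list :: "g2_basis list" where
  "basis_list = map H [Short, Long] @ map (\<lambda>r. E (Pos r)) [R10, R01, R11, R21, R31, R32]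
     @ map (\<lambda>r. E (Neg r)) [R10, R01, R11, R21, R31, R32]"

lemma UNIV_basis_list: "UNIV = set basis_list"
proof -
  have "x \<in> set basis_list" for x
  proof (cases x)
    case (H s)
    then show ?thesis by (cases s) (auto simp: basis_list_def)
  next
    case (E r)
    then show ?thesis
    proof (cases r)
      case (Pos s)
      then show ?thesis using E by (cases s) (auto simp: basis_list_def)
    next
      case (Neg s)
      then show ?thesis using E by (cases s) (auto simp: basis_list_def)
    qed
  qed
  then show ?thesis by blast
qed

lemma range_pos_coords:
  "d \<in> range pos_coords \<longleftrightarrow> d \<in> {(1,0), (0,1), (1,1), (2,1), (3,1), (3,2)}"
proof -
  have "range pos_coords = pos_coords ` {R10, R01, R11, R21, R31, R32}"
    by (rule arg_cong[where f = "image pos_coords"]) (use g2_pos_root.exhaust in auto)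
  then show ?thesis by simp
qed

text \<open>A normal form: coefficients of the same basis vector are merged and zeros dropped, so
  the lists stay short while \<open>simp\<close> evaluates iterated brackets.\<close>

definition collect_list :: "(g2_basis \<Rightarrow> int) \<Rightarrow> (g2_basis \<times> int) list" where
  "collect_list f = filter (\<lambda>(z, c). c \<noteq> 0) (map (\<lambda>z. (z, f z)) basis_list)"

definition sparse :: "(g2_basis \<times> int) list \<Rightarrow> g2_basis \<Rightarrow> int" where
  "sparse xs z = (\<Sum>(w, c)\<leftarrow>xs. if z = w then c else 0)"

definition ad_list :: "g2_root \<Rightarrow> g2_basis \<Rightarrow> (g2_basis \<times> int) list" where
  "ad_list r b = collect_list (g2_bracket (E r) b)"

definition ad_sparse :: "g2_root \<Rightarrow> (g2_basis \<times> int) list \<Rightarrow> (g2_basis \<times> int) list" where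
  "ad_sparse r xs = collect_list
     (sparse (concat (map (\<lambda>(w, c). map (\<lambda>(u, m). (u, c * m)) (ad_list r w)) xs)))"

lemmas ad_list_eqs = ad_list_def[of "Pos r" "H s" for r s] ad_list_def[of "Pos r" "E (Pos s)" for r s]
  ad_list_def[of "Pos r" "E (Neg s)" for r s] ad_list_def[of "Neg r" "H s" for r s]
  ad_list_def[of "Neg r" "E (Pos s)" for r s] ad_list_def[of "Neg r" "E (Neg s)" for r s]

lemmas bracket_simps = ad_list_eqs ad_sparse_def collect_list_def basis_list_def pos_const_def special_pair_const_def
  mixed_const_def range_pos_coords g2_cartan_def g2_coroot_def zero_prod_def

lemma sparse_Nil [simp]: "sparse [] z = 0"
  by (simp add: sparse_def)

lemma sparse_Cons [simp]: "sparse ((w, c) # xs) z = (if z = w then c else 0) + sparse xs z"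
  by (simp add: sparse_def)

lemma sparse_append [simp]: "sparse (xs @ ys) z = sparse xs z + sparse ys z"
  by (simp add: sparse_def)

lemma sparse_scale [simp]: "sparse (map (\<lambda>(u, m). (u, c * m)) xs) z = c * sparse xs z"
  by (induction xs) (auto simp: algebra_simps)

lemma sparse_collect_list [simp]: "sparse (collect_list f) = f"
proof
  fix z
  have "sparse (filter (\<lambda>(z, c). c \<noteq> 0) (map (\<lambda>z. (z, f z)) zs)) z = (if z \<in> set zs then f z else 0)"
    if "distinct zs" for zs
    using that by (induction zs) auto
  moreover have "distinct basis_list"
    by (simp add: basis_list_def)
  ultimately show "sparse (collect_list f) z = f z"
    using UNIV_basis_list unfolding collect_list_def by force
qed

lemma sparse_ad_sparse:
  "sparse (ad_sparse r xs) z = (\<Sum>y\<in>UNIV. g2_bracket (E r) y z * sparse xs y)"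
proof (induction xs)
  case Nil
  then show ?case by (simp add: ad_sparse_def)
next
  case (Cons x xs)
  obtain w c where x: "x = (w, c)" by fastforce
  have "(\<Sum>y\<in>UNIV. g2_bracket (E r) y z * (if y = w then c else 0)) = c * g2_bracket (E r) w z"
    by (simp add: if_distrib cong: if_cong)
  moreover have "sparse (ad_sparse r (x # xs)) z = c * sparse (ad_list r w) z + sparse (ad_sparse r xs) z"
    by (simp add: ad_sparse_def x)
  ultimately show ?case
    by (simp add: x Cons ad_list_def distrib_left sum.distrib)
qed

text \<open>The matrices multiply from the left, so a column arises by iterating
  \<open>ad_sparse\<close> on one basis vector. This trades 14 by 14 matrices for short
  lists.\<close>

lemma ad_power:
  "((**) (g2_ad (E r)) ^^ k) (mat 1) $ z $ b = sparse ((ad_sparse r ^^ k) [(b, 1)]) z"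
proof (induction k arbitrary: z)
  case 0
  then show ?case by (simp add: mat_def)
next
  case (Suc k)
  then show ?case
    by (simp add: matrix_matrix_mult_def sparse_ad_sparse g2_ad_def)
qed

text \<open>Integer division distributes over the sum only because every entry is divisible.\<close>

lemma sparse_div:
  assumes "\<forall>(w, c) \<in> set xs. n dvd c"
  shows "sparse xs z div n = sparse (map (\<lambda>(w, c). (w, c div n)) xs) z"
  using assms by (induction xs) (auto simp: div_plus_div_distrib_dvd_left)

lemma oscale_simps [simp]:
  "oscale 0 x = 0" "oscale 1 x = x" "oscale c 0 = 0"
  "oscale (- 1) x = - x"
  by (cases x rule: oct_cases; simp add: zero_prod_def)+

lemma oscale_add: "oscale (c + d) x = oscale c x + oscale d x"
  by (cases x rule: oct_cases) (simp add: algebra_simps)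

lemma oscale_add_right: "oscale c (x + y) = oscale c x + oscale c y"
  by (cases x rule: oct_cases, cases y rule: oct_cases) (simp add: algebra_simps)

lemma oscale_oscale: "oscale c (oscale d x) = oscale (c * d) x"
  by (cases x rule: oct_cases) (simp add: algebra_simps)

lemma oscale_sum: "oscale c (\<Sum>i\<in>A. f i) = (\<Sum>i\<in>A. oscale c (f i))"
  by (induction A rule: infinite_finite_induct) (auto simp: oscale_add_right)

lemma oscale_sum_left: "oscale (\<Sum>i\<in>A. f i) x = (\<Sum>i\<in>A. oscale (f i) x)"
  by (induction A rule: infinite_finite_induct) (auto simp: oscale_add)

definition sparse_der :: "(g2_basis \<times> int) list \<Rightarrow> 'f::field oct \<Rightarrow> 'f oct" where
  "sparse_der xs y = (\<Sum>(w, c)\<leftarrow>xs. oscale (of_int c) (der w y))"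

lemma sparse_der: "(\<Sum>z\<in>UNIV. oscale (of_int (sparse xs z)) (der z y)) = sparse_der xs y"
proof (induction xs)
  case Nil
  then show ?case by (simp add: sparse_der_def)
next
  case (Cons x xs)
  obtain w c where x: "x = (w, c)" by fastforce
  have "(\<Sum>z\<in>UNIV. oscale (of_int (if z = w then c else 0)) (der z y))
     = (\<Sum>z\<in>UNIV. if z = w then oscale (of_int c) (der z y) else 0)"
    by (intro sum.cong) auto
  then show ?case using Cons
    by (simp add: x sparse_der_def oscale_add sum.distrib)
qed

abbreviation quotients :: "(g2_basis \<times> int) list \<Rightarrow> int \<Rightarrow> (g2_basis \<times> int) list" where
  "quotients xs n \<equiv> map (\<lambda>(w, c). (w, c div n)) xs"

text \<open>Brings a column of x_r(t) into a form that can be evaluated by rewriting. The two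
  hypotheses make the divisions by 2! and 3! exact.\<close>

lemma root_element_column:
  assumes "\<forall>(w, c) \<in> set (ad_sparse r (ad_list r b)). 2 dvd c"
    and "\<forall>(w, c) \<in> set (ad_sparse r (ad_sparse r (ad_list r b))). 6 dvd c"
  shows "(\<Sum>z\<in>UNIV. oscale (g2_root_element r t $ z $ b) (der z y)) =
    der b y + oscale t (sparse_der (ad_list r b) y)
    + oscale (t\<^sup>2) (sparse_der (quotients (ad_sparse r (ad_list r b)) 2) y)
    + oscale (t ^ 3) (sparse_der (quotients (ad_sparse r (ad_sparse r (ad_list r b))) 6) y)"
proof -
  define xs where "xs k = (ad_sparse r ^^ k) [(b, 1)]" for k
  have "sparse [(b, 1)] = (\<lambda>y. if y = b then 1 else 0)"
    by auto
  then have "ad_sparse r [(b, 1)] = ad_list r b"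
    by (simp add: ad_sparse_def) (simp add: ad_list_def)
  then have xs: "xs 0 = [(b, 1)]" "xs 1 = ad_list r b" "xs 2 = ad_sparse r (ad_list r b)"
    "xs 3 = ad_sparse r (ad_sparse r (ad_list r b))"
    by (simp_all add: xs_def numeral_2_eq_2 numeral_3_eq_3)
  have atMost3: "{..3::nat} = {0, 1, 2, 3}"
    by auto
  have fact: "fact 2 = (2::int)" "fact 3 = (6::int)"
    by (simp_all add: fact_numeral)
  have "g2_divided_power r k $ z $ b = sparse (quotients (xs k) (fact k)) z" if "k \<le> 3" for k z
  proof -
    have "k \<in> {0, 1, 2, 3}"
      using that by auto
    then have "\<forall>(w, c) \<in> set (xs k). fact k dvd c"
      using assms by (auto simp: xs fact)
    then show ?thesis
      by (simp add: map_matrix_def g2_divided_power_def ad_power xs_def[symmetric] sparse_div)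
  qed
  then have "g2_root_element r t $ z $ b =
      (\<Sum>k\<le>3. t ^ k * of_int (sparse (quotients (xs k) (fact k)) z))" for z
    unfolding g2_root_element_def sum_component
    by (intro sum.cong refl) (simp add: map_matrix_def)
  then have "(\<Sum>z\<in>UNIV. oscale (g2_root_element r t $ z $ b) (der z y)) =
      (\<Sum>k\<le>3. oscale (t ^ k) (sparse_der (quotients (xs k) (fact k)) y))"
    by (simp add: oscale_sum_left oscale_oscale[symmetric] sparse_der[symmetric] oscale_sum
        sum.swap[of _ UNIV])
  moreover have "sparse_der (quotients (xs 0) 1) y = der b y"
    by (simp add: xs sparse_der_def)
  moreover have "quotients (ad_list r b) 1 = ad_list r b"
    by (rule map_idI) auto
  ultimately show ?thesis
    by (simp add: atMost3 fact xs(2)[unfolded One_nat_def] xs algebra_simps)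
qed

lemma all_basis:
  "(\<forall>b. P b) \<longleftrightarrow> P (H Short) \<and> P (H Long) \<and>
     P (E (Pos R10)) \<and> P (E (Pos R01)) \<and> P (E (Pos R11)) \<and>
     P (E (Pos R21)) \<and> P (E (Pos R31)) \<and> P (E (Pos R32)) \<and>
     P (E (Neg R10)) \<and> P (E (Neg R01)) \<and> P (E (Neg R11)) \<and>
     P (E (Neg R21)) \<and> P (E (Neg R31)) \<and> P (E (Neg R32))"
proof -
  have "(\<forall>b. P b) \<longleftrightarrow> (\<forall>b\<in>set basis_list. P b)"
    using UNIV_basis_list by auto
  then show ?thesis by (simp add: basis_list_def)
qed

text \<open>The integrality of the divided powers of degrees 2 and 3, by evaluation at all 14 basis
  vectors.\<close>

lemma ad_sparse_dvd:
  "\<forall>b. (\<forall>(w, c) \<in> set (ad_sparse r (ad_list r b)). 2 dvd c) \<and>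
   (\<forall>(w, c) \<in> set (ad_sparse r (ad_sparse r (ad_list r b))). 6 dvd c)"
proof (cases r)
  case (Pos s)
  then show ?thesis
    unfolding all_basis by (cases s) (simp_all add: bracket_simps)
next
  case (Neg s)
  then show ?thesis
    unfolding all_basis by (cases s) (simp_all add: bracket_simps)
qed

text \<open>This is exp(t D) D_b exp(- t D) = exp(t ad D) D_b with the inverse moved to the other
  side. It is verified as a polynomial identity in the coordinates, and it is here that the signs in
  \<open>der\<close> have to match those of \<open>g2_const\<close>.\<close>

lemma root_map_der:
  "root_map r t (der b x) =
     (\<Sum>z\<in>UNIV. oscale (g2_root_element r t $ z $ b) (der z (root_map r t x)))"
proof -
  have col: "(\<Sum>z\<in>UNIV. oscale (g2_root_element r t $ z $ b) (der z y)) =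
    der b y + oscale t (sparse_der (ad_list r b) y)
    + oscale (t\<^sup>2) (sparse_der (quotients (ad_sparse r (ad_list r b)) 2) y)
    + oscale (t ^ 3) (sparse_der (quotients (ad_sparse r (ad_sparse r (ad_list r b))) 6) y)" for b y
    using ad_sparse_dvd[of r] by (intro root_element_column) blast+
  obtain a d p1 p2 p3 q1 q2 q3 where x: "x = (a, d, p1, p2, p3, q1, q2, q3)"
    by (rule oct_cases)
  have "\<forall>b. root_map r t (der b x) =
    der b (root_map r t x) + oscale t (sparse_der (ad_list r b) (root_map r t x))
    + oscale (t\<^sup>2) (sparse_der (quotients (ad_sparse r (ad_list r b)) 2) (root_map r t x))
    + oscale (t ^ 3) (sparse_der (quotients (ad_sparse r (ad_sparse r (ad_list r b))) 6) (root_map r t x))"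
    (is "\<forall>b. ?P b")
  proof (cases r)
    case (Pos s)
    then show ?thesis
      unfolding all_basis x
      by (cases s; simp only: ; simp add: bracket_simps sparse_der_def;
          simp add: algebra_simps power2_eq_square power3_eq_cube)
  next
    case (Neg s)
    then show ?thesis
      unfolding all_basis x
      by (cases s; simp only: ; simp add: bracket_simps sparse_der_def;
          simp add: algebra_simps power2_eq_square power3_eq_cube)
  qed
  then show ?thesis
    by (simp add: col)
qed

section \<open>Linear automorphisms of the Zorn algebra\<close>

declare split_paired_All [simp del] split_paired_Ex [simp del]

abbreviation oe :: "'f::field oct" where "oe \<equiv> (1, 0, 0, 0, 0, 0, 0, 0)"
abbreviation oe' :: "'f::field oct" where "oe' \<equiv> (0, 1, 0, 0, 0, 0, 0, 0)"
abbreviation ou1 :: "'f::field oct" where "ou1 \<equiv> (0, 0, 1, 0, 0, 0, 0, 0)"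
abbreviation ou2 :: "'f::field oct" where "ou2 \<equiv> (0, 0, 0, 1, 0, 0, 0, 0)"
abbreviation ou3 :: "'f::field oct" where "ou3 \<equiv> (0, 0, 0, 0, 1, 0, 0, 0)"
abbreviation ov1 :: "'f::field oct" where "ov1 \<equiv> (0, 0, 0, 0, 0, 1, 0, 0)"
abbreviation ov2 :: "'f::field oct" where "ov2 \<equiv> (0, 0, 0, 0, 0, 0, 1, 0)"
abbreviation ov3 :: "'f::field oct" where "ov3 \<equiv> (0, 0, 0, 0, 0, 0, 0, 1)"

definition oct_aut :: "('f::field \<Rightarrow> 'f) \<Rightarrow> ('f oct \<Rightarrow> 'f oct) \<Rightarrow> bool" where
  "oct_aut \<theta> \<alpha> \<longleftrightarrow> bij \<alpha> \<and> (\<forall>x y. \<alpha> (x + y) = \<alpha> x + \<alpha> y) \<and>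
     (\<forall>c x. \<alpha> (oscale c x) = oscale (\<theta> c) (\<alpha> x)) \<and> (\<forall>x y. \<alpha> (omul x y) = omul (\<alpha> x) (\<alpha> y))"

lemma oct_autD:
  assumes "oct_aut \<theta> \<alpha>"
  shows "bij \<alpha>" "\<alpha> (x + y) = \<alpha> x + \<alpha> y" "\<alpha> (oscale c x) = oscale (\<theta> c) (\<alpha> x)"
    "\<alpha> (omul x y) = omul (\<alpha> x) (\<alpha> y)"
  using assms by (auto simp: oct_aut_def)

lemma oct_aut_zero: "oct_aut \<theta> \<alpha> \<Longrightarrow> \<alpha> 0 = 0"
  using oct_autD(2)[of \<theta> \<alpha> 0 0] by simp

lemma oct_aut_uminus: "oct_aut \<theta> \<alpha> \<Longrightarrow> \<alpha> (- x) = - \<alpha> x"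
  using oct_autD(2)[of \<theta> \<alpha> x "- x"] by (simp add: oct_aut_zero eq_neg_iff_add_eq_0 add.commute)

lemma oct_aut_sum: "oct_aut \<theta> \<alpha> \<Longrightarrow> \<alpha> (\<Sum>i\<in>I. f i) = (\<Sum>i\<in>I. \<alpha> (f i))"
  by (induction I rule: infinite_finite_induct) (simp_all add: oct_aut_zero oct_autD(2))

lemma oct_aut_inj: "oct_aut \<theta> \<alpha> \<Longrightarrow> \<alpha> x = \<alpha> y \<longleftrightarrow> x = y"
  using inj_eq[OF bij_is_inj[OF oct_autD(1)]] .

lemma oct_aut_comp: "oct_aut \<theta> \<alpha> \<Longrightarrow> oct_aut \<kappa> \<beta> \<Longrightarrow> oct_aut (\<theta> \<circ> \<kappa>) (\<alpha> \<circ> \<beta>)"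
  unfolding oct_aut_def by (auto intro: bij_comp)

lemma oct_aut_id: "oct_aut id id"
  by (simp add: oct_aut_def)

lemma oct_aut_inv:
  assumes "oct_aut \<theta> \<alpha>" "bij \<theta>"
  shows "oct_aut (inv_into UNIV \<theta>) (inv_into UNIV \<alpha>)"
proof -
  note \<alpha> = oct_autD[OF assms(1)]
  have surj: "\<alpha> (inv_into UNIV \<alpha> x) = x" for x
    using \<alpha>(1) by (simp add: bij_is_surj surj_f_inv_f)
  have inj: "inv_into UNIV \<alpha> (\<alpha> x) = x" for x
    using \<alpha>(1) by (simp add: bij_is_inj)
  have eqI: "inv_into UNIV \<alpha> x = y" if "x = \<alpha> y" for x y
    using inj that by simp
  have "inv_into UNIV \<alpha> (x + y) = inv_into UNIV \<alpha> x + inv_into UNIV \<alpha> y" for x y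
    by (intro eqI) (simp only: \<alpha>(2) surj)
  moreover have "inv_into UNIV \<alpha> (omul x y) = omul (inv_into UNIV \<alpha> x) (inv_into UNIV \<alpha> y)" for x y
    by (intro eqI) (simp only: \<alpha>(4) surj)
  moreover have "inv_into UNIV \<alpha> (oscale c x) = oscale (inv_into UNIV \<theta> c) (inv_into UNIV \<alpha> x)" for c x
    by (intro eqI) (simp only: \<alpha>(3) surj surj_f_inv_f[OF bij_is_surj[OF assms(2)]])
  ultimately show ?thesis
    using \<alpha>(1) by (auto simp: oct_aut_def intro: bij_imp_bij_inv)
qed

lemma root_map_inverse: "root_map r (- t) (root_map r t x) = x"
proof (cases r)
  case (Pos s)
  then show ?thesis
    by (cases x rule: oct_cases, cases s) (simp_all add: algebra_simps power2_eq_square)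
next
  case (Neg s)
  then show ?thesis
    by (cases x rule: oct_cases, cases s) (simp_all add: algebra_simps power2_eq_square)
qed

lemma root_map_linear:
  "root_map r t (x + y) = root_map r t x + root_map r t y"
  "root_map r t (oscale c x) = oscale c (root_map r t x)"
proof -
  have "root_map r t (x + y) = root_map r t x + root_map r t y \<and>
    root_map r t (oscale c x) = oscale c (root_map r t x)"
  proof (cases r)
    case (Pos s)
    then show ?thesis
      by (cases x rule: oct_cases, cases y rule: oct_cases, cases s) (simp_all add: algebra_simps)
  next
    case (Neg s)
    then show ?thesis
      by (cases x rule: oct_cases, cases y rule: oct_cases, cases s) (simp_all add: algebra_simps)
  qed
  then show "root_map r t (x + y) = root_map r t x + root_map r t y"
    "root_map r t (oscale c x) = oscale c (root_map r t x)" by auto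
qed

lemma oct_aut_root_map: "oct_aut id (root_map r t)"
proof -
  have "root_map r t (root_map r (- t) x) = x" for x
    using root_map_inverse[of r "- t" x] by simp
  then have "bij (root_map r t)"
    using root_map_inverse by (intro o_bij[of "root_map r (- t)"]) (auto simp: fun_eq_iff)
  then show ?thesis
    by (simp add: oct_aut_def root_map_linear root_map_mul)
qed

lemma oct_basis_expansion:
  "(a, d, p1, p2, p3, q1, q2, q3) = oscale a oe + oscale d oe' + oscale p1 ou1 + oscale p2 ou2
     + oscale p3 ou3 + oscale q1 ov1 + oscale q2 ov2 + oscale q3 ov3"
  by simp

text \<open>If y is a preimage of 1, then 1 = \<alpha>(y) = \<alpha>(1 y) = \<alpha>(1) \<alpha>(y)
  = \<alpha>(1).\<close>

lemma oct_aut_one: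
  assumes "oct_aut \<theta> \<alpha>"
  shows "\<alpha> (1, 1, 0, 0, 0, 0, 0, 0) = (1, 1, 0, 0, 0, 0, 0, 0)"
proof -
  have unit: "omul (1, 1, 0, 0, 0, 0, 0, 0) x = x" "omul x (1, 1, 0, 0, 0, 0, 0, 0) = x" for x :: "'a oct"
    by (cases x rule: oct_cases; simp)+
  obtain y where "\<alpha> y = (1, 1, 0, 0, 0, 0, 0, 0)"
    using surjD[OF bij_is_surj[OF oct_autD(1)[OF assms]], of "(1, 1, 0, 0, 0, 0, 0, 0)"]
    by (elim exE) (rule that, rule sym)
  then show ?thesis
    using oct_autD(4)[OF assms, of "(1, 1, 0, 0, 0, 0, 0, 0)" y] by (simp only: unit)
qed

text \<open>The v_i are products of two of the u_i, and 1 - e is fixed by e because automorphisms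
  preserve 1.\<close>

lemma oct_aut_cong_generators:
  assumes "oct_aut \<theta> \<alpha>" "oct_aut \<theta> \<beta>"
    and "\<alpha> oe = \<beta> oe" "\<alpha> ou1 = \<beta> ou1" "\<alpha> ou2 = \<beta> ou2" "\<alpha> ou3 = \<beta> ou3"
  shows "\<alpha> = \<beta>"
proof
  fix x :: "'a oct"
  have "\<alpha> oe' = \<beta> oe'"
  proof -
    have *: "oe' = (1, 1, 0, 0, 0, 0, 0, 0) + - (oe :: 'a oct)"
      by simp
    show ?thesis
      unfolding * oct_autD(2)[OF assms(1)] oct_autD(2)[OF assms(2)] oct_aut_uminus[OF assms(1)]
        oct_aut_uminus[OF assms(2)] oct_aut_one[OF assms(1)] oct_aut_one[OF assms(2)] assms(3) ..
  qed
  moreover have "\<alpha> ov1 = \<beta> ov1" "\<alpha> ov2 = \<beta> ov2" "\<alpha> ov3 = \<beta> ov3"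
  proof -
    have v: "omul ou2 ou3 = (ov1 :: 'a oct)" "omul ou3 ou1 = (ov2 :: 'a oct)" "omul ou1 ou2 = (ov3 :: 'a oct)"
      by simp_all
    show "\<alpha> ov1 = \<beta> ov1" "\<alpha> ov2 = \<beta> ov2" "\<alpha> ov3 = \<beta> ov3"
      by (simp_all only: v[symmetric] oct_autD(4)[OF assms(1)] oct_autD(4)[OF assms(2)] assms)
  qed
  moreover obtain a d p1 p2 p3 q1 q2 q3 where "x = (a, d, p1, p2, p3, q1, q2, q3)"
    by (rule oct_cases[of x])
  note x_sum = trans[OF this oct_basis_expansion]
  ultimately show "\<alpha> x = \<beta> x"
    unfolding x_sum oct_autD(2,3)[OF assms(1)] oct_autD(2,3)[OF assms(2)]
    using assms by simp
qed

section \<open>Elimination by root automorphisms\<close>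

inductive root_product :: "('f::field oct \<Rightarrow> 'f oct) \<Rightarrow> bool" where
  root_product_id: "root_product id"
| root_product_step: "root_product k \<Longrightarrow> root_product (root_map r t \<circ> k)"

lemma root_product_map: "root_product (root_map r t)"
  using root_product_step[OF root_product_id] by simp

lemma root_product_comp: "root_product k \<Longrightarrow> root_product l \<Longrightarrow> root_product (k \<circ> l)"
  by (induction rule: root_product.induct) (auto intro: root_product.intros simp: comp_assoc)

lemma root_product_aut: "root_product k \<Longrightarrow> oct_aut id k"
proof (induction rule: root_product.induct)
  case root_product_id
  show ?case by (rule oct_aut_id)
next
  case (root_product_step k r t)
  show ?case
    using oct_aut_comp[OF oct_aut_root_map root_product_step.IH] by (simp only: comp_id)
qed

text \<open>The set \<open>S\<close> records the vectors already normalised, which later elimination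
  steps must not disturb.\<close>

definition reach :: "'f::field oct set \<Rightarrow> 'f oct \<Rightarrow> 'f oct \<Rightarrow> bool" where
  "reach S x y \<longleftrightarrow> (\<exists>k. root_product k \<and> (\<forall>s\<in>S. k s = s) \<and> k x = y)"

lemma reach_refl: "reach S x x"
  unfolding reach_def by (intro exI[of _ id]) (simp add: root_product_id)

lemma reach_trans [trans]: "reach S x y \<Longrightarrow> reach S y z \<Longrightarrow> reach S x z"
  unfolding reach_def by (elim exE, rule_tac x = "ka \<circ> k" in exI) (auto intro: root_product_comp)

lemma reach_map: "\<forall>s\<in>S. root_map r t s = s \<Longrightarrow> reach S x (root_map r t x)"
  unfolding reach_def using root_product_map by blast

lemma reach_map2:
  assumes "\<forall>s\<in>S. root_map r t s = s" "\<forall>s\<in>S. root_map r' t' s = s"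
  shows "reach S x (root_map r' t' (root_map r t x))"
  by (rule reach_trans[OF reach_map reach_map]) (rule assms)+

text \<open>The long root maps fix e and act on (p1, p2, p3) by elementary 3 by 3 matrices. A
  nonzero entry is first copied to the middle place and then clears the other two.\<close>

lemma reach_p2:
  assumes "(p1, p2, p3) \<noteq> (0, 0, 0)"
  shows "\<exists>c q1' q2' q3'. c \<noteq> 0 \<and>
    reach {oe} (a, d, p1, p2, p3, q1, q2, q3) (a, d, 0, c, 0, q1', q2', q3')"
proof -
  have *: "\<exists>q1' q2' q3'. reach {oe} (a, d, p1, p2, p3, q1, q2, q3) (a, d, 0, p2, 0, q1', q2', q3')"
    if "p2 \<noteq> 0" for p1 p2 p3 q1 q2 q3
    using that reach_map2[of "{oe}" "Pos R01" "- p1 / p2" "Neg R31" "- p3 / p2"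
        "(a, d, p1, p2, p3, q1, q2, q3)"] by auto
  show ?thesis
  proof (cases "p2 = 0")
    case False
    then show ?thesis using *[OF False] by blast
  next
    case True
    show ?thesis
    proof (cases "p3 = 0")
      case False
      have "reach {oe} (a, d, p1, p2, p3, q1, q2, q3) (a, d, p1, p3, p3, q1, q2, q3 - q2)"
        using True reach_map[of "{oe}" "Pos R31" 1 "(a, d, p1, p2, p3, q1, q2, q3)"] by simp
      then show ?thesis
        using *[OF False] False reach_trans by blast
    next
      case p3: True
      then have p1: "p1 \<noteq> 0" using True assms by simp
      have "reach {oe} (a, d, p1, p2, p3, q1, q2, q3) (a, d, p1, p1, p3, q1 - q2, q2, q3)"
        using True reach_map[of "{oe}" "Neg R01" 1 "(a, d, p1, p2, p3, q1, q2, q3)"] by simp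
      then show ?thesis
        using *[OF p1] p1 reach_trans by blast
    qed
  qed
qed

text \<open>The long root maps act on (q1, q2, q3) by the contragredient matrices, so the same
  elimination works; the u-part stays zero throughout.\<close>

lemma reach_q2:
  assumes "(q1, q2, q3) \<noteq> (0, 0, 0)"
  shows "\<exists>c. c \<noteq> 0 \<and> reach {oe} (a, d, 0, 0, 0, q1, q2, q3) (a, d, 0, 0, 0, 0, c, 0)"
proof -
  have *: "reach {oe} (a, d, 0, 0, 0, q1, q2, q3) (a, d, 0, 0, 0, 0, q2, 0)"
    if "q2 \<noteq> 0" for q1 q2 q3
    using that reach_map2[of "{oe}" "Neg R01" "q1 / q2" "Pos R31" "q3 / q2"
        "(a, d, 0, 0, 0, q1, q2, q3)"] by simp
  show ?thesis
  proof (cases "q2 = 0")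
    case False
    then show ?thesis using *[OF False] by blast
  next
    case True
    show ?thesis
    proof (cases "q3 = 0")
      case False
      have "reach {oe} (a, d, 0, 0, 0, q1, q2, q3) (a, d, 0, 0, 0, q1, - q3, q3)"
        using True reach_map[of "{oe}" "Neg R31" 1 "(a, d, 0, 0, 0, q1, q2, q3)"] by simp
      moreover have "- q3 \<noteq> 0" using False by simp
      ultimately show ?thesis
        using *[of "- q3"] reach_trans by blast
    next
      case q3: True
      then have q1: "- q1 \<noteq> 0" using True assms by simp
      have "reach {oe} (a, d, 0, 0, 0, q1, q2, q3) (a, d, 0, 0, 0, q1, - q1, q3)"
        using True reach_map[of "{oe}" "Pos R01" 1 "(a, d, 0, 0, 0, q1, q2, q3)"] by simp
      then show ?thesis
        using *[OF q1] q1 reach_trans by blast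
    qed
  qed
qed

text \<open>A nontrivial idempotent has trace 1 and norm 0. Short root maps move its first
  coordinate to 1, which forces the second to be 0; then the u-part and the v-part are cleared in
  turn.\<close>

lemma reach_idempotent:
  assumes "omul x x = x" "x \<noteq> 0" "x \<noteq> (1, 1, 0, 0, 0, 0, 0, 0)"
  shows "reach {} x oe"
proof -
  have weaken: "reach {} y z" if "reach S y z" for S and y z :: "'a oct"
    using that unfolding reach_def by blast
  define idem where "idem y \<longleftrightarrow> omul y y = y \<and> y \<noteq> 0 \<and> y \<noteq> (1, 1, 0, 0, 0, 0, 0, 0)" for y :: "'a oct"
  \<comment> \<open>Being a nontrivial idempotent survives every step, so the trace and norm
    equations may be invoked again after each of them.\<close>
  have idem_reach: "idem z" if "idem y" and "reach {} y z" for y z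
  proof -
    from \<open>reach {} y z\<close> obtain k where k: "oct_aut id k" "k y = z"
      unfolding reach_def using root_product_aut by blast
    have "omul z z = z"
      using \<open>idem y\<close> oct_autD(4)[OF k(1), of y y] by (simp only: k(2) idem_def)
    moreover have "z = 0 \<longleftrightarrow> y = 0"
      using oct_aut_inj[OF k(1), of y 0] by (simp only: k(2) oct_aut_zero[OF k(1)])
    moreover have "z = (1, 1, 0, 0, 0, 0, 0, 0) \<longleftrightarrow> y = (1, 1, 0, 0, 0, 0, 0, 0)"
      using oct_aut_inj[OF k(1), of y "(1, 1, 0, 0, 0, 0, 0, 0)"]
      by (simp only: k(2) oct_aut_one[OF k(1)])
    ultimately show ?thesis
      using \<open>idem y\<close> unfolding idem_def by blast
  qed
  \<comment> \<open>If the trace is not 1, every off-diagonal coordinate vanishes and only the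
    trivial idempotents 0 and 1 remain.\<close>
  have idem_coords: "a + d = 1 \<and> a * d + (p1 * q1 + p2 * q2 + p3 * q3) = 0"
    if "idem (a, d, p1, p2, p3, q1, q2, q3)" for a d p1 p2 p3 q1 q2 q3
  proof (cases "a + d = 1")
    case True
    then have d: "d = 1 - a" by (simp add: eq_diff_eq add.commute)
    have "a * a - (p1 * q1 + p2 * q2 + p3 * q3) = a"
      using that by (simp add: idem_def)
    then show ?thesis
      by (simp add: d algebra_simps)
  next
    case False
    then have ne: "a + d - 1 \<noteq> 0" by simp
    have "p1 * (a + d - 1) = 0" "p2 * (a + d - 1) = 0" "p3 * (a + d - 1) = 0"
      "q1 * (a + d - 1) = 0" "q2 * (a + d - 1) = 0" "q3 * (a + d - 1) = 0"
      using that by (simp_all add: idem_def algebra_simps)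
    then have "p1 = 0" "p2 = 0" "p3 = 0" "q1 = 0" "q2 = 0" "q3 = 0"
      using ne by simp_all
    then show ?thesis
      using that False by (auto simp: idem_def zero_prod_def)
  qed
  \<comment> \<open>For each off-diagonal coordinate some short root map adds a multiple of it to
    the first coordinate.\<close>
  have step1: "\<exists>d p1 p2 p3 q1 q2 q3. reach {} y (1, d, p1, p2, p3, q1, q2, q3)"
    if y: "y = (a, d, p1, p2, p3, q1, q2, q3)" and ne: "(p1, p2, p3, q1, q2, q3) \<noteq> (0, 0, 0, 0, 0, 0)"
    for y :: "'a oct" and a d p1 p2 p3 q1 q2 q3
  proof -
    consider "p1 \<noteq> 0" | "p2 \<noteq> 0" | "p3 \<noteq> 0" | "q1 \<noteq> 0" | "q2 \<noteq> 0" | "q3 \<noteq> 0"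
      using ne by auto
    then show ?thesis
    proof cases
      case 1
      then show ?thesis
        using reach_map[of "{}" "Neg R11" "(a - 1) / p1" y] by (simp add: y) blast
    next
      case 2
      then show ?thesis
        using reach_map[of "{}" "Neg R10" "(1 - a) / p2" y] by (simp add: y) blast
    next
      case 3
      then show ?thesis
        using reach_map[of "{}" "Pos R21" "(1 - a) / p3" y] by (simp add: y) blast
    next
      case 4
      then show ?thesis
        using reach_map[of "{}" "Pos R11" "(a - 1) / q1" y] by (simp add: y) blast
    next
      case 5
      then show ?thesis
        using reach_map[of "{}" "Pos R10" "(1 - a) / q2" y] by (simp add: y) blast
    next
      case 6
      then show ?thesis
        using reach_map[of "{}" "Neg R21" "(1 - a) / q3" y] by (simp add: y) blast
    qed
  qed
  have x: "idem x" unfolding idem_def using assms by blast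
  obtain a d p1 p2 p3 q1 q2 q3 where x_eq: "x = (a, d, p1, p2, p3, q1, q2, q3)"
    by (rule oct_cases[of x])
  have "\<exists>d p1 p2 p3 q1 q2 q3. reach {} x (1, d, p1, p2, p3, q1, q2, q3)"
  proof (cases "(p1, p2, p3, q1, q2, q3) = (0, 0, 0, 0, 0, 0)")
    case False
    then show ?thesis using step1[OF x_eq] by blast
  next
    case True
    then have zero: "p1 = 0" "p2 = 0" "p3 = 0" "q1 = 0" "q2 = 0" "q3 = 0" by simp_all
    have "a * d = 0" "a + d = 1"
      using idem_coords[OF x[unfolded x_eq]] by (simp_all add: zero)
    then consider "a = 1" "d = 0" | "a = 0" "d = 1" by fastforce
    then show ?thesis
    proof cases
      case 1
      then show ?thesis using reach_refl x_eq by blast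
    next
      case 2
      \<comment> \<open>Here x is 1 - e, which has no off-diagonal coordinate to work with; one root
        map creates one.\<close>
      have "reach {} x (0, 1, 0, - 1, 0, 0, 0, 0)"
        using reach_map[of "{}" "Pos R10" 1 x] by (simp add: x_eq 2 zero)
      note r = this
      have "(0 :: 'a, - 1 :: 'a, 0 :: 'a, 0 :: 'a, 0 :: 'a, 0 :: 'a) \<noteq> (0, 0, 0, 0, 0, 0)"
        by simp
      from step1[OF refl this, of 0 1] show ?thesis
        by (elim exE) (intro exI, rule reach_trans[OF r], assumption)
    qed
  qed
  then obtain d p1 p2 p3 q1 q2 q3 where r0: "reach {} x (1, d, p1, p2, p3, q1, q2, q3)"
    by blast
  have "d = 0"
    using idem_coords[OF idem_reach[OF x r0]] by simp
  then have r1: "reach {} x (1, 0, p1, p2, p3, q1, q2, q3)"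
    using r0 by (simp only:)
  have "\<exists>q1' q2' q3'. reach {} (1, 0, p1, p2, p3, q1, q2, q3) (1, 0, 0, 0, 0, q1', q2', q3')"
  proof (cases "(p1, p2, p3) = (0, 0, 0)")
    case True
    then show ?thesis
      using reach_refl[of "{}" "(1, 0, 0, 0, 0, q1, q2, q3)"] by simp blast
  next
    case False
    obtain c q1' q2' q3' where c0: "c \<noteq> 0" and
      "reach {oe} (1, 0, p1, p2, p3, q1, q2, q3) (1, 0, 0, c, 0, q1', q2', q3')"
      using reach_p2[OF False, of 1 0 q1 q2 q3] by blast
    then have c: "reach {} (1, 0, p1, p2, p3, q1, q2, q3) (1, 0, 0, c, 0, q1', q2', q3')"
      by (intro weaken)
    \<comment> \<open>Norm 0 together with d = 0 and u-part (0, c, 0) gives c q2' = 0. Then the next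
      root map leaves both diagonal coordinates alone.\<close>
    have "q2' = 0"
      using idem_coords[OF idem_reach[OF x reach_trans[OF r1 c]]] c0 by simp
    then have "reach {} (1, 0, 0, c, 0, q1', q2', q3') (1, 0, 0, 0, 0, q1', q2', q3')"
      using reach_map[of "{}" "Pos R10" "- c" "(1, 0, 0, c, 0, q1', q2', q3')"] by simp
    then show ?thesis
      by (rule exI[of _ q1', OF exI[of _ q2', OF exI[of _ q3', OF reach_trans[OF c]]]])
  qed
  then obtain q1' q2' q3' where r2: "reach {} x (1, 0, 0, 0, 0, q1', q2', q3')"
    using reach_trans[OF r1] by blast
  have "reach {} (1, 0, 0, 0, 0, q1', q2', q3') oe"
  proof (cases "(q1', q2', q3') = (0, 0, 0)")
    case True
    then show ?thesis
      using reach_refl[of "{}" oe] by simp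
  next
    case False
    obtain c where "reach {oe} (1, 0, 0, 0, 0, q1', q2', q3') (1, 0, 0, 0, 0, 0, c, 0)"
      using reach_q2[OF False, of 1 0] by blast
    then have c: "reach {} (1, 0, 0, 0, 0, q1', q2', q3') (1, 0, 0, 0, 0, 0, c, 0)"
      by (rule weaken)
    have "reach {} (1, 0, 0, 0, 0, 0, c, 0) oe"
      using reach_map[of "{}" "Neg R10" "- c" "(1, 0, 0, 0, 0, 0, c, 0)"] by simp
    then show ?thesis
      by (rule reach_trans[OF c])
  qed
  then show ?thesis
    by (rule reach_trans[OF r2])
qed
lemma oct_aut_root_product:
  assumes "oct_aut id \<alpha>"
  shows "\<exists>k. root_product k \<and> k \<circ> \<alpha> = id"
proof -
  have step: "\<exists>k. root_product k \<and> oct_aut id (k \<circ> \<beta>) \<and> (\<forall>s\<in>insert x S. (k \<circ> \<beta>) s = s)"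
    if "oct_aut id \<beta>" and "\<forall>s\<in>S. \<beta> s = s" and "reach S (\<beta> x) x" for \<beta> x S
  proof -
    obtain k where k: "root_product k" "\<forall>s\<in>S. k s = s" "k (\<beta> x) = x"
      using \<open>reach S (\<beta> x) x\<close> unfolding reach_def by blast
    moreover have "oct_aut id (k \<circ> \<beta>)"
      using oct_aut_comp[OF root_product_aut[OF k(1)] \<open>oct_aut id \<beta>\<close>] by simp
    moreover have "\<forall>s\<in>insert x S. (k \<circ> \<beta>) s = s"
      using k(2,3) \<open>\<forall>s\<in>S. \<beta> s = s\<close> by simp
    ultimately show ?thesis by blast
  qed
  \<comment> \<open>The span of the u_i is described by multiplication with e, so automorphisms
    fixing e preserve it.\<close>
  have u: "\<exists>p1 p2 p3. \<beta> y = (0, 0, p1, p2, p3, 0, 0, 0)"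
    if "oct_aut id \<beta>" "\<beta> oe = oe" "omul oe y = y" "omul y oe = 0" for \<beta> y
  proof -
    have "omul oe (\<beta> y) = \<beta> y" "omul (\<beta> y) oe = 0"
      using oct_autD(4)[OF that(1), of oe y] oct_autD(4)[OF that(1), of y oe]
      by (simp_all only: that oct_aut_zero[OF that(1)])
    then show ?thesis
      by (cases "\<beta> y" rule: oct_cases) (simp add: zero_prod_def)
  qed

  have "\<alpha> oe \<noteq> 0" "\<alpha> oe \<noteq> (1, 1, 0, 0, 0, 0, 0, 0)"
    using oct_aut_inj[OF assms, of oe 0] oct_aut_inj[OF assms, of oe "(1, 1, 0, 0, 0, 0, 0, 0)"]
    unfolding oct_aut_zero[OF assms] oct_aut_one[OF assms] by (simp_all add: zero_prod_def)
  moreover have "omul oe oe = (oe :: 'a oct)"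
    by simp
  then have "omul (\<alpha> oe) (\<alpha> oe) = \<alpha> oe"
    using oct_autD(4)[OF assms, of oe oe] by (simp only:)
  ultimately have "reach {} (\<alpha> oe) oe"
    by (intro reach_idempotent)
  then obtain k1 where k1: "root_product k1" "oct_aut id (k1 \<circ> \<alpha>)" "\<forall>s\<in>{oe}. (k1 \<circ> \<alpha>) s = s"
    using step[OF assms, of "{}" oe] by auto
  define \<beta> where "\<beta> = k1 \<circ> \<alpha>"
  note \<beta> = k1(2,3)[folded \<beta>_def]

  obtain p1 p2 p3 where p: "\<beta> ou1 = (0, 0, p1, p2, p3, 0, 0, 0)"
    using u[OF \<beta>(1), of ou1] \<beta>(2) by (auto simp: zero_prod_def)
  have "\<beta> ou1 \<noteq> 0"
    using oct_aut_inj[OF \<beta>(1), of ou1 0]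
    unfolding oct_aut_zero[OF \<beta>(1)] by (simp add: zero_prod_def)
  then have "(p1, p2, p3) \<noteq> (0, 0, 0)"
    unfolding p by (auto simp: zero_prod_def)
  from reach_p2[OF this, of 0 0 0 0 0] obtain c q1' q2' q3' where c: "c \<noteq> 0"
    "reach {oe} (0, 0, p1, p2, p3, 0, 0, 0) (0, 0, 0, c, 0, q1', q2', q3')"
    by blast
  obtain k where k: "root_product k" "k oe = oe" "k (\<beta> ou1) = (0, 0, 0, c, 0, q1', q2', q3')"
    using c(2) unfolding reach_def p by auto
  have "oct_aut id (k \<circ> \<beta>)"
    using oct_aut_comp[OF root_product_aut[OF k(1)] \<beta>(1)] by simp
  then have "q1' = 0" "q2' = 0" "q3' = 0"
    using u[of "k \<circ> \<beta>" ou1] k(2,3) \<beta>(2) by (auto simp: zero_prod_def)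
  \<comment> \<open>No single root map rescales a coordinate: c is used to set the first entry to 1,
    and this 1 then clears c.\<close>
  moreover have "reach {oe} (0, 0, 0, c, 0, 0, 0, 0) ou1"
    using reach_map2[of "{oe}" "Pos R01" "1 / c" "Neg R01" "- c" "(0, 0, 0, c, 0, 0, 0, 0)"] c(1)
    by simp
  ultimately have "reach {oe} (\<beta> ou1) ou1"
    unfolding p using c(2) by (auto intro: reach_trans)
  then obtain k2 where k2: "root_product k2" "oct_aut id (k2 \<circ> \<beta>)"
      "\<forall>s\<in>{ou1, oe}. (k2 \<circ> \<beta>) s = s"
    using step[OF \<beta>, of ou1] by auto
  define \<gamma> where "\<gamma> = k2 \<circ> \<beta>"
  note \<gamma> = k2(2,3)[folded \<gamma>_def]

  obtain r1 r2 r3 where r: "\<gamma> ou2 = (0, 0, r1, r2, r3, 0, 0, 0)"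
    using u[OF \<gamma>(1), of ou2] \<gamma>(2) by (auto simp: zero_prod_def)
  \<comment> \<open>As \<gamma> fixes u_1, the case r2 = r3 = 0 would contradict
    injectivity.\<close>
  have "\<gamma> (oscale r1 ou1) \<noteq> \<gamma> ou2"
    unfolding oct_aut_inj[OF \<gamma>(1)] by simp
  then have r0: "(r2, r3) \<noteq> (0, 0)"
    unfolding oct_autD(3)[OF \<gamma>(1)] r using \<gamma>(2) by auto
  have "reach {ou1, oe} (0, 0, r1, r2, r3, 0, 0, 0) ou2"
  proof -
    have *: "reach {ou1, oe} (0, 0, r1, r2, r3, 0, 0, 0) ou2" if "r3 \<noteq> 0" for r1 r2 r3
    proof -
      have "reach {ou1, oe} (0, 0, r1, r2, r3, 0, 0, 0) (0, 0, r1, 1, 0, 0, 0, 0)"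
        using reach_map2[of "{ou1, oe}" "Pos R31" "(1 - r2) / r3" "Neg R31" "- r3" "(0, 0, r1, r2, r3, 0, 0, 0)"] that
        by simp
      moreover have "reach {ou1, oe} (0, 0, r1, 1, 0, 0, 0, 0) ou2"
        using reach_map[of "{ou1, oe}" "Pos R01" "- r1" "(0, 0, r1, 1, 0, 0, 0, 0)"] by simp
      ultimately show ?thesis by (rule reach_trans)
    qed
    show ?thesis
    proof (cases "r3 = 0")
      case False
      then show ?thesis by (rule *)
    next
      case True
      then have "r2 \<noteq> 0" using r0 by simp
      then have "reach {ou1, oe} (0, 0, r1, r2, r2, 0, 0, 0) ou2"
        by (rule *)
      moreover have "reach {ou1, oe} (0, 0, r1, r2, r3, 0, 0, 0) (0, 0, r1, r2, r2, 0, 0, 0)"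
        using reach_map[of "{ou1, oe}" "Neg R31" 1 "(0, 0, r1, r2, r3, 0, 0, 0)"] True by simp
      ultimately show ?thesis by (rule reach_trans[rotated])
    qed
  qed
  then obtain k3 where k3: "root_product k3" "oct_aut id (k3 \<circ> \<gamma>)"
      "\<forall>s\<in>{ou2, ou1, oe}. (k3 \<circ> \<gamma>) s = s"
    using step[OF \<gamma>, of ou2] unfolding r by auto
  define \<delta> where "\<delta> = k3 \<circ> \<gamma>"
  note \<delta> = k3(2,3)[folded \<delta>_def]

  obtain s1 s2 s3 where s: "\<delta> ou3 = (0, 0, s1, s2, s3, 0, 0, 0)"
    using u[OF \<delta>(1), of ou3] \<delta>(2) by (auto simp: zero_prod_def)
  \<comment> \<open>A determinant condition: the triple product of the u_i is a fixed element, which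
    forces the third coordinate of the image of u_3 to be 1.\<close>
  have "omul (omul ou1 ou2) ou3 = (oe + - (1, 1, 0, 0, 0, 0, 0, 0) :: 'a oct)"
    by simp
  then have "omul (omul (\<delta> ou1) (\<delta> ou2)) (\<delta> ou3) = \<delta> oe + - (1, 1, 0, 0, 0, 0, 0, 0)"
    unfolding oct_autD(4)[OF \<delta>(1), symmetric] by (simp only: oct_autD(2)[OF \<delta>(1)]
        oct_aut_uminus[OF \<delta>(1)] oct_aut_one[OF \<delta>(1)])
  then have "s3 = 1"
    unfolding s using \<delta>(2) by simp
  then have "reach {ou2, ou1, oe} (\<delta> ou3) ou3"
    unfolding s using reach_map2[of "{ou2, ou1, oe}" "Pos R32" "- s1" "Pos R31" "- s2"
        "(0, 0, s1, s2, s3, 0, 0, 0)"] by simp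
  then obtain k4 where k4: "root_product k4" "oct_aut id (k4 \<circ> \<delta>)"
      "\<forall>s\<in>{ou3, ou2, ou1, oe}. (k4 \<circ> \<delta>) s = s"
    using step[OF \<delta>, of ou3] by auto
  then have "k4 \<circ> \<delta> = id"
    by (intro oct_aut_cong_generators[OF _ oct_aut_id]) auto
  then have "(k4 \<circ> (k3 \<circ> (k2 \<circ> k1))) \<circ> \<alpha> = id"
    unfolding \<delta>_def \<gamma>_def \<beta>_def by (simp add: comp_assoc)
  moreover have "root_product (k4 \<circ> (k3 \<circ> (k2 \<circ> k1)))"
    using k1 k2 k3 k4 by (intro root_product_comp)
  ultimately show ?thesis by blast
qed

text \<open>\<open>A\<close> is the matrix of conjugation by \<alpha> on the span of the
  derivations; putting \<alpha> inside the argument avoids its inverse.\<close>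

definition acts :: "('f::field oct \<Rightarrow> 'f oct) \<Rightarrow> 'f ^ g2_basis ^ g2_basis \<Rightarrow> ('f \<Rightarrow> 'f) \<Rightarrow> bool" where
  "acts \<alpha> A \<theta> \<longleftrightarrow> oct_aut \<theta> \<alpha> \<and>
     (\<forall>b x. \<alpha> (der b x) = (\<Sum>z\<in>UNIV. oscale (A $ z $ b) (der z (\<alpha> x))))"

lemma field_autD:
  assumes "\<theta> \<in> field_automorphisms"
  shows "bij \<theta>" "\<theta> (x + y) = \<theta> x + \<theta> y" "\<theta> (x * y) = \<theta> x * \<theta> y" "\<theta> 0 = 0" "\<theta> 1 = 1"
    "\<theta> (- x) = - \<theta> x" "\<theta> (x - y) = \<theta> x - \<theta> y"
proof -
  show *: "bij \<theta>" "\<theta> (x + y) = \<theta> x + \<theta> y" "\<theta> (x * y) = \<theta> x * \<theta> y" for x y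
    using assms by (auto simp: field_automorphisms_def)
  show 0: "\<theta> 0 = 0"
    using *(2)[of 0 0] unfolding add_0_right by (rule add_cancel_right_right[THEN iffD1])
  have "\<theta> 1 \<noteq> 0"
    using bij_is_inj[OF *(1)] 0 by (metis injD zero_neq_one)
  then show "\<theta> 1 = 1"
    using *(3)[of 1 1] by simp
  show neg: "\<theta> (- x) = - \<theta> x" for x
    using *(2)[of x "- x"] 0 by (simp add: eq_neg_iff_add_eq_0 add.commute)
  show "\<theta> (x - y) = \<theta> x - \<theta> y"
    using *(2)[of x "- y"] neg[of y] by simp
qed

text \<open>Conjugation by \<alpha> is \<theta>-semilinear on derivations, so \<theta> hits the
  entries of \<open>B\<close>. This is the twist of the semidirect product.\<close>

lemma acts_comp:
  assumes "acts \<alpha> A \<theta>" "acts \<beta> B \<kappa>"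
  shows "acts (\<alpha> \<circ> \<beta>) (A ** map_matrix \<theta> B) (\<theta> \<circ> \<kappa>)"
proof -
  have \<alpha>: "oct_aut \<theta> \<alpha>" "\<alpha> (der b x) = (\<Sum>z\<in>UNIV. oscale (A $ z $ b) (der z (\<alpha> x)))" for b x
    using assms(1) by (auto simp: acts_def)
  have \<beta>: "oct_aut \<kappa> \<beta>" "\<beta> (der b x) = (\<Sum>z\<in>UNIV. oscale (B $ z $ b) (der z (\<beta> x)))" for b x
    using assms(2) by (auto simp: acts_def)
  have "(\<alpha> \<circ> \<beta>) (der b x) = (\<Sum>z\<in>UNIV. oscale ((A ** map_matrix \<theta> B) $ z $ b) (der z ((\<alpha> \<circ> \<beta>) x)))"
    for b x
  proof -
    have "(\<alpha> \<circ> \<beta>) (der b x) =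
        (\<Sum>y\<in>UNIV. \<Sum>z\<in>UNIV. oscale (A $ z $ y * \<theta> (B $ y $ b)) (der z (\<alpha> (\<beta> x))))"
      by (simp add: \<beta>(2) oct_aut_sum[OF \<alpha>(1)] oct_autD(3)[OF \<alpha>(1)] \<alpha>(2) oscale_sum
          oscale_oscale mult.commute)
    also have "\<dots> = (\<Sum>z\<in>UNIV. oscale ((A ** map_matrix \<theta> B) $ z $ b) (der z (\<alpha> (\<beta> x))))"
      by (subst sum.swap) (simp add: matrix_matrix_mult_def map_matrix_def oscale_sum_left)
    finally show ?thesis by simp
  qed
  then show ?thesis
    using oct_aut_comp[OF \<alpha>(1) \<beta>(1)] by (simp add: acts_def)
qed

lemma map_matrix_id: "map_matrix id A = A"
  by (simp add: map_matrix_def vec_eq_iff)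

lemma acts_comp_linear: "acts \<alpha> A id \<Longrightarrow> acts \<beta> B id \<Longrightarrow> acts (\<alpha> \<circ> \<beta>) (A ** B) id"
  using acts_comp[of \<alpha> A id \<beta> B id] by (simp only: map_matrix_id comp_id)

lemma acts_id: "acts (id :: 'f::field oct \<Rightarrow> _) (mat 1) id"
proof -
  have "(\<Sum>z\<in>UNIV. oscale (mat 1 $ z $ b) (der z x)) = (\<Sum>z\<in>UNIV. if z = b then der z x else 0)"
    for b and x :: "'f oct"
    by (intro sum.cong) (auto simp: mat_def)
  then show ?thesis
    by (simp add: acts_def oct_aut_id)
qed

lemma acts_root_map: "acts (root_map r t) (g2_root_element r t) id"
  unfolding acts_def using oct_aut_root_map root_map_der by blast

text \<open>The evaluations below separate the coefficients: every root vector is detected by an entry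
  \<open>\<plusminus>1\<close>, and the two Cartan elements by their values on \<open>u\<^sub>1\<close> and \<open>u\<^sub>3\<close>.\<close>

lemma der_independent:
  assumes "\<And>x. (\<Sum>z\<in>UNIV. oscale (c z) (der z x)) = 0"
  shows "c b = (0 :: 'f::field)"
proof -
  have UNIV: "(\<Sum>z\<in>UNIV. f z) = sum_list (map f basis_list)" for f :: "g2_basis \<Rightarrow> 'f oct"
  proof -
    have "distinct basis_list" by (simp add: basis_list_def)
    then show ?thesis by (simp add: UNIV_basis_list sum_list_distinct_conv_sum_set)
  qed
  note eval = assms[unfolded UNIV basis_list_def, simplified]
  have "\<forall>b. c b = 0"
    unfolding all_basis
    using eval[of oe] eval[of ou1] eval[of ou2] eval[of ou3]
    by (simp add: zero_prod_def)
  then show ?thesis by blast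
qed

lemma acts_unique_matrix:
  assumes "acts \<alpha> A \<theta>" "acts \<alpha> B \<theta>"
  shows "A = B"
proof -
  have "A $ z $ b - B $ z $ b = 0" for z b
  proof (rule der_independent[of "\<lambda>z. A $ z $ b - B $ z $ b"])
    fix y :: "'a oct"
    obtain x where x: "y = \<alpha> x"
      using assms(1) surjD[OF bij_is_surj[OF oct_autD(1)]] unfolding acts_def by blast
    have "oscale (c - d) w = oscale c w - oscale d w" for c d and w :: "'a oct"
      using oscale_add[of "c - d" d w] by simp
    then show "(\<Sum>z\<in>UNIV. oscale (A $ z $ b - B $ z $ b) (der z y)) = 0"
      using assms by (simp add: acts_def sum_subtractf x)
  qed
  then show ?thesis
    by (simp add: vec_eq_iff)
qed

text \<open>The derivations R01 and R32 send u_2 and u_3 to u_1, and their images meet in the line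
  of u_1, so \<alpha> scales u_1 by some c. Further derivations carry the same c to u_2, u_3 and
  v_2, and the product u_3 u_1 = v_2 gives c c = c.\<close>

lemma oct_aut_centralizer:
  assumes "oct_aut id \<alpha>" and comm: "\<And>b x. \<alpha> (der b x) = der b (\<alpha> x)"
  shows "\<alpha> = id"
proof -
  have "\<exists>c. \<alpha> ou1 = oscale c ou1"
    using comm[of "E (Pos R01)" ou2] comm[of "E (Pos R32)" ou3]
    by (cases "\<alpha> ou2" rule: oct_cases, cases "\<alpha> ou3" rule: oct_cases) simp
  then obtain c where u1: "\<alpha> ou1 = (0, 0, c, 0, 0, 0, 0, 0)" by auto
  have u2: "\<alpha> ou2 = (0, 0, 0, c, 0, 0, 0, 0)"
    using comm[of "E (Neg R01)" ou1] by (simp add: u1)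
  have u3: "\<alpha> ou3 = (0, 0, 0, 0, c, 0, 0, 0)"
    using comm[of "E (Neg R32)" ou1] by (simp add: u1)
  have v2: "\<alpha> ov2 = (0, 0, 0, 0, 0, 0, c, 0)"
    using comm[of "E (Pos R11)" ou3] by (simp add: u3)
  have "\<alpha> ov2 = (0, 0, 0, 0, 0, 0, c * c, 0)"
    using oct_autD(4)[OF assms(1), of ou3 ou1] by (simp add: u1 u3)
  moreover have "c \<noteq> 0"
    using oct_aut_inj[OF assms(1), of ou1 0] oct_aut_zero[OF assms(1)] u1
    by (auto simp: zero_prod_def)
  ultimately have c: "c = 1"
    using v2 by simp
  note fixed = u1[unfolded c] u2[unfolded c] u3[unfolded c]
  have "\<alpha> oe = oe"
  proof -
    have *: "oe = - omul ou1 (omul ou2 (ou3 :: 'a oct))" by simp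
    show ?thesis
      unfolding * oct_aut_uminus[OF assms(1)] oct_autD(4)[OF assms(1)] fixed ..
  qed
  then show ?thesis
    by (intro oct_aut_cong_generators[OF assms(1) oct_aut_id]) (simp_all add: fixed)
qed

text \<open>The composite of \<beta> with the inverse of \<alpha> is linear and commutes with all
  the derivations.\<close>

lemma acts_unique_map:
  assumes "acts \<alpha> A \<theta>" "acts \<beta> A \<theta>" "\<theta> \<in> field_automorphisms"
  shows "\<alpha> = \<beta>"
proof -
  have \<alpha>: "oct_aut \<theta> \<alpha>" "\<alpha> (der b x) = (\<Sum>z\<in>UNIV. oscale (A $ z $ b) (der z (\<alpha> x)))" for b x
    using assms(1) by (auto simp: acts_def)
  have \<beta>: "oct_aut \<theta> \<beta>" "\<beta> (der b x) = (\<Sum>z\<in>UNIV. oscale (A $ z $ b) (der z (\<beta> x)))" for b x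
    using assms(2) by (auto simp: acts_def)
  define \<gamma> where "\<gamma> = inv_into UNIV \<alpha> \<circ> \<beta>"
  have \<alpha>\<gamma>: "\<alpha> (\<gamma> x) = \<beta> x" for x
    using surj_f_inv_f[OF bij_is_surj[OF oct_autD(1)[OF \<alpha>(1)]]] by (simp add: \<gamma>_def)
  have "oct_aut (inv_into UNIV \<theta> \<circ> \<theta>) \<gamma>"
    unfolding \<gamma>_def using oct_aut_comp[OF oct_aut_inv[OF \<alpha>(1)] \<beta>(1)] field_autD(1)[OF assms(3)] by simp
  moreover have "inv_into UNIV \<theta> \<circ> \<theta> = id"
    using field_autD(1)[OF assms(3)] by (simp add: bij_is_inj)
  ultimately have "oct_aut id \<gamma>" by simp
  moreover have "\<gamma> (der b x) = der b (\<gamma> x)" for b x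
  proof -
    have "\<alpha> (\<gamma> (der b x)) = \<alpha> (der b (\<gamma> x))"
      by (simp add: \<alpha>\<gamma> \<alpha>(2) \<beta>(2))
    then show ?thesis
      by (simp only: oct_aut_inj[OF \<alpha>(1)])
  qed
  ultimately have "\<gamma> = id" by (rule oct_aut_centralizer)
  then show ?thesis
    using \<alpha>\<gamma> by (simp add: fun_eq_iff)
qed

abbreviation oct_map :: "('f \<Rightarrow> 'f) \<Rightarrow> 'f::field oct \<Rightarrow> 'f oct" where
  "oct_map \<theta> \<equiv> \<lambda>(a, d, p1, p2, p3, q1, q2, q3).
     (\<theta> a, \<theta> d, \<theta> p1, \<theta> p2, \<theta> p3, \<theta> q1, \<theta> q2, \<theta> q3)"

text \<open>The coefficients of the derivations are integers, which field automorphisms fix; hence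
  the identity matrix.\<close>

lemma acts_oct_map:
  assumes "\<theta> \<in> field_automorphisms"
  shows "acts (oct_map \<theta>) (mat 1) \<theta>"
proof -
  note \<theta> = field_autD[OF assms]
  have inv: "\<theta> (inv_into UNIV \<theta> y) = y" "inv_into UNIV \<theta> (\<theta> y) = y" for y
    using \<theta>(1) by (simp_all add: bij_is_surj surj_f_inv_f bij_is_inj)
  have "oct_map (inv_into UNIV \<theta>) (oct_map \<theta> x) = x"
    "oct_map \<theta> (oct_map (inv_into UNIV \<theta>) x) = x" for x
    by (cases x rule: oct_cases; simp add: inv)+
  then have bij: "bij (oct_map \<theta>)"
    by (intro o_bij[of "oct_map (inv_into UNIV \<theta>)"]) (simp_all add: fun_eq_iff)
  have hom: "oct_map \<theta> (x + y) = oct_map \<theta> x + oct_map \<theta> y"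
    "oct_map \<theta> (oscale c x) = oscale (\<theta> c) (oct_map \<theta> x)"
    "oct_map \<theta> (omul x y) = omul (oct_map \<theta> x) (oct_map \<theta> y)" for x y c
    by (cases x rule: oct_cases, cases y rule: oct_cases; simp add: \<theta>)+
  have "\<theta> 2 = 2"
    using \<theta>(2)[of 1 1] \<theta>(5) by simp
  then have all: "\<forall>b. oct_map \<theta> (der b x) = der b (oct_map \<theta> x)" for x
    unfolding all_basis by (cases x rule: oct_cases) (simp add: \<theta>)
  have "oct_map \<theta> (der b x) = (\<Sum>z\<in>UNIV. oscale (mat 1 $ z $ b) (der z (oct_map \<theta> x)))" for b x
  proof -
    have "oct_map \<theta> (der b x) = der b (oct_map \<theta> x)"
      by (rule spec[OF all])
    also have "\<dots> = (\<Sum>z\<in>UNIV. oscale (mat 1 $ z $ b) (der z (oct_map \<theta> x)))"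
      using acts_id unfolding acts_def id_apply by blast
    finally show ?thesis .
  qed
  then show ?thesis
    unfolding acts_def oct_aut_def by (intro conjI allI bij hom)
qed

text \<open>Deduced from the root maps through the uniqueness of the matrix, instead of by
  multiplying 14 by 14 matrices.\<close>

lemma root_element_inverse: "g2_root_element r t ** g2_root_element r (- t) = mat 1"
proof -
  have "acts (root_map r t \<circ> root_map r (- t)) (g2_root_element r t ** g2_root_element r (- t)) id"
    by (intro acts_comp_linear acts_root_map)
  moreover have "root_map r t \<circ> root_map r (- t) = id"
    using root_map_inverse[of r "- t"] by (simp add: fun_eq_iff)
  ultimately show ?thesis
    by (intro acts_unique_matrix[OF _ acts_id]) simp
qed

lemma group_GL: "group (GL_group :: ('f::field ^ 'n ^ 'n) monoid)"
proof (rule groupI)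
  fix A :: "'f ^ 'n ^ 'n"
  assume "A \<in> carrier GL_group"
  then obtain B where "A ** B = mat 1" "B ** A = mat 1"
    by (auto simp: GL_group_def invertible_def)
  then show "\<exists>B\<in>carrier GL_group. B \<otimes>\<^bsub>GL_group\<^esub> A = \<one>\<^bsub>GL_group\<^esub>"
    by (auto simp: GL_group_def invertible_def)
qed (auto simp: GL_group_def invertible_mult matrix_mul_assoc invertible_def[of "mat 1"])

lemma root_element_GL: "g2_root_element r t \<in> carrier GL_group"
  using root_element_inverse[of r t] root_element_inverse[of r "- t"]
  by (auto simp: GL_group_def invertible_def intro!: exI[of _ "g2_root_element r (- t)"])

lemma root_element_inv:
  "inv\<^bsub>GL_group\<^esub> (g2_root_element r t :: 'f::field ^ g2_basis ^ g2_basis) = g2_root_element r (- t)"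
proof -
  interpret GL: group "GL_group :: ('f ^ g2_basis ^ g2_basis) monoid"
    by (rule group_GL)
  show ?thesis
    using root_element_inverse[of r "- t"] root_element_GL[of r t] root_element_GL[of r "- t"]
    by (intro GL.inv_equality) (simp_all add: GL_group_def)
qed

lemma carrier_G2: "carrier G2_group = generate GL_group {g2_root_element r t | r t. True}"
  by (simp add: G2_group_def)

lemma G2_acts:
  assumes "A \<in> carrier G2_group"
  shows "\<exists>\<alpha>. acts \<alpha> A id"
  using assms unfolding carrier_G2
proof (induction rule: generate.induct)
  case one
  show ?case unfolding GL_group_def monoid.simps using acts_id by blast
next
  case (incl h)
  then show ?case using acts_root_map by blast
next
  case (inv h)
  then obtain r t where "h = g2_root_element r t" by blast
  then show ?case
    unfolding root_element_inv using acts_root_map by (simp only: root_element_inv) blast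
next
  case (eng h1 h2)
  then obtain \<alpha> \<beta> where "acts \<alpha> h1 id" "acts \<beta> h2 id" by blast
  from acts_comp_linear[OF this] have "acts (\<alpha> \<circ> \<beta>) (h1 \<otimes>\<^bsub>GL_group\<^esub> h2) id"
    by (simp add: GL_group_def)
  then show ?case by blast
qed

lemma root_product_acts:
  assumes "root_product k"
  shows "\<exists>A\<in>carrier G2_group. acts k A id"
  using assms
proof (induction rule: root_product.induct)
  case root_product_id
  have "mat 1 \<in> carrier G2_group"
    unfolding carrier_G2 using generate.one[of GL_group] by (simp add: GL_group_def)
  then show ?case using acts_id by blast
next
  case (root_product_step k r t)
  then obtain A where A: "A \<in> carrier G2_group" "acts k A id" by blast
  have "acts (root_map r t \<circ> k) (g2_root_element r t ** A) id"
    by (intro acts_comp_linear acts_root_map A)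
  moreover have "g2_root_element r t ** A \<in> carrier G2_group"
    using generate.eng[OF generate.incl A(1)[unfolded carrier_G2], of "g2_root_element r t"]
    unfolding carrier_G2 by (auto simp: GL_group_def)
  ultimately show ?case by blast
qed

text \<open>Elimination yields only a left inverse \<open>k\<close> of a linear automorphism; a
  second elimination, applied to \<open>k\<close>, exhibits the automorphism itself as a root
  product. Semilinear maps are first untwisted by \<open>oct_map\<close>.\<close>

lemma oct_aut_acts:
  assumes "oct_aut \<theta> \<alpha>" "\<theta> \<in> field_automorphisms"
  shows "\<exists>A\<in>carrier G2_group. acts \<alpha> A \<theta>"
proof -
  have linear: "\<exists>A\<in>carrier G2_group. acts \<beta> A id" if \<beta>: "oct_aut id \<beta>" for \<beta> :: "'a oct \<Rightarrow> 'a oct"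
  proof -
    obtain k where k: "root_product k" "k \<circ> \<beta> = id"
      using oct_aut_root_product[OF \<beta>] by blast
    obtain l where l: "root_product l" "l \<circ> k = id"
      using oct_aut_root_product[OF root_product_aut[OF k(1)]] by blast
    have "\<beta> = (l \<circ> k) \<circ> \<beta>"
      by (simp add: l)
    also have "\<dots> = l"
      by (simp add: comp_assoc k)
    finally have "\<beta> = l" .
    then show ?thesis
      using root_product_acts[OF l(1)] by simp
  qed
  define \<beta> where "\<beta> = \<alpha> \<circ> inv_into UNIV (oct_map \<theta>)"
  have map: "oct_aut \<theta> (oct_map \<theta>)"
    using acts_oct_map[OF assms(2)] by (simp add: acts_def)
  have "oct_aut (\<theta> \<circ> inv_into UNIV \<theta>) \<beta>"
    unfolding \<beta>_def by (rule oct_aut_comp[OF assms(1) oct_aut_inv[OF map field_autD(1)[OF assms(2)]]])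
  moreover have "\<theta> \<circ> inv_into UNIV \<theta> = id"
    using field_autD(1)[OF assms(2)] by (simp add: bij_is_surj surj_iff[symmetric])
  ultimately have "oct_aut id \<beta>" by (simp only:)
  from linear[OF this] obtain A where A: "A \<in> carrier G2_group" "acts \<beta> A id"
    by (elim bexE)
  have "acts (\<beta> \<circ> oct_map \<theta>) (A ** map_matrix id (mat 1)) (id \<circ> \<theta>)"
    by (rule acts_comp[OF A(2) acts_oct_map[OF assms(2)]])
  moreover have "\<beta> \<circ> oct_map \<theta> = \<alpha>"
    unfolding \<beta>_def comp_assoc inv_o_cancel[OF bij_is_inj[OF oct_autD(1)[OF map]]] by (rule comp_id)
  ultimately have "acts \<alpha> A \<theta>"
    by (simp only: map_matrix_id matrix_mul_rid id_comp)
  then show ?thesis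
    using A(1) by (rule bexI)
qed

section \<open>The norm under automorphisms, and generators of the norm-one loop\<close>

lemma oct_norm_root_product: "root_product k \<Longrightarrow> oct_norm (k z) = oct_norm z"
proof (induction rule: root_product.induct)
  case (root_product_step k r t)
  have "oct_norm (root_map r t u) = oct_norm u" for u
  proof (cases r)
    case (Pos s)
    then show ?thesis
      by (cases u rule: oct_cases, cases s) (simp_all add: algebra_simps power2_eq_square)
  next
    case (Neg s)
    then show ?thesis
      by (cases u rule: oct_cases, cases s) (simp_all add: algebra_simps power2_eq_square)
  qed
  then show ?case using root_product_step.IH by (simp only: comp_apply)
qed simp

text \<open>Compatibility with the norm is not built into \<open>oct_aut\<close>. It follows
  because, once untwisted, the map is undone by a root product, and root maps preserve the
  norm.\<close>

lemma oct_aut_norm: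
  assumes "oct_aut \<theta> \<beta>" "\<theta> \<in> field_automorphisms"
  shows "oct_norm (\<beta> z) = \<theta> (oct_norm z)"
proof -
  have map: "oct_aut \<theta> (oct_map \<theta>)"
    using acts_oct_map[OF assms(2)] by (simp only: acts_def)
  note bij = oct_autD(1)[OF map] field_autD(1)[OF assms(2)]
  have "oct_aut (\<theta> \<circ> inv_into UNIV \<theta>) (\<beta> \<circ> inv_into UNIV (oct_map \<theta>))"
    by (rule oct_aut_comp[OF assms(1) oct_aut_inv[OF map bij(2)]])
  moreover have "\<theta> \<circ> inv_into UNIV \<theta> = id"
    using bij(2) by (simp add: bij_is_surj surj_iff[symmetric])
  ultimately have "oct_aut id (\<beta> \<circ> inv_into UNIV (oct_map \<theta>))"
    by (simp only:)
  from oct_aut_root_product[OF this] obtain k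
    where k: "root_product k" "k \<circ> (\<beta> \<circ> inv_into UNIV (oct_map \<theta>)) = id"
    by blast
  have "k (\<beta> z) = oct_map \<theta> z"
    using fun_cong[OF k(2), of "oct_map \<theta> z"] inv_f_f[OF bij_is_inj[OF bij(1)], of z]
    by (simp only: comp_apply id_apply)
  then have "oct_norm (\<beta> z) = oct_norm (oct_map \<theta> z)"
    using oct_norm_root_product[OF k(1), of "\<beta> z"] by (simp only:)
  also have "\<dots> = \<theta> (oct_norm z)"
    using field_autD[OF assms(2)] by (cases z rule: oct_cases) simp
  finally show ?thesis .
qed

lemma norm_one_induct:
  assumes mul: "\<And>y z. P y \<Longrightarrow> P z \<Longrightarrow> P (omul y z)"
    and u: "\<And>c. P (1, 1, c, 0, 0, 0, 0, 0)" "\<And>c. P (1, 1, 0, c, 0, 0, 0, 0)" "\<And>c. P (1, 1, 0, 0, c, 0, 0, 0)"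
    and v: "\<And>c. P (1, 1, 0, 0, 0, c, 0, 0)" "\<And>c. P (1, 1, 0, 0, 0, 0, c, 0)" "\<And>c. P (1, 1, 0, 0, 0, 0, 0, c)"
    and norm: "oct_norm x = (1 :: 'f::field)"
  shows "P x"
proof -
  \<comment> \<open>The product of 1 + p2 u_2 and 1 + p3 u_3 has an extra v_1 term p2 p3, which the
    left factor removes.\<close>
  have two_u: "P (1, 1, 0, p2, p3, 0, 0, 0)" for p2 p3
    using mul[OF v(1)[of "- (p2 * p3)"] mul[OF u(2)[of p2] u(3)[of p3]]] by simp
  have two_v: "P (1, 1, 0, 0, 0, 0, q2, q3)" for q2 q3
    using mul[OF u(1)[of "- (q2 * q3)"] mul[OF v(2)[of q2] v(3)[of q3]]] by simp
  have unipotent: "P (1, 1, p1, p2, p3, 0, 0, 0)" for p1 p2 p3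
    using mul[OF u(1)[of p1] mul[OF two_v[of "p1 * p3" "- (p1 * p2)"] two_u[of p2 p3]]]
    by (simp add: algebra_simps)
  have one: "P (1, d, p1, p2, p3, q1, q2, q3)" if "oct_norm (1, d, p1, p2, p3, q1, q2, q3) = 1"
    for d p1 p2 p3 q1 q2 q3
  proof -
    have d: "d = 1 - (p1 * q1 + p2 * q2 + p3 * q3)"
      using that by (simp add: eq_diff_eq)
    \<comment> \<open>The v-part is created by one left factor 1 + q_i v_i at a time. Products of
      the v_i lie in the span of the u_i, so the u-part is shifted in advance to compensate.\<close>
    have 3: "P (1, 1 - r3 * q3, r1, r2, r3, 0, 0, q3)" for r1 r2 r3
      using mul[OF v(3)[of q3] unipotent[of r1 r2 r3]]
      by (simp add: algebra_simps)
    have 2: "P (1, 1 - (r2 * q2 + r3 * q3), r1, r2, r3, 0, q2, q3)" for r1 r2 r3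
      using mul[OF v(2)[of q2] 3[where ?r1.0 = "r1 - q2 * q3" and ?r2.0 = r2 and ?r3.0 = r3]] by (simp add: algebra_simps)
    show ?thesis
      using mul[OF v(1)[of q1] 2[where ?r1.0 = p1 and ?r2.0 = "p2 + q1 * q3" and ?r3.0 = "p3 - q1 * q2"]] by (simp add: d algebra_simps)
  qed
  have q: "P (a, d, p1, p2, p3, q1, q2, q3)"
    if norm: "oct_norm (a, d, p1, p2, p3, q1, q2, q3) = 1" and ne: "(q1, q2, q3) \<noteq> (0, 0, 0)"
    for a d p1 p2 p3 q1 q2 q3
  proof -
    have ad: "a * d + (p1 * q1 + p2 * q2 + p3 * q3) = 1"
      using norm by simp
    consider "q1 \<noteq> 0" | "q2 \<noteq> 0" | "q3 \<noteq> 0"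
      using ne by auto
    then show ?thesis
    proof cases
      case 1
      \<comment> \<open>A left factor 1 + t u_1 turns the first coordinate 1 into 1 - t q1, which
        dictates t. The other factor below is (1 - t u_1) times the given element.\<close>
      define t where "t = (1 - a) / q1"
      have a: "a = 1 - t * q1" using 1 by (simp add: t_def)
      have "P (1, d, p1 - d * t, p2, p3, q1, q2 + t * p3, q3 - t * p2)"
        by (rule one) (use ad in \<open>simp add: a algebra_simps\<close>)
      from mul[OF u(1)[of t] this] show ?thesis
        by (simp add: a algebra_simps)
    next
      case 2
      define t where "t = (1 - a) / q2"
      have a: "a = 1 - t * q2" using 2 by (simp add: t_def)
      have "P (1, d, p1, p2 - d * t, p3, q1 - t * p3, q2, q3 + t * p1)"
        by (rule one) (use ad in \<open>simp add: a algebra_simps\<close>)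
      from mul[OF u(2)[of t] this] show ?thesis
        by (simp add: a algebra_simps)
    next
      case 3
      define t where "t = (1 - a) / q3"
      have a: "a = 1 - t * q3" using 3 by (simp add: t_def)
      have "P (1, d, p1, p2, p3 - d * t, q1 + t * p2, q2 - t * p1, q3)"
        by (rule one) (use ad in \<open>simp add: a algebra_simps\<close>)
      from mul[OF u(3)[of t] this] show ?thesis
        by (simp add: a algebra_simps)
    qed
  qed
  obtain a d p1 p2 p3 q1 q2 q3 where x: "x = (a, d, p1, p2, p3, q1, q2, q3)"
    by (rule oct_cases[of x])
  show ?thesis
  proof (cases "(q1, q2, q3) = (0, 0, 0)")
    case False
    then show ?thesis using q norm unfolding x by blast
  next
    case True
    then have zero: "q1 = 0" "q2 = 0" "q3 = 0" by simp_all
    have ad: "a * d = 1" using norm by (simp add: x zero)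
    then have "a \<noteq> 0" by auto
    \<comment> \<open>This is (1 + v_1) x. Its v_1 coordinate is a, hence nonzero, so the previous
      case applies; multiplying by 1 - v_1 returns to x.\<close>
    have "P (a, d - p1, p1, p2, p3, a, 0, 0)"
      by (rule q) (use ad \<open>a \<noteq> 0\<close> in \<open>simp_all add: algebra_simps\<close>)
    from mul[OF v(1)[of "- 1"] this] show ?thesis
      by (simp add: x zero)
  qed
qed

section \<open>Composition algebras of dimension 8\<close>

datatype tri = I1 | I2 | I3

fun nxt :: "tri \<Rightarrow> tri" where
  "nxt I1 = I2" | "nxt I2 = I3" | "nxt I3 = I1"

instance tri :: finite
proof
  have "(UNIV :: tri set) = {I1, I2, I3}"
    using tri.exhaust by blast
  then show "finite (UNIV :: tri set)"
    by (metis finite.emptyI finite_insert)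
qed

lemma UNIV_tri: "UNIV = {I1, I2, I3}"
  using tri.exhaust by blast

lemma nxt_simps [simp]: "nxt (nxt (nxt i)) = i" "nxt i \<noteq> i" "i \<noteq> nxt i" "nxt (nxt i) \<noteq> i"
  "i \<noteq> nxt (nxt i)" "nxt i = nxt j \<longleftrightarrow> i = j"
  by (cases i; cases j; simp)+

lemma add_eq_minusI: "- a + - b = c \<Longrightarrow> a + b = - (c :: 'g::ab_group_add)"
  by (drule arg_cong[of _ _ uminus]) (simp add: add.commute)

context octonion_algebra
begin

notation mul (infixl "\<star>" 70)

definition B :: "'b \<Rightarrow> 'b \<Rightarrow> 'a" where
  "B u v = N (u + v) - N u - N v"

definition cnj :: "'b \<Rightarrow> 'b" where
  "cnj x = smul (B x unit) unit - x"

lemma mul_simps: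
  "x \<star> (y + z) = x \<star> y + x \<star> z" "(x + y) \<star> z = x \<star> z + y \<star> z"
  "x \<star> smul c y = smul c (x \<star> y)" "smul c x \<star> y = smul c (x \<star> y)"
  "x \<star> 0 = 0" "0 \<star> x = 0" "x \<star> (- y) = - (x \<star> y)" "(- x) \<star> y = - (x \<star> y)"
  "x \<star> (y - z) = x \<star> y - x \<star> z" "(x - y) \<star> z = x \<star> z - y \<star> z"
proof -
  interpret r: Vector_Spaces.linear smul smul "\<lambda>v. x \<star> v" for x
    by (rule mul_linear_right)
  interpret l: Vector_Spaces.linear smul smul "\<lambda>u. u \<star> x" for x
    by (rule mul_linear_left)
  show "x \<star> (y + z) = x \<star> y + x \<star> z" "(x + y) \<star> z = x \<star> z + y \<star> z"
    "x \<star> smul c y = smul c (x \<star> y)" "smul c x \<star> y = smul c (x \<star> y)"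
    "x \<star> 0 = 0" "0 \<star> x = 0" "x \<star> (- y) = - (x \<star> y)" "(- x) \<star> y = - (x \<star> y)"
    "x \<star> (y - z) = x \<star> y - x \<star> z" "(x - y) \<star> z = x \<star> z - y \<star> z"
    by (simp_all add: r.add l.add r.scale l.scale r.zero l.zero r.neg l.neg r.diff l.diff)
qed

lemma B_sym: "B x y = B y x"
  by (simp add: B_def add.commute)

lemma B_simps:
  "B (x + y) z = B x z + B y z" "B x (y + z) = B x y + B x z"
  "B (smul c x) y = c * B x y" "B x (smul c y) = c * B x y"
  "B 0 x = 0" "B x 0 = 0" "B (- x) y = - B x y" "B x (- y) = - B x y"
  "B (x - y) z = B x z - B y z" "B x (y - z) = B x y - B x z"
proof -
  interpret l: Vector_Spaces.linear smul "(*)" "\<lambda>u. B u v" for v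
    unfolding B_def by (rule polar_linear)
  have *: "B (x + y) z = B x z + B y z" "B (smul c x) y = c * B x y" "B 0 x = 0"
    "B (- x) y = - B x y" "B (x - y) z = B x z - B y z" for x y z c
    by (simp_all add: l.add l.scale l.zero l.neg l.diff)
  show "B (x + y) z = B x z + B y z" "B x (y + z) = B x y + B x z"
    "B (smul c x) y = c * B x y" "B x (smul c y) = c * B x y"
    "B 0 x = 0" "B x 0 = 0" "B (- x) y = - B x y" "B x (- y) = - B x y"
    "B (x - y) z = B x z - B y z" "B x (y - z) = B x y - B x z"
    using * by (simp_all add: B_sym[of x])
qed

lemma N_add: "N (x + y) = N x + N y + B x y"
  by (simp add: B_def)

lemma N_zero [simp]: "N 0 = 0"
  using norm_scale[of 0 0] by simp

lemma N_minus [simp]: "N (- x) = N x"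
  using norm_scale[of "- 1" x] by (simp add: scale_minus_left)

lemma N_diff: "N (x - y) = N x + N y - B x y"
  using N_add[of x "- y"] by (simp add: B_simps)

lemma B_self: "B x x = 2 * N x"
proof -
  have "N (x + x) = 4 * N x"
    using norm_scale[of "1 + 1" x] unfolding scale_left_distrib by (simp add: power2_eq_square)
  then show ?thesis by (simp add: B_def)
qed

lemma B_nondegenerate: "(\<And>v. B u v = 0) \<Longrightarrow> u = 0"
  using nondegenerate[of u] dim_8 by (simp add: B_def)

lemma B_eqI: "(\<And>v. B x v = B y v) \<Longrightarrow> x = y"
  using B_nondegenerate[of "x - y"] by (simp add: B_simps)

lemma B_mul_left: "B (x \<star> y) (x \<star> z) = N x * B y z"
  by (simp add: B_def mul_simps(1)[symmetric] norm_mul algebra_simps)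

lemma B_mul_right: "B (y \<star> x) (z \<star> x) = B y z * N x"
  by (simp add: B_def mul_simps(2)[symmetric] norm_mul algebra_simps)

text \<open>Obtained from \<open>B_mul_left\<close> by replacing x with x + z.\<close>

lemma B_exchange: "B (x \<star> y) (z \<star> w) + B (x \<star> w) (z \<star> y) = B x z * B y w"
  using B_mul_left[of "x + z" y w] B_mul_left[of x y w] B_mul_left[of z y w] B_sym[of "z \<star> y"]
  by (simp add: mul_simps B_simps N_add algebra_simps)

text \<open>Multiplicativity leaves only 0 and 1; the value 0 would make N, and with it the
  nondegenerate form B, vanish identically.\<close>

lemma N_unit [simp]: "N unit = 1"
proof -
  have "N unit \<noteq> 0"
  proof
    assume "N unit = 0"
    then have "N x = 0" for x
      using norm_mul[of unit x] by (simp add: unit_left)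
    then have "x = 0" for x :: 'b
      using B_nondegenerate[of x] by (simp add: B_def)
    then have "UNIV = {0 :: 'b}" by blast
    then have "dim (UNIV :: 'b set) = 0"
      using dim_span[of "{}"] dim_eq_card_independent[OF independent_empty] by simp
    then show False using dim_8 by simp
  qed
  then show ?thesis
    using norm_mul[of unit unit] by (simp add: unit_left)
qed

lemma B_unit_unit [simp]: "B unit unit = 2"
  by (simp add: B_self)

lemma cnj_cnj [simp]: "cnj (cnj x) = x"
  by (simp add: cnj_def B_simps algebra_simps)

lemma N_cnj [simp]: "N (cnj x) = N x"
  by (simp add: cnj_def N_diff norm_scale B_simps B_sym[of unit] power2_eq_square)

lemma cnj_add: "cnj (x + y) = cnj x + cnj y"
  by (simp add: cnj_def B_simps scale_left_distrib)

text \<open>The exchange identity with one of its four arguments equal to 1.\<close>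

lemma B_adjoint_left: "B (x \<star> y) z = B y (cnj x \<star> z)"
  using B_exchange[of x y unit z] by (simp add: unit_left cnj_def mul_simps B_simps B_sym algebra_simps)

lemma B_adjoint_right: "B (x \<star> y) z = B x (z \<star> cnj y)"
  using B_exchange[of x y z unit] by (simp add: unit_right cnj_def mul_simps B_simps algebra_simps)

text \<open>The substitute for associativity in everything below: both sides have the same polar
  form with every vector.\<close>

lemma cnj_cancel:
  "cnj x \<star> (x \<star> y) = smul (N x) y" "(y \<star> x) \<star> cnj x = smul (N x) y"
  "x \<star> (cnj x \<star> y) = smul (N x) y" "(y \<star> cnj x) \<star> x = smul (N x) y"
proof -
  have *: "cnj x \<star> (x \<star> y) = smul (N x) y" "(y \<star> x) \<star> cnj x = smul (N x) y" for x
    by (rule B_eqI, simp add: B_adjoint_left[of "cnj x"] B_mul_left B_simps)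
      (rule B_eqI, simp add: B_adjoint_right[of _ "cnj x"] B_mul_right B_simps)
  show "cnj x \<star> (x \<star> y) = smul (N x) y" "(y \<star> x) \<star> cnj x = smul (N x) y"
    "x \<star> (cnj x \<star> y) = smul (N x) y" "(y \<star> cnj x) \<star> x = smul (N x) y"
    using *[of x] *[of "cnj x"] by simp_all
qed

lemma cnj_linearized:
  "cnj x \<star> (y \<star> z) + cnj y \<star> (x \<star> z) = smul (B x y) z"
  "(z \<star> x) \<star> cnj y + (z \<star> y) \<star> cnj x = smul (B x y) z"
proof -
  have "smul (N (x + y)) z = smul (N x) z + smul (N y) z + smul (B x y) z"
    by (simp add: N_add scale_left_distrib)
  then show "cnj x \<star> (y \<star> z) + cnj y \<star> (x \<star> z) = smul (B x y) z"
    "(z \<star> x) \<star> cnj y + (z \<star> y) \<star> cnj x = smul (B x y) z"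
    using cnj_cancel(1)[of "x + y" z] cnj_cancel(2)[of z "x + y"]
    by (simp_all add: cnj_add mul_simps cnj_cancel algebra_simps)
qed

lemma cnj_pure: "B x unit = 0 \<Longrightarrow> cnj x = - x"
  by (simp add: cnj_def)

lemma square: "x \<star> x = smul (B x unit) x - smul (N x) unit"
  using cnj_cancel(1)[of x unit] by (simp add: cnj_def mul_simps unit_left unit_right algebra_simps)

lemma pure_mul:
  assumes "B x unit = 0"
  shows "x \<star> (x \<star> y) = - smul (N x) y" "(y \<star> x) \<star> x = - smul (N x) y"
  using cnj_cancel(1)[of x y] cnj_cancel(2)[of y x]
  by (simp_all add: cnj_pure[OF assms] mul_simps minus_equation_iff eq_commute)

lemma pure_linearized:
  assumes "B x unit = 0" "B y unit = 0"
  shows "x \<star> (y \<star> z) + y \<star> (x \<star> z) = - smul (B x y) z"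
    "(z \<star> x) \<star> y + (z \<star> y) \<star> x = - smul (B x y) z"
    "x \<star> y + y \<star> x = - smul (B x y) unit"
proof -
  show "x \<star> (y \<star> z) + y \<star> (x \<star> z) = - smul (B x y) z" for z
    using cnj_linearized(1)[of x y z]
    by (intro add_eq_minusI) (simp only: cnj_pure assms mul_simps)
  from this[of unit] show "x \<star> y + y \<star> x = - smul (B x y) unit"
    by (simp add: unit_right)
  show "(z \<star> x) \<star> y + (z \<star> y) \<star> x = - smul (B x y) z"
    using cnj_linearized(2)[of z x y]
    by (intro add_eq_minusI) (simp add: cnj_pure assms mul_simps add.commute)
qed

lemma N_mul_unit: "B (x \<star> y) unit = B x (cnj y)"
  by (simp add: B_adjoint_right unit_left)

subsection \<open>Zorn bases\<close>

text \<open>By \<open>square\<close>, these are exactly the elements whose square is zero.\<close>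

definition nil :: "'b \<Rightarrow> bool" where
  "nil n \<longleftrightarrow> N n = 0 \<and> B n unit = 0"

text \<open>Three mutually orthogonal hyperbolic pairs of trace zero; \<open>True\<close> selects
  the u_i and \<open>False\<close> the v_i.\<close>

definition hexad :: "(bool \<Rightarrow> tri \<Rightarrow> 'b) \<Rightarrow> bool" where
  "hexad x \<longleftrightarrow> (\<forall>s i. nil (x s i)) \<and>
     (\<forall>s t i j. B (x s i) (x t j) = (if s \<noteq> t \<and> i = j then 1 else 0))"

text \<open>The products of u_i with v_i in either order are left out: the listed relations
  determine them, see \<open>zorn_opposite\<close>.\<close>

definition zorn :: "(bool \<Rightarrow> tri \<Rightarrow> 'b) \<Rightarrow> bool" where
  "zorn x \<longleftrightarrow> hexad x \<and> (\<forall>s i. x s i \<star> x s (nxt i) = x (\<not> s) (nxt (nxt i))) \<and>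
     (\<forall>s i j. i \<noteq> j \<longrightarrow> x s i \<star> x (\<not> s) j = 0)"

text \<open>The dual family makes the eight vectors independent, the dimension makes them span, and
  the coefficients are read off by duality.\<close>

lemma dual_expansion:
  fixes f g :: "'i::finite \<Rightarrow> 'b"
  assumes dual: "\<And>i j. B (f i) (g j) = (if i = j then 1 else 0)" and card: "CARD('i) = 8"
  shows "z = (\<Sum>i\<in>UNIV. smul (B z (g i)) (f i))"
proof -
  have B_sum: "B (\<Sum>i\<in>I. h i) w = (\<Sum>i\<in>I. B (h i) w)" for I w and h :: "'k \<Rightarrow> 'b"
    by (induction I rule: infinite_finite_induct) (simp_all add: B_simps)
  have coeff: "B (\<Sum>i\<in>UNIV. smul (c i) (f i)) (g j) = c j" for c j
    by (simp add: B_sum B_simps dual if_distrib cong: if_cong)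
  have inj: "inj f"
  proof (rule injI)
    fix i j assume "f i = f j"
    then have "B (f i) (g j) = B (f j) (g j)" by simp
    then show "i = j" by (simp add: dual split: if_splits)
  qed
  have indep: "independent (range f)"
  proof (rule independent_if_scalars_zero)
    fix c x assume sum: "(\<Sum>x\<in>range f. smul (c x) x) = 0" and "x \<in> range f"
    then obtain j where j: "x = f j" by blast
    have "(\<Sum>i\<in>UNIV. smul (c (f i)) (f i)) = 0"
      using sum inj by (simp add: sum.reindex)
    then show "c x = 0"
      using coeff[of "\<lambda>i. c (f i)" j] by (simp add: j B_simps)
  qed simp
  obtain b where b: "independent b" "span b = (UNIV :: 'b set)" "card b = 8"
    using basis_exists[of "UNIV :: 'b set"] dim_8 by (auto simp: top_unique)
  have "finite b" using b(3) by (metis card.infinite zero_neq_numeral)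
  have "span (range f) = UNIV"
  proof (rule ccontr)
    assume "span (range f) \<noteq> UNIV"
    then obtain w where w: "w \<notin> span (range f)" by blast
    then have "independent (insert w (range f))"
      using indep by (simp add: independent_insert)
    then have "card (insert w (range f)) \<le> card b"
      using independent_span_bound[OF \<open>finite b\<close>, of "insert w (range f)"] b(2) by simp
    moreover have "w \<notin> range f"
      using w by (auto intro: span_base)
    then have "card (insert w (range f)) = 9"
      using card inj by (simp add: card_image)
    ultimately show False using b(3) by simp
  qed
  then have "z \<in> span (range f)" by simp
  then show ?thesis
  proof (induction rule: span_induct_alt)
    case base
    show ?case by (simp only: B_simps scale_zero_left sum.neutral_const)
  next
    case (step c x y)
    then obtain j where j: "x = f j" by blast
    have "(\<Sum>i\<in>UNIV. smul (B (f j) (g i)) (f i)) = (\<Sum>i\<in>UNIV. if i = j then f i else 0)"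
      by (intro sum.cong) (simp_all add: dual)
    then have "smul c x = smul c (\<Sum>i\<in>UNIV. smul (B x (g i)) (f i))"
      by (simp add: j)
    also have "\<dots> = (\<Sum>i\<in>UNIV. smul (B (smul c x) (g i)) (f i))"
      by (simp only: scale_sum_right scale_scale B_simps)
    finally have sum: "smul c x + y = (\<Sum>i\<in>UNIV. smul (B (smul c x) (g i)) (f i))
        + (\<Sum>i\<in>UNIV. smul (B y (g i)) (f i))"
      using step.IH by (simp only:)
    show ?case
      unfolding B_simps(1) scale_left_distrib sum.distrib by (rule sum)
  qed
qed

lemma card_index: "CARD(bool \<times> tri option) = 8"
proof -
  have "CARD(tri) = 3"
    by (simp add: UNIV_tri)
  then show ?thesis
    by (simp add: card_UNIV_option)
qed

lemma hexadD:
  assumes "hexad x"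
  shows "N (x s i) = 0" "B (x s i) unit = 0" "B unit (x s i) = 0"
    "B (x s i) (x t j) = (if s \<noteq> t \<and> i = j then 1 else 0)"
  using assms B_sym[of unit] by (auto simp: hexad_def nil_def)

lemma zornD:
  assumes "zorn x"
  shows "hexad x" "x s i \<star> x s (nxt i) = x (\<not> s) (nxt (nxt i))" "i \<noteq> j \<Longrightarrow> x s i \<star> x (\<not> s) j = 0"
    "x s (nxt i) \<star> x s i = - x (\<not> s) (nxt (nxt i))" "x s i \<star> x s i = 0"
proof -
  show *: "hexad x" "x s i \<star> x s (nxt i) = x (\<not> s) (nxt (nxt i))"
    "i \<noteq> j \<Longrightarrow> x s i \<star> x (\<not> s) j = 0"
    using assms by (auto simp: zorn_def)
  note h = hexadD[OF *(1)]
  show "x s (nxt i) \<star> x s i = - x (\<not> s) (nxt (nxt i))"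
    using pure_linearized(3)[OF h(2) h(2), of s i s "nxt i"] *(2) h(4)[of s i s "nxt i"]
    by (simp add: eq_neg_iff_add_eq_0 add.commute)
  show "x s i \<star> x s i = 0"
    using square[of "x s i"] h by simp
qed

definition idem :: "(bool \<Rightarrow> tri \<Rightarrow> 'b) \<Rightarrow> 'b" where
  "idem x = - (x True I1 \<star> x False I1)"

lemma zorn_opposite:
  assumes "zorn x"
  shows "x True i \<star> x False i = - idem x" "x False i \<star> x True i = idem x - unit"
proof -
  note z = zornD[OF assms] and h = hexadD[OF zornD(1)[OF assms]]
  \<comment> \<open>With v_i = u_{i+1} u_{i+2} and v_{i+1} = - u_i u_{i+2}, this is the linearised
    alternative law for the orthogonal elements u_i and u_{i+1}.\<close>
  have step: "x True (nxt i) \<star> x False (nxt i) = x True i \<star> x False i" for i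
  proof -
    have 1: "x True (nxt i) \<star> x True (nxt (nxt i)) = x False i"
      using z(2)[of True "nxt i"] by simp
    have 2: "x True i \<star> x True (nxt (nxt i)) = - x False (nxt i)"
      using z(4)[of True "nxt (nxt i)"] by simp
    show ?thesis
      using pure_linearized(1)[OF h(2) h(2), of True i True "nxt i" "x True (nxt (nxt i))"]
      by (simp add: 1 2 mul_simps h(4))
  qed
  have 1: "x True I1 \<star> x False I1 = - idem x"
    by (simp add: idem_def)
  show *: "x True i \<star> x False i = - idem x"
    using 1 step[of I1] step[of I2] by (cases i) simp_all
  show "x False i \<star> x True i = idem x - unit"
    using pure_linearized(3)[OF h(2) h(2), of True i False i] h(4)[of True i False i] *
    by (simp add: algebra_simps)
qed

lemma zorn_idem:
  assumes "zorn x"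
  shows "B (idem x) unit = 1" "N (idem x) = 0" "idem x \<star> idem x = idem x"
    "idem x \<star> x s i = (if s then x s i else 0)" "x s i \<star> idem x = (if s then 0 else x s i)"
    "B (idem x) (x s i) = 0"
proof -
  note z = zornD[OF assms] and h = hexadD[OF zornD(1)[OF assms]]
  note e = zorn_opposite(1)[OF assms, symmetric, unfolded neg_equal_iff_equal]
  have e': "idem x = - (x True i \<star> x False i)" for i
    by (simp add: zorn_opposite(1)[OF assms])
  show tr: "B (idem x) unit = 1"
    by (simp add: idem_def B_simps N_mul_unit cnj_pure h)
  show N: "N (idem x) = 0"
    by (simp add: idem_def norm_mul h)
  show "idem x \<star> idem x = idem x"
    using square[of "idem x"] tr N by simp
  have u: "idem x \<star> x True i = x True i" for i
    using pure_linearized(2)[OF h(2) h(2), of "x True i" False i True i]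
    by (simp add: e'[of i] mul_simps z(5) h(4))
  have v: "idem x \<star> x False i = 0" for i
    by (simp add: e'[of i] mul_simps pure_mul h)
  have u': "x True i \<star> idem x = 0" for i
    by (simp add: e'[of i] mul_simps pure_mul h)
  have v': "x False i \<star> idem x = x False i" for i
    using pure_linearized(1)[OF h(2) h(2), of False i True i "x False i"]
    by (simp add: e'[of i] mul_simps z(5) h(4))
  show "idem x \<star> x s i = (if s then x s i else 0)" "x s i \<star> idem x = (if s then 0 else x s i)"
    using u v u' v' by (cases s; simp)+
  show "B (idem x) (x s i) = 0"
  proof (cases s)
    case True
    have "B (idem x) (x True i) = B (idem x \<star> unit) (idem x \<star> x True i)"
      by (simp add: u unit_right)
    then show ?thesis using True by (simp add: B_mul_left N)
  next
    case False
    have "B (idem x) (x False i) = B (unit \<star> idem x) (x False i \<star> idem x)"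
      by (simp add: v' unit_left)
    then show ?thesis using False by (simp add: B_mul_right N)
  qed
qed

fun zmap :: "(bool \<Rightarrow> tri \<Rightarrow> 'b) \<Rightarrow> 'a oct \<Rightarrow> 'b" where
  "zmap x (a, d, p1, p2, p3, q1, q2, q3) = smul a (idem x) + smul d (unit - idem x)
     + smul p1 (x True I1) + smul p2 (x True I2) + smul p3 (x True I3)
     + smul q1 (x False I1) + smul q2 (x False I2) + smul q3 (x False I3)"

definition oct_iso :: "('a oct \<Rightarrow> 'b) \<Rightarrow> bool" where
  "oct_iso \<phi> \<longleftrightarrow> bij \<phi> \<and> (\<forall>x y. \<phi> (x + y) = \<phi> x + \<phi> y) \<and>
     (\<forall>c x. \<phi> (oscale c x) = smul c (\<phi> x)) \<and> (\<forall>x y. \<phi> (omul x y) = \<phi> x \<star> \<phi> y) \<and>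
     (\<forall>x. N (\<phi> x) = oct_norm x)"

lemma zmap_linear: "zmap x (y + z) = zmap x y + zmap x z" "zmap x (oscale c y) = smul c (zmap x y)"
proof -
  show "zmap x (y + z) = zmap x y + zmap x z"
    by (cases y rule: oct_cases, cases z rule: oct_cases) (simp add: scale_left_distrib)
  show "zmap x (oscale c y) = smul c (zmap x y)"
    by (cases y rule: oct_cases) (simp add: scale_right_distrib)
qed

lemma zmap_mul:
  assumes "zorn x"
  shows "zmap x (omul y z) = zmap x y \<star> zmap x z"
proof -
  note zo = zornD[OF assms] zorn_opposite[OF assms] zorn_idem[OF assms]
  have prods: "x s I1 \<star> x s I2 = x (\<not> s) I3" "x s I2 \<star> x s I3 = x (\<not> s) I1" "x s I3 \<star> x s I1 = x (\<not> s) I2"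
    "x s I2 \<star> x s I1 = - x (\<not> s) I3" "x s I3 \<star> x s I2 = - x (\<not> s) I1" "x s I1 \<star> x s I3 = - x (\<not> s) I2" for s
    using zo(2)[of s I1] zo(2)[of s I2] zo(2)[of s I3] zo(4)[of s I1] zo(4)[of s I2] zo(4)[of s I3]
    by simp_all
  have zero: "x True i \<star> x False j = 0" "x False i \<star> x True j = 0" if "i \<noteq> j" for i j
    using zo(3)[OF that, of True] zo(3)[OF that, of False] by simp_all
  note rules = mul_simps prods zero zo(5,6,7,8,9,10,11,12) unit_left unit_right
    scale_right_diff_distrib scale_left_diff_distrib scale_left_distrib scale_right_distrib
  obtain a d p1 p2 p3 q1 q2 q3 where y: "y = (a, d, p1, p2, p3, q1, q2, q3)"
    by (rule oct_cases[of y])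
  obtain a' d' p1' p2' p3' q1' q2' q3' where z: "z = (a', d', p1', p2', p3', q1', q2', q3')"
    by (rule oct_cases[of z])
  have "idem x \<star> zmap x z = zmap x (omul oe z)" "(unit - idem x) \<star> zmap x z = zmap x (omul oe' z)"
    "x True I1 \<star> zmap x z = zmap x (omul ou1 z)" "x True I2 \<star> zmap x z = zmap x (omul ou2 z)"
    "x True I3 \<star> zmap x z = zmap x (omul ou3 z)" "x False I1 \<star> zmap x z = zmap x (omul ov1 z)"
    "x False I2 \<star> zmap x z = zmap x (omul ov2 z)" "x False I3 \<star> zmap x z = zmap x (omul ov3 z)"
    unfolding z by (simp_all add: rules)
  note left = this
  have "zmap x y \<star> zmap x z = smul a (zmap x (omul oe z)) + smul d (zmap x (omul oe' z))
     + smul p1 (zmap x (omul ou1 z)) + smul p2 (zmap x (omul ou2 z)) + smul p3 (zmap x (omul ou3 z))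
     + smul q1 (zmap x (omul ov1 z)) + smul q2 (zmap x (omul ov2 z)) + smul q3 (zmap x (omul ov3 z))"
    unfolding y zmap.simps(1)[of x a] mul_simps(2,4) left ..
  also have "\<dots> = zmap x (oscale a (omul oe z) + oscale d (omul oe' z) + oscale p1 (omul ou1 z)
     + oscale p2 (omul ou2 z) + oscale p3 (omul ou3 z) + oscale q1 (omul ov1 z)
     + oscale q2 (omul ov2 z) + oscale q3 (omul ov3 z))"
    by (simp only: zmap_linear)
  also have "oscale a (omul oe z) + oscale d (omul oe' z) + oscale p1 (omul ou1 z)
     + oscale p2 (omul ou2 z) + oscale p3 (omul ou3 z) + oscale q1 (omul ov1 z)
     + oscale q2 (omul ov2 z) + oscale q3 (omul ov3 z) = omul y z"
    unfolding y z by (simp add: algebra_simps)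
  finally show ?thesis ..
qed

lemma B_idem_idem:
  assumes "zorn x"
  shows "B (idem x) (idem x) = 0" "B (idem x) (unit - idem x) = 1" "B (unit - idem x) (idem x) = 1"
    "B (unit - idem x) (unit - idem x) = 0" "N (unit - idem x) = 0" "B (unit - idem x) (x s i) = 0"
proof -
  note e = zorn_idem(1,2,6)[OF assms] and h = hexadD[OF zornD(1)[OF assms]]
  have e': "B unit (idem x) = 1"
    using e(1) by (simp add: B_sym)
  show "B (idem x) (idem x) = 0" "B (idem x) (unit - idem x) = 1" "B (unit - idem x) (idem x) = 1"
    "B (unit - idem x) (unit - idem x) = 0" "N (unit - idem x) = 0" "B (unit - idem x) (x s i) = 0"
    by (simp_all add: N_diff B_simps(9,10) B_self[of "idem x"] e e' h)
qed

lemma zmap_norm: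
  assumes "zorn x"
  shows "N (zmap x y) = oct_norm y"
proof -
  note h = hexadD[OF zornD(1)[OF assms]]
  define e where "e = unit - idem x"
  have e: "N e = 0" "B (idem x) e = 1" "B e (idem x) = 1" "B e (x s i) = 0" for s i
    unfolding e_def by (rule B_idem_idem[OF assms])+
  obtain a d p1 p2 p3 q1 q2 q3 where y: "y = (a, d, p1, p2, p3, q1, q2, q3)"
    by (rule oct_cases[of y])
  show ?thesis
    unfolding y zmap.simps e_def[symmetric]
    by (simp add: N_add norm_scale B_simps e h(1,4) zorn_idem(2,6)[OF assms] algebra_simps)
qed

lemma zmap_iso:
  assumes "zorn x"
  shows "oct_iso (zmap x)"
proof -
  note h = hexadD[OF zornD(1)[OF assms]]
  have B_idem: "B (x s i) (idem x) = 0" "B (idem x) (x s i) = 0"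
      "B (x s i) (unit - idem x) = 0" "B (unit - idem x) (x s i) = 0" for s i
    using zorn_idem(6)[OF assms] B_idem_idem(6)[OF assms]
    by (simp_all add: B_sym[of _ "idem x"] B_sym[of _ "unit - idem x"])
  note gram = h(4) B_idem B_idem_idem[OF assms]
  define e where "e = unit - idem x"
  have coords: "B (zmap x (a, d, p1, p2, p3, q1, q2, q3)) e = a"
    "B (zmap x (a, d, p1, p2, p3, q1, q2, q3)) (idem x) = d"
    "B (zmap x (a, d, p1, p2, p3, q1, q2, q3)) (x False I1) = p1"
    "B (zmap x (a, d, p1, p2, p3, q1, q2, q3)) (x False I2) = p2"
    "B (zmap x (a, d, p1, p2, p3, q1, q2, q3)) (x False I3) = p3"
    "B (zmap x (a, d, p1, p2, p3, q1, q2, q3)) (x True I1) = q1"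
    "B (zmap x (a, d, p1, p2, p3, q1, q2, q3)) (x True I2) = q2"
    "B (zmap x (a, d, p1, p2, p3, q1, q2, q3)) (x True I3) = q3"
    for a d p1 p2 p3 q1 q2 q3
    unfolding zmap.simps e_def[symmetric]
    by (simp_all add: B_simps(1,3) gram[folded e_def])
  have "y = z" if eq: "zmap x y = zmap x z" for y z :: "'a oct"
  proof -
    obtain a d p1 p2 p3 q1 q2 q3 where y: "y = (a, d, p1, p2, p3, q1, q2, q3)"
      by (rule oct_cases[of y])
    obtain a' d' p1' p2' p3' q1' q2' q3' where z: "z = (a', d', p1', p2', p3', q1', q2', q3')"
      by (rule oct_cases[of z])
    note coords[of a d p1 p2 p3 q1 q2 q3, folded y, unfolded eq, unfolded z coords]
    then show ?thesis
      unfolding y z by (simp only:)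
  qed
  then have inj: "inj (zmap x)" by (rule injI)
  \<comment> \<open>The whole basis in one family: \<open>None\<close> stands for the two
    idempotents. Flipping the Boolean gives the dual family \<open>g\<close>.\<close>
  define f where "f p = (case p of (s, None) \<Rightarrow> if s then idem x else unit - idem x
    | (s, Some i) \<Rightarrow> x s i)" for p
  define g where "g p = f (\<not> fst p, snd p)" for p
  have dual: "B (f p) (g q) = (if p = q then 1 else 0)" for p q
    by (cases p; cases q; cases "snd p"; cases "snd q") (auto simp: f_def g_def gram)
  have "z \<in> range (zmap x)" for z :: 'b
  proof -
    have "z = (\<Sum>p\<in>UNIV. smul (B z (g p)) (f p))"
      using dual_expansion[OF dual card_index] .
    also have "\<dots> \<in> range (zmap x)"
    proof -
      have smul: "smul c (f p) \<in> range (zmap x)" for c p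
      proof -
        have "f p \<in> range (zmap x)"
        proof (cases p)
          case (Pair s k)
          show ?thesis
          proof (cases k)
            case None
            then have "f p = zmap x (if s then oe else oe')"
              by (simp add: f_def Pair)
            then show ?thesis by blast
          next
            case (Some i)
            have "f p = zmap x (case i of I1 \<Rightarrow> if s then ou1 else ov1
                | I2 \<Rightarrow> if s then ou2 else ov2 | I3 \<Rightarrow> if s then ou3 else ov3)"
              by (cases i) (simp_all add: f_def Pair Some)
            then show ?thesis by blast
          qed
        qed
        then obtain y where "f p = zmap x y" by blast
        then have "smul c (f p) = zmap x (oscale c y)"
          by (simp only: zmap_linear)
        then show ?thesis by blast
      qed
      have zero: "0 \<in> range (zmap x)"
        by (rule image_eqI[of _ _ "(0, 0, 0, 0, 0, 0, 0, 0)"]) simp_all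
      have "(\<Sum>p\<in>I. smul (c p) (f p)) \<in> range (zmap x)" for I c
      proof (induction I rule: infinite_finite_induct)
        case (insert p I)
        then obtain y y' where "smul (c p) (f p) = zmap x y" "(\<Sum>p\<in>I. smul (c p) (f p)) = zmap x y'"
          using smul by blast
        then have "(\<Sum>p\<in>insert p I. smul (c p) (f p)) = zmap x (y + y')"
          by (simp only: zmap_linear sum.insert[OF insert.hyps])
        then show ?case by blast
      next
        case (infinite I)
        then show ?case using zero by (simp only: sum.infinite[OF infinite.hyps])
      next
        case empty
        show ?case using zero by (simp only: sum.empty)
      qed
      then show ?thesis .
    qed
    finally show ?thesis .
  qed
  then have "bij (zmap x)"
    using inj by (simp add: bij_def subset_antisym subset_iff)
  then show ?thesis
    by (simp only: oct_iso_def zmap_linear zmap_mul[OF assms] zmap_norm[OF assms] simp_thms)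
qed

text \<open>If w were nonzero, a partner z of w would complete the hexad to a basis. Since 1 is
  orthogonal to the hexad and to w, expanding 1 in this basis would make it a multiple of w, against
  N 1 = 1.\<close>

lemma isotropic_orthogonal_hexad:
  assumes hx: "hexad x" and w: "B w unit = 0" "N w = 0" "\<And>s i. B w (x s i) = 0"
  shows "w = 0"
proof (rule ccontr)
  assume "w \<noteq> 0"
  note h = hexadD[OF hx]
  obtain z0 where z0: "B w z0 \<noteq> 0"
    using B_nondegenerate[of w] \<open>w \<noteq> 0\<close> by blast
  define z1 where "z1 = smul (1 / B w z0) z0"
  have z1: "B w z1 = 1"
    using z0 by (simp add: z1_def B_simps)
  define z where "z = z1 - (smul (B z1 (x False I1)) (x True I1) + smul (B z1 (x False I2)) (x True I2)
     + smul (B z1 (x False I3)) (x True I3) + smul (B z1 (x True I1)) (x False I1)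
     + smul (B z1 (x True I2)) (x False I2) + smul (B z1 (x True I3)) (x False I3))"
  have zw: "B w z = 1" "B z w = 1"
    by (simp_all add: z_def B_simps w z1 B_sym[of _ w])
  have zx: "B z (x s i) = 0" "B (x s i) z = 0" for s i
    by (cases s; cases i; simp add: z_def B_simps h(4) B_sym[of _ z1])+
  define f where "f p = (case p of (s, None) \<Rightarrow> if s then w else z | (s, Some i) \<Rightarrow> x s i)" for p
  \<comment> \<open>The vector dual to w has to be orthogonal to z, and B z z = 2 N z explains the
    correction by 2 N z times w.\<close>
  define g where "g p = (case p of (s, None) \<Rightarrow> if s then z - smul (2 * N z) w else w
     | (s, Some i) \<Rightarrow> x (\<not> s) i)" for p
  have wx: "B (x s i) w = 0" for s i
    using w(3) B_sym by simp
  have dual: "B (f p) (g q) = (if p = q then 1 else 0)" for p q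
    by (cases p; cases q; cases "snd p"; cases "snd q")
      (auto simp: f_def g_def h(4) zx zw w wx B_simps B_self)
  have "B unit (g p) = 0" if "p \<noteq> (True, None)" for p
    using that by (cases p; cases "snd p") (auto simp: g_def h w B_sym[of unit])
  then have "unit = (\<Sum>p\<in>UNIV. if p = (True, None) then smul (B unit (g p)) (f p) else 0)"
    by (subst dual_expansion[OF dual card_index, of unit]) (intro sum.cong, auto)
  then have "unit = smul (B unit (g (True, None))) w"
    by (simp add: f_def)
  then have "N unit = 0"
    using norm_scale w(2) by (metis mult_zero_right)
  then show False by simp
qed

section \<open>Peirce spaces of an element of norm 0 and trace 1\<close>

context
  fixes e :: 'b
  assumes e: "N e = 0" "B e unit = 1"
begin

lemma e_conj: "cnj e = unit - e"
  using e by (simp add: cnj_def)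

definition peirce_u :: "'b \<Rightarrow> bool" where
  "peirce_u u \<longleftrightarrow> B u unit = 0 \<and> e \<star> u = u"

definition peirce_v :: "'b \<Rightarrow> bool" where
  "peirce_v v \<longleftrightarrow> B v unit = 0 \<and> e \<star> v = 0"

lemma peirce_u:
  assumes "peirce_u u"
  shows "B u unit = 0" "e \<star> u = u" "N u = 0" "B u e = 0" "u \<star> e = 0"
proof -
  show u: "B u unit = 0" "e \<star> u = u"
    using assms by (auto simp: peirce_u_def)
  show "N u = 0"
    using norm_mul[of e u] u e by simp
  show Be: "B u e = 0"
    using B_mul_left[of e u unit] u e by (simp add: unit_right)
  show "u \<star> e = 0"
    using cnj_linearized(2)[of unit u e] u Be
    by (simp add: unit_left e_conj cnj_pure mul_simps unit_right)
qed

lemma peirce_v: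
  assumes "peirce_v v"
  shows "B v unit = 0" "e \<star> v = 0" "N v = 0" "B v e = 0" "v \<star> e = v"
proof -
  show v: "B v unit = 0" "e \<star> v = 0"
    using assms by (auto simp: peirce_v_def)
  show "N v = 0"
    using norm_mul[of "unit - e" v] v e B_sym[of unit e] by (simp add: mul_simps unit_left N_diff)
  show Be: "B v e = 0"
    using B_adjoint_left[of e unit v] v B_sym[of e v] B_sym[of unit v]
    by (simp add: unit_right e_conj mul_simps unit_left)
  show "v \<star> e = v"
    using cnj_linearized(2)[of unit v e] v Be
    by (simp add: unit_left e_conj cnj_pure mul_simps unit_right)
qed

text \<open>Left multiplication by e fixes u v and kills v u, while u v + v u is the scalar - B u v.
  Multiplying this sum by e isolates u v.\<close>

lemma peirce_opposite:
  assumes u: "peirce_u u" and v: "peirce_v v"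
  shows "u \<star> v = - smul (B u v) e" "v \<star> u = smul (B u v) (e - unit)"
proof -
  note u = peirce_u[OF u] and v = peirce_v[OF v]
  have 1: "e \<star> (u \<star> v) = u \<star> v"
    using cnj_linearized(1)[of "cnj e" u v] u v B_sym[of unit u] B_sym[of e u]
    by (simp add: e_conj cnj_pure mul_simps unit_left B_simps e[unfolded e_conj])
      (simp add: cnj_def B_simps e mul_simps unit_left)
  have 2: "e \<star> (v \<star> u) = 0"
    using cnj_linearized(1)[of "cnj e" v u] u v B_sym[of unit v] B_sym[of e v]
    by (simp add: e_conj cnj_pure mul_simps unit_left B_simps)
      (simp add: cnj_def B_simps e mul_simps unit_left)
  have sum: "u \<star> v + v \<star> u = - smul (B u v) unit"
    using pure_linearized(3) u v by blast
  then have "e \<star> (u \<star> v) + e \<star> (v \<star> u) = - smul (B u v) e"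
    by (simp add: mul_simps(1)[symmetric]) (simp add: mul_simps unit_right)
  then show uv: "u \<star> v = - smul (B u v) e"
    by (simp add: 1 2)
  show "v \<star> u = smul (B u v) (e - unit)"
    using sum unfolding uv by (simp add: algebra_simps)
qed

lemma peirce_same:
  assumes u: "peirce_u u" "peirce_u u'" and v: "peirce_v v" "peirce_v v'"
  shows "B u u' = 0" "B v v' = 0" "peirce_v (u \<star> u')" "peirce_u (v \<star> v')"
proof -
  note u = peirce_u[OF u(1)] peirce_u[OF u(2)] and v = peirce_v[OF v(1)] peirce_v[OF v(2)]
  show Bu: "B u u' = 0"
    using B_mul_left[of e u u'] u e by simp
  show Bv: "B v v' = 0"
    using B_mul_right[of v e v'] v e by simp
  have "e \<star> (u \<star> u') = 0"
    using cnj_linearized(1)[of "cnj e" u u'] u B_sym[of unit u] B_sym[of e u]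
    by (simp add: e_conj cnj_pure mul_simps unit_left B_simps)
      (simp add: cnj_def B_simps e mul_simps unit_left)
  then show "peirce_v (u \<star> u')"
    using Bu u by (simp add: peirce_v_def N_mul_unit cnj_pure B_simps)
  have "v \<star> v' - e \<star> (v \<star> v') = 0"
    using cnj_linearized(1)[of e v v'] v B_sym[of e v]
    by (simp add: e_conj cnj_pure mul_simps unit_left)
  then show "peirce_u (v \<star> v')"
    using Bv v by (simp add: peirce_u_def N_mul_unit cnj_pure B_simps)
qed

text \<open>Two hyperbolic pairs suffice: the third is formed by the products v1 v2 and u1 u2, and
  the other products follow from the linearised alternative laws.\<close>

lemma zorn_from_pairs:
  assumes u1: "peirce_u u1" and u2: "peirce_u u2" and v1: "peirce_v v1" and v2: "peirce_v v2"
    and gram: "B u1 v1 = 1" "B u1 v2 = 0" "B u2 v1 = 0" "B u2 v2 = 1"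
  shows "\<exists>x. zorn x \<and> x True I1 = u1"
proof -
  define u3 where "u3 = v1 \<star> v2"
  define v3 where "v3 = u1 \<star> u2"
  define x where "x s i = (if s then (case i of I1 \<Rightarrow> u1 | I2 \<Rightarrow> u2 | I3 \<Rightarrow> u3)
    else (case i of I1 \<Rightarrow> v1 | I2 \<Rightarrow> v2 | I3 \<Rightarrow> v3))" for s i
  have u3: "peirce_u u3" and v3: "peirce_v v3"
    unfolding u3_def v3_def by (rule peirce_same[OF u1 u2 v1 v2])+
  have gram': "B v1 u1 = 1" "B v2 u1 = 0" "B v1 u2 = 0" "B v2 u2 = 1"
    using gram by (simp_all add: B_sym[of v1] B_sym[of v2])
  note U = peirce_u[OF u1] peirce_u[OF u2] peirce_u[OF u3]
  note V = peirce_v[OF v1] peirce_v[OF v2] peirce_v[OF v3]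
  have sq: "v1 \<star> v1 = 0" "v2 \<star> v2 = 0" "u1 \<star> u1 = 0" "u2 \<star> u2 = 0"
    using square U V by simp_all
  have opp: "v1 \<star> u2 = 0" "v2 \<star> u1 = 0" "u1 \<star> v2 = 0" "u2 \<star> v1 = 0"
    using peirce_opposite assms by simp_all
  have v1v3: "v1 \<star> v3 = - u2"
    using pure_linearized(1)[OF V(1) U(1), of u2] gram' by (simp add: v3_def opp mul_simps)
  have u1u3: "u1 \<star> u3 = - v2"
    using pure_linearized(1)[OF U(1) V(1), of v2] gram by (simp add: u3_def opp mul_simps)
  have u2u3: "u2 \<star> u3 = v1"
    using pure_linearized(1)[OF U(6) V(1), of v2] gram peirce_opposite(1)[OF u2 v2] V(5)
    by (simp add: u3_def mul_simps)
  have v2v3: "v2 \<star> v3 = u1"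
    using pure_linearized(1)[OF V(6) U(1), of u2] gram gram' peirce_opposite(2)[OF u2 v2] U(5)
    by (simp add: v3_def mul_simps unit_right)
  have gram3: "B u3 v1 = 0" "B u3 v2 = 0" "B u1 v3 = 0" "B u2 v3 = 0" "B u3 v3 = 1"
  proof -
    show "B u3 v1 = 0" "B u1 v3 = 0"
      using B_adjoint_left[of v1 v2 v1] B_adjoint_left[of u1 u2 u1] B_sym[of u1 v3]
      by (simp_all add: u3_def v3_def cnj_pure U V mul_simps sq B_simps)
    show "B u3 v2 = 0" "B u2 v3 = 0"
      using B_adjoint_right[of v1 v2 v2] B_adjoint_right[of u1 u2 u2] B_sym[of u2 v3]
      by (simp_all add: u3_def v3_def cnj_pure U V mul_simps sq B_simps)
    show "B u3 v3 = 1"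
      using B_adjoint_left[of v1 v2 v3] by (simp add: u3_def[symmetric] cnj_pure U V mul_simps v1v3 gram')
  qed
  have swap: "b \<star> a = - (a \<star> b)" if "B a unit = 0" "B b unit = 0" "B a b = 0" for a b
    using pure_linearized(3)[OF that(1,2)] that(3) by (simp add: eq_neg_iff_add_eq_0 add.commute)
  have B_uu: "B u u' = 0" if "u \<in> {u1, u2, u3}" "u' \<in> {u1, u2, u3}" for u u'
    using that u1 u2 u3 by (intro peirce_same(1)[OF _ _ v1 v1]) auto
  have B_vv: "B v v' = 0" if "v \<in> {v1, v2, v3}" "v' \<in> {v1, v2, v3}" for v v'
    using that v1 v2 v3 by (intro peirce_same(2)[OF u1 u1]) auto
  have B_uv: "B (x True i) (x False j) = (if i = j then 1 else 0)" for i j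
    by (cases i; cases j) (simp_all add: x_def gram gram3)
  have in_u: "peirce_u (x True i)" and in_v: "peirce_v (x False i)" for i
    using u1 u2 u3 v1 v2 v3 by (cases i; simp add: x_def)+
  have hx: "hexad x"
    unfolding hexad_def nil_def
  proof (intro allI conjI)
    fix s t i j
    show "N (x s i) = 0" "B (x s i) unit = 0"
      using peirce_u[OF in_u] peirce_v[OF in_v] by (cases s; simp)+
    have "B (x True i) (x True j) = 0" "B (x False i) (x False j) = 0"
      using peirce_same(1,2)[OF in_u in_u in_v in_v] by blast+
    then show "B (x s i) (x t j) = (if s \<noteq> t \<and> i = j then 1 else 0)"
      using B_uv[of i j] B_uv[of j i] B_sym[of "x False i"] by (cases s; cases t) auto
  qed
  have prods: "x s i \<star> x s (nxt i) = x (\<not> s) (nxt (nxt i))" for s i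
  proof -
    have "u3 \<star> u1 = v2" "v3 \<star> v1 = u2"
      using swap[of u1 u3] swap[of v1 v3] U V u1u3 v1v3 B_uu B_vv by simp_all
    then show ?thesis
      using u2u3 v2v3 by (cases s; cases i) (simp_all add: x_def u3_def v3_def)
  qed
  have "x s i \<star> x (\<not> s) j = 0" if "i \<noteq> j" for s i j
    using peirce_opposite[OF in_u in_v, of i j] peirce_opposite[OF in_u in_v, of j i]
      B_uv that by (cases s) auto
  then have "zorn x"
    using hx prods by (simp add: zorn_def)
  then show ?thesis
    by (intro exI[of _ x]) (simp add: x_def)
qed

text \<open>A partner v1 of u1 is projected into the v-space; a second pair is then found in the
  orthogonal complement of 1, e, u1 and v1, which is large enough because the dimension is
  8.\<close>

lemma zorn_from_peirce:
  assumes u1: "peirce_u u1" "u1 \<noteq> 0"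
  shows "\<exists>x. zorn x \<and> x True I1 = u1"
proof -
  note U1 = peirce_u[OF u1(1)]
  \<comment> \<open>The projection away from 1 and e. Their Gram matrix has rows (2, 1) and (1, 0)
    and determinant -1, so the coefficients below involve no division, in any
    characteristic.\<close>
  have proj: "\<exists>w'. B w' unit = 0 \<and> B w' e = 0 \<and> (\<forall>z. B z unit = 0 \<longrightarrow> B z e = 0 \<longrightarrow> B z w' = B z w) \<and>
      w - w' \<in> span {unit, e}" for w
  proof -
    define w' where "w' = w - (smul (B w e) unit + smul (B w unit - 2 * B w e) e)"
    have "B w' unit = 0" "B w' e = 0" "\<forall>z. B z unit = 0 \<longrightarrow> B z e = 0 \<longrightarrow> B z w' = B z w"
      using e B_sym[of unit e] by (simp_all add: w'_def B_simps B_self)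
    moreover have "w - w' \<in> span {unit, e}"
      unfolding w'_def by (simp add: span_add span_scale span_base)
    ultimately show ?thesis by blast
  qed
  have to_v: "peirce_v ((unit - e) \<star> w)" if "B w unit = 0" "B w e = 0" for w
  proof -
    have "e \<star> ((unit - e) \<star> w) = 0"
      using cnj_cancel(3)[of e w] e by (simp add: e_conj)
    moreover have "B ((unit - e) \<star> w) unit = 0"
      using that B_adjoint_left[of "unit - e" w unit]
      by (simp add: e_conj[symmetric] unit_right)
    ultimately show ?thesis by (simp add: peirce_v_def)
  qed
  have to_u: "peirce_u (e \<star> w)" if "B w unit = 0" "B w e = 0" for w
  proof -
    have "e \<star> (e \<star> w) = e \<star> w"
      using cnj_cancel(1)[of e w] e by (simp add: e_conj mul_simps unit_left)
    moreover have "B (e \<star> w) unit = 0"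
      using that B_adjoint_left[of e w unit]
      by (simp add: e_conj unit_right B_simps)
    ultimately show ?thesis by (simp add: peirce_u_def)
  qed
  have B_to_v: "B u ((unit - e) \<star> w) = B u w" if "peirce_u u" for u w
    using B_adjoint_left[of "unit - e" w u] B_sym peirce_u[OF that]
    by (simp add: e_conj[symmetric])
  have B_to_u: "B v (e \<star> w) = B v w" if "peirce_v v" for v w
    using B_adjoint_left[of e w v] B_sym peirce_v[OF that]
    by (simp add: e_conj mul_simps unit_left)
  have scaled: "\<exists>w. B a w = 1" if ne: "a \<noteq> 0" for a
  proof -
    obtain w where "B a w \<noteq> 0"
      using B_nondegenerate[of a] ne by blast
    then have "B a (smul (1 / B a w) w) = 1"
      by (simp add: B_simps)
    then show ?thesis by blast
  qed

  obtain w where "B u1 w = 1"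
    using scaled u1(2) by blast
  then obtain w' where w': "B w' unit = 0" "B w' e = 0" "B u1 w' = 1"
    using proj[of w] U1 by auto
  define v1 where "v1 = (unit - e) \<star> w'"
  have v1: "peirce_v v1" "B u1 v1 = 1"
    unfolding v1_def using to_v[OF w'(1,2)] B_to_v[OF u1(1)] w'(3) by simp_all
  note V1 = peirce_v[OF v1(1)]

  define perp where "perp a \<longleftrightarrow> B a unit = 0 \<and> B a e = 0 \<and> B a u1 = 0 \<and> B a v1 = 0" for a
  have proj2: "\<exists>w'. perp w' \<and> (\<forall>z. perp z \<longrightarrow> B z w' = B z w) \<and> w - w' \<in> span {unit, e, u1, v1}" for w
  proof -
    obtain w' where w': "B w' unit = 0" "B w' e = 0" "w - w' \<in> span {unit, e}"
        "\<And>z. B z unit = 0 \<Longrightarrow> B z e = 0 \<Longrightarrow> B z w' = B z w"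
      using proj[of w] by blast
    define w'' where "w'' = w' - (smul (B w' v1) u1 + smul (B w' u1) v1)"
    have "perp w''"
      using w' U1 V1 v1(2) B_sym[of v1 u1] by (simp add: perp_def w''_def B_simps B_self)
    moreover have "\<forall>z. perp z \<longrightarrow> B z w'' = B z w"
      using w'(4) by (simp add: perp_def w''_def B_simps)
    moreover have "w - w'' \<in> span {unit, e, u1, v1}"
    proof -
      have "w - w'' = (w - w') + (smul (B w' v1) u1 + smul (B w' u1) v1)"
        by (simp add: w''_def)
      moreover have "w - w' \<in> span {unit, e, u1, v1}"
        using w'(3) span_mono[of "{unit, e}" "{unit, e, u1, v1}"] by blast
      moreover have "smul (B w' v1) u1 + smul (B w' u1) v1 \<in> span {unit, e, u1, v1}"
        by (intro span_add span_scale span_base) simp_all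
      ultimately show ?thesis
        by (simp only: span_add)
    qed
    ultimately show ?thesis by blast
  qed
  \<comment> \<open>If the norm vanished on the complement, so would its polar form; the projection
    then makes the complement zero, and four vectors would span the algebra.\<close>
  have "\<exists>a. perp a \<and> N a \<noteq> 0"
  proof (rule ccontr)
    assume "\<nexists>a. perp a \<and> N a \<noteq> 0"
    then have iso: "perp a \<Longrightarrow> N a = 0" for a by blast
    have zero: "a = 0" if pa: "perp a" for a
    proof (rule B_nondegenerate)
      fix w
      obtain w' where "perp w'" "B a w' = B a w"
        using proj2[of w] pa by blast
      moreover have "perp (a + w')"
        using that \<open>perp w'\<close> by (simp add: perp_def B_simps)
      ultimately show "B a w = 0"
        using iso that by (simp add: B_def)
    qed
    have "w \<in> span {unit, e, u1, v1}" for w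
    proof -
      obtain w' where w': "perp w'" "w - w' \<in> span {unit, e, u1, v1}"
        using proj2[of w] by blast
      show ?thesis
        using w'(2) unfolding zero[OF w'(1)] by simp
    qed
    then have "dim (UNIV :: 'b set) \<le> card {unit, e, u1, v1}"
      by (intro dim_le_card) auto
    also have "\<dots> \<le> 4"
      using card_length[of "[unit, e, u1, v1]"] by simp
    finally show False using dim_8 by simp
  qed
  then obtain a where a: "perp a" "N a \<noteq> 0" by blast
  have a0: "a \<noteq> 0" using a(2) by auto
  \<comment> \<open>Here e a = 0 is impossible: it would put a into the v-space, where the norm
    vanishes. So e a serves as u2, and v2 comes from a partner of u2.\<close>
  have pair: "\<exists>u2 v2. peirce_u u2 \<and> peirce_v v2 \<and> perp u2 \<and> perp v2 \<and> B u2 v2 = 1"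
  proof (cases "e \<star> a = 0")
    case False
    define u2 where "u2 = e \<star> a"
    have pa: "B a unit = 0" "B a e = 0" "B a u1 = 0" "B a v1 = 0"
      using a(1) by (auto simp: perp_def)
    have u2: "peirce_u u2"
      unfolding u2_def using to_u pa by blast
    have "B u2 u1 = 0"
      using peirce_same(1)[OF u2 u1(1) v1(1) v1(1)] .
    moreover have "B u2 v1 = 0"
      using B_to_u[OF v1(1), of a] pa(4) unfolding u2_def by (simp add: B_sym[of _ v1])
    ultimately have p2: "perp u2"
      using peirce_u[OF u2] by (simp add: perp_def)
    obtain w where "B u2 w = 1"
      using scaled[OF False] unfolding u2_def by blast
    then obtain w' where w': "perp w'" "B u2 w' = 1"
      using proj2[of w] p2 by force
    define v2 where "v2 = (unit - e) \<star> w'"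
    have v2: "peirce_v v2" "B u2 v2 = 1" "B u1 v2 = B u1 w'"
      unfolding v2_def using to_v[of w'] B_to_v u1(1) u2 w' by (simp_all add: perp_def)
    moreover have "B v2 v1 = 0"
      using peirce_same(2)[OF u1(1) u1(1) v2(1) v1(1)] .
    ultimately have "perp v2"
      using peirce_v[OF v2(1)] w'(1) B_sym[of _ u1] by (simp add: perp_def)
    then show ?thesis using u2 p2 v2 by blast
  next
    case True
    have pa: "B a unit = 0" "B a e = 0"
      using a(1) by (auto simp: perp_def)
    then have v2: "peirce_v a"
      using True by (simp add: peirce_v_def)
    then show ?thesis
      using peirce_v(3)[OF v2] a(2) by simp
  qed
  then obtain u2 v2 where "peirce_u u2" "peirce_v v2" "perp u2" "perp v2" "B u2 v2 = 1" by blast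
  then show ?thesis
    using zorn_from_pairs[OF u1(1) _ v1(1), of u2 v2] v1(2) B_sym[of v2 u1] by (simp add: perp_def)
qed

end

text \<open>Any w with B n w = 1 yields e = n (cnj w), of norm 0 and trace 1, and the linearised
  conjugation identity shows e n = n.\<close>

theorem zorn_extends_nil:
  assumes n: "nil n" "n \<noteq> 0"
  shows "\<exists>x. zorn x \<and> x True I1 = n"
proof -
  have n': "N n = 0" "B n unit = 0"
    using n(1) by (auto simp: nil_def)
  obtain w0 where "B n w0 \<noteq> 0"
    using B_nondegenerate[of n] n(2) by blast
  define w where "w = smul (1 / B n w0) w0"
  have w: "B n w = 1"
    using \<open>B n w0 \<noteq> 0\<close> by (simp add: w_def B_simps)
  define e where "e = n \<star> cnj w"
  have "N e = 0"
    by (simp add: e_def norm_mul n')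
  moreover have "B e unit = 1"
    using w by (simp add: e_def N_mul_unit)
  moreover have "e \<star> n = n"
  proof -
    have "(n \<star> cnj w) \<star> cnj (- n) + (n \<star> - n) \<star> cnj (cnj w) = smul (B (cnj w) (- n)) n"
      by (rule cnj_linearized(2))
    moreover have "n \<star> n = 0"
      using square[of n] n' by simp
    moreover have "B (cnj w) n = - 1"
      using w n' by (simp add: cnj_def B_simps B_sym[of _ n])
    ultimately show ?thesis
      using n' by (simp add: e_def cnj_pure B_simps mul_simps)
  qed
  ultimately show ?thesis
    using zorn_from_peirce[of e n] n n' by (simp add: peirce_u_def)
qed

subsection \<open>Automorphisms of the loop as relations up to sign\<close>

definition pm :: "'b \<Rightarrow> 'b \<Rightarrow> bool" where
  "pm x y \<longleftrightarrow> x = y \<or> x = - y"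

lemma pm_simps [simp]: "pm x x" "pm (- x) y = pm x y" "pm x (- y) = pm x y"
  by (auto simp: pm_def minus_equation_iff eq_commute)

lemma pm_sym: "pm x y \<Longrightarrow> pm y x"
  by (auto simp: pm_def)

lemma pm_trans: "pm x y \<Longrightarrow> pm y z \<Longrightarrow> pm x z"
  by (auto simp: pm_def)

lemma pm_mul: "pm x x' \<Longrightarrow> pm y y' \<Longrightarrow> pm (x \<star> y) (x' \<star> y')"
  by (auto simp: pm_def mul_simps)

lemma nilD:
  assumes "nil n"
  shows "N n = 0" "B n unit = 0" "B unit n = 0" "n \<star> n = 0" "cnj n = - n"
  using assms B_sym[of unit n] square[of n] by (auto simp: nil_def cnj_pure)

lemma unit_add_nil: "nil n \<Longrightarrow> N (unit + n) = 1" "nil n \<Longrightarrow> B (unit + n) unit = 2"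
  by (simp_all add: N_add B_simps nilD)

lemma nil_if_unit_add: "N (unit + n) = 1 \<Longrightarrow> B (unit + n) unit = 2 \<Longrightarrow> nil n"
  using B_sym[of unit n] by (simp add: nil_def N_add B_simps)

lemma nil_scale: "nil n \<Longrightarrow> nil (smul c n)"
  by (simp add: nil_def norm_scale B_simps)

lemma nil_minus: "nil n \<Longrightarrow> nil (- n)"
  by (simp add: nil_def B_simps)

lemma four_eq_0: "(4::'a) = 0 \<longleftrightarrow> (2::'a) = 0"
proof -
  have "(4::'a) = 0 \<longleftrightarrow> (2::'a) * 2 = 0" by simp
  also have "\<dots> \<longleftrightarrow> (2::'a) = 0" unfolding mult_eq_0_iff by blast
  finally show ?thesis .
qed

lemma minus_eq_self: "(2::'a) = 0 \<Longrightarrow> - z = z" for z :: 'b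
proof -
  assume two: "(2::'a) = 0"
  have "z + z = smul (1 + 1) z" by (simp only: scale_left_distrib scale_one)
  also have "\<dots> = 0" using two by simp
  finally show "- z = z" by (simp add: neg_eq_iff_add_eq_0)
qed

text \<open>Opposite signs would give the traces 2 and - 2, hence 4 = 0 and characteristic 2, where
  signs are invisible. So a class contains 1 + n for at most one n.\<close>

lemma pm_unit_add_nil:
  assumes "nil n" "nil m" "pm (unit + n) (unit + m)"
  shows "n = m"
proof (cases "unit + n = unit + m")
  case True
  then show ?thesis by simp
next
  case False
  then have eq: "unit + n = - (unit + m)"
    using assms(3) by (auto simp: pm_def)
  then have "B (unit + n) unit = - B (unit + m) unit"
    by (simp only: B_simps)
  then have "(2::'a) = - 2"
    unfolding unit_add_nil(2)[OF assms(1)] unit_add_nil(2)[OF assms(2)] .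
  then have "(4::'a) = 0"
    unfolding eq_neg_iff_add_eq_0 by simp
  then show ?thesis
    using eq minus_eq_self[of "unit + m"] by (simp add: four_eq_0)
qed

text \<open>
  Unipotency in terms of the loop operations modulo sign.  In characteristic other than 2, the
  elements \<open>x\<close> with a conjugate \<open>y \<noteq> x, x\<^sup>-\<^sup>1\<close> commuting with \<open>x\<close> are the unipotent ones, since
  commuting with a semisimple \<open>x\<close> forces \<open>y\<close> into the quadratic subalgebra generated by \<open>x\<close>.
\<close>

definition unip :: "'b \<Rightarrow> bool" where
  "unip x \<longleftrightarrow> N x = 1 \<and> (if (2::'a) = 0 then pm (x \<star> x) unit else
     pm x unit \<or> (\<not> pm (x \<star> x) unit \<and> (\<exists>y z. N y = 1 \<and> N z = 1 \<and> pm (y \<star> z) (z \<star> x) \<and>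
       pm (y \<star> x) (x \<star> y) \<and> \<not> pm y x \<and> \<not> pm (y \<star> x) unit)))"

lemma unip_minus: "unip (- x) \<longleftrightarrow> unip x"
  by (simp add: unip_def mul_simps)

lemma unip_nil:
  assumes n: "nil n"
  shows "unip (unit + n)"
proof (cases "(2::'a) = 0")
  case True
  then show ?thesis
    using n square[of "unit + n"] unit_add_nil[OF n] by (simp add: unip_def)
next
  case two: False
  then have four: "(4::'a) \<noteq> 0"
    by (simp add: four_eq_0)
  show ?thesis
  proof (cases "n = 0")
    case True
    then show ?thesis using two by (simp add: unip_def)
  next
    case False
    obtain x where x: "zorn x" "x True I1 = n"
      using zorn_extends_nil[OF n False] by blast
    note z = zornD[OF x(1)] and h = hexadD[OF zornD(1)[OF x(1)]]
    define m where "m = x True I2"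
    define v where "v = x False I3"
    have prods: "n \<star> n = 0" "m \<star> m = 0" "n \<star> m = v" "m \<star> n = - v" "n \<star> v = 0" "v \<star> n = 0" "m \<star> v = 0" "v \<star> m = 0"
      using z(5)[of True I1] z(5)[of True I2] z(2)[of True I1] z(4)[of True I1]
        z(3)[of I1 I3 True] z(3)[of I3 I1 False] z(3)[of I2 I3 True] z(3)[of I3 I2 False]
      by (simp_all add: x(2) m_def v_def)
    have nil: "nil n" "nil m" "nil v"
      using h by (simp_all add: nil_def m_def v_def x(2)[symmetric])
    have Bnv: "B n v = 0" "B v n = 0"
      using h(4)[of True I1 False I3] h(4)[of False I3 True I1] by (simp_all add: v_def x(2))
    define w where "w = smul (- 2) v"
    have w: "nil (n + w)"
      using nil Bnv by (simp add: nil_def w_def N_add N_diff norm_scale B_simps)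
    have "v + v = - w"
      using scale_left_distrib[of 1 1 v] by (simp add: w_def)
    then have ww: "n \<star> w = 0" "w \<star> n = 0" "w \<star> m = 0" "v + v = - w"
      by (simp_all add: w_def mul_simps prods)
    define X where "X = unit + n"
    define Y where "Y = unit + (n + w)"
    define Z where "Z = unit + m"
    have norms: "N X = 1" "N Y = 1" "N Z = 1"
      unfolding X_def Y_def Z_def using unit_add_nil nil w by blast+
    have trX: "B X unit = 2" and trY: "B Y unit = 2"
      unfolding X_def Y_def using unit_add_nil nil w by blast+
    have trXX: "B (X \<star> X) unit = 2"
      using square[of X] trX norms by (simp add: B_simps)
    have YX: "Y \<star> X = unit + (n + n + w)"
      by (simp add: X_def Y_def mul_simps unit_left unit_right prods ww algebra_simps)
    have trYX: "B (Y \<star> X) unit = 2"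
      unfolding YX using nil by (simp add: B_simps nil_def w_def)
    have YZ: "pm (Y \<star> Z) (Z \<star> X)"
    proof -
      have "w = - (v + v)"
        by (simp add: ww(4))
      then have "w + v = - v" by simp
      moreover have "Y \<star> Z = unit + n + m + (w + v)" "Z \<star> X = unit + n + m + (- v)"
        by (simp_all add: X_def Y_def Z_def mul_simps unit_left unit_right prods ww(3) algebra_simps)
      ultimately have "Y \<star> Z = Z \<star> X"
        by (simp only:)
      then show ?thesis by simp
    qed
    have XY: "pm (Y \<star> X) (X \<star> Y)"
    proof -
      have "Y \<star> X = X \<star> Y"
        by (simp add: X_def Y_def mul_simps unit_left unit_right prods ww algebra_simps)
      then show ?thesis by simp
    qed
    \<comment> \<open>All elements compared below have trace 2, so the minus sign allowed by
      \<open>pm\<close> would force 4 = 0.\<close>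
    have not_minus: "a \<noteq> - b" if "B a unit = 2" "B b unit = 2" for a b
    proof
      assume "a = - b"
      then have "(2::'a) = - 2" using that by (simp add: B_simps)
      then have "(4::'a) = 0" by (simp add: eq_neg_iff_add_eq_0)
      then show False using four by simp
    qed
    have B3: "B v (x True I3) = 1" "B n (x True I3) = 0" "B n (x False I1) = 1" "B v (x False I1) = 0"
      using h(4) by (simp_all add: v_def x(2)[symmetric])
    have "w \<noteq> 0"
    proof
      assume "w = 0"
      then have "B w (x True I3) = 0" by (simp add: B_simps)
      then show False using two B3 by (simp add: w_def B_simps)
    qed
    then have "\<not> pm Y X"
      using not_minus[OF trY trX] by (simp add: pm_def X_def Y_def)
    moreover have "\<not> pm (Y \<star> X) unit"
    proof -
      have "n + n + w \<noteq> 0"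
      proof
        assume "n + n + w = 0"
        then have "B (n + n + w) (x False I1) = 0" by (simp add: B_simps)
        then show False using two B3 by (simp add: w_def B_simps)
      qed
      then show ?thesis
        using not_minus[OF trYX B_unit_unit] by (simp add: pm_def YX)
    qed
    moreover have "\<not> pm (X \<star> X) unit"
    proof -
      have "n + n \<noteq> 0"
      proof
        assume "n + n = 0"
        then have "B (n + n) (x False I1) = 0" by (simp add: B_simps)
        then show False using two B3 by (simp add: B_simps)
      qed
      moreover have "X \<star> X = unit + (n + n)"
        by (simp add: X_def mul_simps unit_left unit_right prods)
      ultimately show ?thesis
        using not_minus[OF trXX B_unit_unit] by (simp add: pm_def)
    qed
    ultimately have "unip X"
      unfolding unip_def using two norms YZ XY by auto
    then show ?thesis by (simp add: X_def)
  qed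
qed

text \<open>In characteristic 2, x x = 1 and the quadratic equation of x give trace 0. Otherwise,
  for a trace other than 2 and - 2, a conjugate commuting with x can only be x or its
  inverse.\<close>

lemma unip_trace:
  assumes x: "unip x"
  shows "B x unit = 2 \<or> B x unit = - 2"
proof (cases "(2::'a) = 0")
  case True
  then have "pm (x \<star> x) unit" "N x = 1"
    using x by (auto simp: unip_def)
  then have "x \<star> x = unit"
    using minus_eq_self[OF True] by (auto simp: pm_def)
  then have "smul (B x unit) x = unit + unit"
    using square[of x] \<open>N x = 1\<close> by (simp add: diff_eq_eq)
  also have "unit + unit = 0"
    using minus_eq_self[OF True, of unit] by (simp add: neg_eq_iff_add_eq_0)
  finally have "B x unit = 0"
    using \<open>N x = 1\<close> by auto
  then show ?thesis using True by simp
next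
  case two: False
  have Nx: "N x = 1"
    using x by (simp add: unip_def)
  show ?thesis
  proof (cases "pm x unit")
    case True
    then show ?thesis by (auto simp: pm_def B_simps)
  next
    case False
    then obtain y0 z where y0: "\<not> pm (x \<star> x) unit" "N y0 = 1" "N z = 1" "pm (y0 \<star> z) (z \<star> x)"
       "pm (y0 \<star> x) (x \<star> y0)" "\<not> pm y0 x" "\<not> pm (y0 \<star> x) unit"
      using x two by (auto simp: unip_def)
    \<comment> \<open>The sign is chosen so that the conjugation relation holds exactly; then y and
      x have the same trace.\<close>
    define y where "y = (if y0 \<star> z = z \<star> x then y0 else - y0)"
    have y: "N y = 1" "y \<star> z = z \<star> x" "pm (y \<star> x) (x \<star> y)" "\<not> pm y x" "\<not> pm (y \<star> x) unit"
      using y0 by (auto simp: y_def mul_simps pm_def[of "y0 \<star> z"])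
    have "y = (z \<star> x) \<star> cnj z"
      using cnj_cancel(2)[of y z] y0(3) by (simp add: y(2))
    then have "B y unit = B (z \<star> x) (z \<star> unit)"
      by (simp add: N_mul_unit unit_right)
    then have tr: "B y unit = B x unit"
      using y0(3) by (simp add: B_mul_left)
    show ?thesis
    proof (cases "y \<star> x = x \<star> y")
      case False
      \<comment> \<open>Anticommuting makes the trace zero, so x x = - 1, which \<open>unip\<close>
        forbids.\<close>
      then have anti: "y \<star> x = - (x \<star> y)"
        using y(3) by (auto simp: pm_def)
      have yx: "(y \<star> x) \<star> cnj x = y"
        using cnj_cancel(2)[of y x] Nx by simp
      have "B y unit = B (y \<star> x) x"
        unfolding N_mul_unit[of "y \<star> x" "cnj x", unfolded yx cnj_cnj] ..
      also have "\<dots> = - B (x \<star> y) (x \<star> unit)"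
        by (simp add: anti B_simps unit_right)
      also have "\<dots> = - B y unit"
        using Nx by (simp only: B_mul_left) simp
      finally have "B y unit + B y unit = 0"
        unfolding eq_neg_iff_add_eq_0 .
      then have "B x unit = 0"
        unfolding mult_2[symmetric] using two tr by simp
      then have "x \<star> x = - unit"
        using square[of x] Nx by simp
      then show ?thesis
        using y0(1) by simp
    next
      case comm: True
      define h where "h = B x unit / 2"
      have hh: "B x unit = 2 * h"
        using two by (simp add: h_def)
      \<comment> \<open>The trace-zero parts x0 and y1 have the common norm d and commute, so x0 y1
        is a scalar; this makes them proportional unless d = 0, and d = 0 means trace 2 or -
        2.\<close>
      define x0 where "x0 = x - smul h unit"
      define y1 where "y1 = y - smul h unit"
      have pure: "B x0 unit = 0" "B y1 unit = 0"
        using tr hh by (simp_all add: x0_def y1_def B_simps)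
      define d where "d = 1 - h * h"
      have Nd: "N x0 = d" "N y1 = d"
        using Nx y(1) hh tr by (simp_all add: x0_def y1_def d_def N_diff norm_scale B_simps power2_eq_square)
      have "x0 \<star> y1 = y1 \<star> x0"
        by (simp add: x0_def y1_def mul_simps unit_left unit_right comm algebra_simps)
      then have "x0 \<star> y1 + x0 \<star> y1 = - smul (B x0 y1) unit"
        using pure_linearized(3)[OF pure] by simp
      then have "x0 \<star> (x0 \<star> y1 + x0 \<star> y1) = x0 \<star> (- smul (B x0 y1) unit)"
        by (simp only:)
      then have "- smul d y1 + - smul d y1 = - smul (B x0 y1) x0"
        by (simp only: mul_simps pure_mul[OF pure(1)] Nd unit_right)
      from add_eq_minusI[OF this] have "smul (d + d) y1 = smul (B x0 y1) x0"
        by (simp only: scale_left_distrib minus_minus)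
      then have key: "smul (2 * d) y1 = smul (B x0 y1) x0"
        by (simp only: mult_2)
      show ?thesis
      proof (cases "d = 0")
        case True
        then have "(h - 1) * (h + 1) = 0"
          by (simp add: d_def algebra_simps)
        then have "h = 1 \<or> h = - 1"
          by (simp add: eq_neg_iff_add_eq_0)
        then show ?thesis by (auto simp: hh)
      next
        case False
        \<comment> \<open>Equal norms give k = 1 or k = - 1, that is, y = x or y = cnj x, the
          inverse of x; both are excluded.\<close>
        define k where "k = B x0 y1 / (2 * d)"
        have "smul (1 / (2 * d)) (smul (2 * d) y1) = smul k x0"
          unfolding key by (simp add: k_def)
        then have yk: "y1 = smul k x0"
          using False two by simp
        then have "d = k\<^sup>2 * d"
          using Nd norm_scale[of k x0] by (simp only:)
        then have "(k - 1) * (k + 1) = 0"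
          using False by (simp add: algebra_simps power2_eq_square)
        then consider "k = 1" | "k = - 1"
          by (auto simp: eq_neg_iff_add_eq_0)
        then show ?thesis
        proof cases
          case 1
          then have "y = x" using yk by (simp add: x0_def y1_def)
          then show ?thesis using y(4) by simp
        next
          case 2
          then have "y1 = - x0" using yk by simp
          then have "y = (smul h unit + smul h unit) - x"
            by (simp add: x0_def y1_def algebra_simps)
          then have "y = cnj x"
            by (simp only: cnj_def hh mult_2 scale_left_distrib)
          then have "y \<star> x = unit"
            using cnj_cancel(1)[of x unit] Nx by (simp add: unit_right)
          then show ?thesis using y(5) by simp
        qed
      qed
    qed
  qed
qed

lemma unip_imp_nil:
  assumes "unip x"
  shows "\<exists>n. nil n \<and> pm x (unit + n)"
proof -
  have N: "N x = 1" using assms by (simp add: unip_def)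
  from unip_trace[OF assms] show ?thesis
  proof
    assume "B x unit = 2"
    then have "nil (x - unit)" using N by (intro nil_if_unit_add) simp_all
    then show ?thesis by (intro exI[of _ "x - unit"]) simp
  next
    assume "B x unit = - 2"
    then have "nil (- x - unit)" using N by (intro nil_if_unit_add) (simp_all add: B_simps)
    moreover have "unit + (- x - unit) = - x" by simp
    then have "pm x (unit + (- x - unit))" by (simp only: pm_simps)
    ultimately show ?thesis by blast
  qed
qed

text \<open>The graph of a loop automorphism lifted to representatives and closed under signs. No
  representatives have to be chosen, and the conditions are symmetric, so the converse describes the
  inverse automorphism.\<close>

definition loop_rel :: "('b \<Rightarrow> 'b \<Rightarrow> bool) \<Rightarrow> bool" where
  "loop_rel R \<longleftrightarrow> (\<forall>x y. R x y \<longrightarrow> N x = 1 \<and> N y = 1) \<and>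
     (\<forall>x. N x = 1 \<longrightarrow> (\<exists>y. R x y)) \<and> (\<forall>y. N y = 1 \<longrightarrow> (\<exists>x. R x y)) \<and>
     (\<forall>x y x' y'. R x y \<longrightarrow> R x' y' \<longrightarrow> (pm x x' \<longleftrightarrow> pm y y')) \<and>
     (\<forall>x y x' y'. R x y \<longrightarrow> R x' y' \<longrightarrow> R (x \<star> x') (y \<star> y')) \<and>
     (\<forall>x y. R x y \<longrightarrow> R x (- y) \<and> R (- x) y)"

lemma loop_relD:
  assumes "loop_rel R"
  shows "R x y \<Longrightarrow> N x = 1" "R x y \<Longrightarrow> N y = 1" "N x = 1 \<Longrightarrow> \<exists>y. R x y" "N y = 1 \<Longrightarrow> \<exists>x. R x y"
    "R x y \<Longrightarrow> R x' y' \<Longrightarrow> pm x x' \<longleftrightarrow> pm y y'" "R x y \<Longrightarrow> R x' y' \<Longrightarrow> R (x \<star> x') (y \<star> y')"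
    "R x y \<Longrightarrow> pm x x' \<Longrightarrow> pm y y' \<Longrightarrow> R x' y'"
proof -
  show "R x y \<Longrightarrow> N x = 1" "R x y \<Longrightarrow> N y = 1" "N x = 1 \<Longrightarrow> \<exists>y. R x y" "N y = 1 \<Longrightarrow> \<exists>x. R x y"
    "R x y \<Longrightarrow> R x' y' \<Longrightarrow> pm x x' \<longleftrightarrow> pm y y'" "R x y \<Longrightarrow> R x' y' \<Longrightarrow> R (x \<star> x') (y \<star> y')"
    using assms unfolding loop_rel_def by blast+
  have minus: "R x (- y)" "R (- x) y" if "R x y" for x y
    using assms that unfolding loop_rel_def by blast+
  show "R x y \<Longrightarrow> pm x x' \<Longrightarrow> pm y y' \<Longrightarrow> R x' y'"
  proof -
    assume xy: "R x y" and pm: "pm x x'" "pm y y'"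
    have "R x' y"
    proof (cases "x = x'")
      case False
      then have "x' = - x" using pm by (simp add: pm_def)
      then show ?thesis using minus(2)[OF xy] by simp
    qed (use xy in simp)
    then show "R x' y'"
    proof (cases "y = y'")
      case False
      then have "y' = - y" using pm by (simp add: pm_def)
      then show ?thesis using minus(1)[OF \<open>R x' y\<close>] by simp
    qed simp
  qed
qed

lemma loop_rel_converse:
  assumes R: "loop_rel R"
  shows "loop_rel (\<lambda>x y. R y x)"
proof -
  note r = loop_relD[OF R]
  show ?thesis
    unfolding loop_rel_def
  proof (intro conjI allI impI)
    fix x y x' y'
    assume 1: "R y x" "R y' x'"
    show "pm x x' = pm y y'" using r(5)[OF 1(1) 1(2)] by blast
  qed (use r(1-4) r(6) r(7) in auto)
qed

text \<open>A partner of 1 is idempotent modulo sign and can be cancelled.\<close>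

lemma loop_rel_unit:
  assumes R: "loop_rel R"
  shows "R unit unit"
proof -
  note r = loop_relD[OF R]
  obtain y where y: "R unit y" using r(3)[of unit] by auto
  have "pm y (y \<star> y)"
    using r(5)[OF y r(6)[OF y y]] by (simp add: unit_left)
  then have "pm (y \<star> unit) (y \<star> y)"
    by (simp add: unit_right)
  from pm_mul[OF pm_simps(1)[of "cnj y"] this] have "pm unit y"
    using r(2)[OF y] by (simp add: cnj_cancel)
  then show ?thesis
    using r(7)[OF y _ pm_sym] by simp
qed

text \<open>Apart from norm one, \<open>unip\<close> is built from products compared by
  \<open>pm\<close>, and \<open>loop_rel\<close> transports these.\<close>

lemma loop_rel_unip:
  assumes R: "loop_rel R" and xy: "R x x'" and x: "unip x"
  shows "unip x'"
proof -
  note r = loop_relD[OF R] and u = loop_rel_unit[OF R]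
  have Nx': "N x' = 1" using r(2)[OF xy] .
  show ?thesis
  proof (cases "(2::'a) = 0")
    case True
    then show ?thesis
      using x r(5)[OF r(6)[OF xy xy] u] Nx' by (simp add: unip_def)
  next
    case two: False
    show ?thesis
    proof (cases "pm x unit")
      case True
      then show ?thesis using two Nx' r(5)[OF xy u] by (simp add: unip_def)
    next
      case False
      then obtain y z where yz: "\<not> pm (x \<star> x) unit" "N y = 1" "N z = 1" "pm (y \<star> z) (z \<star> x)"
         "pm (y \<star> x) (x \<star> y)" "\<not> pm y x" "\<not> pm (y \<star> x) unit"
        using x two by (auto simp: unip_def)
      obtain y' z' where R': "R y y'" "R z z'"
        using r(3) yz(2,3) by blast
      have "\<not> pm (x' \<star> x') unit" "N y' = 1" "N z' = 1" "pm (y' \<star> z') (z' \<star> x')"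
         "pm (y' \<star> x') (x' \<star> y')" "\<not> pm y' x'" "\<not> pm (y' \<star> x') unit"
        using yz r(2)[OF R'(1)] r(2)[OF R'(2)] r(5)[OF r(6)[OF xy xy] u]
          r(5)[OF r(6)[OF R'(1) R'(2)] r(6)[OF R'(2) xy]] r(5)[OF r(6)[OF R'(1) xy] r(6)[OF xy R'(1)]]
          r(5)[OF R'(1) xy] r(5)[OF r(6)[OF R'(1) xy] u] by simp_all
      then show ?thesis
        unfolding unip_def using two Nx' by auto
    qed
  qed
qed

text \<open>
  The traces of \<open>(1 + n) (1 + m)\<close> and \<open>(1 + n) (1 - m)\<close> are \<open>2 - B n m\<close> and \<open>2 + B n m\<close>; the second
  product excludes \<open>B n m = 4\<close>, where the first one is minus a unipotent element.
\<close>

lemma nil_orthogonal_iff: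
  assumes n: "nil n" and m: "nil m"
  shows "B n m = 0 \<longleftrightarrow> unip ((unit + n) \<star> (unit + m)) \<and> unip ((unit + n) \<star> (unit - m))"
proof -
  have N1: "N ((unit + n) \<star> (unit + m)) = 1" and N2: "N ((unit + n) \<star> (unit - m)) = 1"
    using unit_add_nil(1) n m nil_minus[OF m] by (simp_all add: norm_mul unit_add_nil[of "- m", simplified])
  have "B (n \<star> m) unit = - B n m"
    using m by (simp add: N_mul_unit nilD B_simps)
  then have tr: "B ((unit + n) \<star> (unit + m)) unit = 2 - B n m" "B ((unit + n) \<star> (unit - m)) unit = 2 + B n m"
    using n m by (simp_all add: mul_simps unit_left unit_right B_simps nilD)
  have unip_iff: "unip x \<longleftrightarrow> B x unit = 2 \<or> B x unit = - 2" if Nx: "N x = 1" for x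
  proof
    assume "B x unit = 2 \<or> B x unit = - 2"
    then show "unip x"
    proof
      assume "B x unit = 2"
      then have "nil (x - unit)" using Nx by (intro nil_if_unit_add) simp_all
      then show ?thesis using unip_nil by fastforce
    next
      assume "B x unit = - 2"
      then have "nil (- x - unit)" using Nx by (intro nil_if_unit_add) (simp_all add: B_simps)
      from unip_nil[OF this] show ?thesis by (simp add: unip_minus)
    qed
  qed (rule unip_trace)
  have "B n m = 0" if "2 - B n m = 2 \<or> 2 - B n m = - 2" "2 + B n m = 2 \<or> 2 + B n m = - 2"
  proof (rule ccontr)
    assume "B n m \<noteq> 0"
    then have "2 - B n m \<noteq> 2" "2 + B n m \<noteq> 2" by simp_all
    then have eqs: "2 - B n m = - 2" "2 + B n m = - 2" using that by blast+
    have "2 + B n m = 2 - B n m"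
      unfolding eqs ..
    then have "B n m = - B n m"
      by (simp only: diff_conv_add_uminus add_left_cancel)
    then have "2 * B n m = 0"
      by (simp only: eq_neg_iff_add_eq_0 mult_2)
    then have two: "(2::'a) = 0"
      using \<open>B n m \<noteq> 0\<close> by simp
    show False
      using eqs(1) \<open>B n m \<noteq> 0\<close> unfolding two by simp
  qed
  then show ?thesis
    unfolding unip_iff[OF N1] unip_iff[OF N2] tr by auto
qed

text \<open>With b = B n m the two sides are (1 - b) + (2 - b) n + m and (1 - b) + (2 - b) m + n,
  which differ by (1 - b) (n - m). The case n = m satisfies the relation with b = 0. A minus sign
  would give 4 (1 - b) = 0 by traces.\<close>

lemma nil_braid_iff:
  assumes n: "nil n" and m: "nil m"
  shows "B n m = 1 \<longleftrightarrow> n \<noteq> m \<and>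
    pm (((unit + n) \<star> (unit + m)) \<star> (unit + n)) (((unit + m) \<star> (unit + n)) \<star> (unit + m))"
proof -
  define b where "b = B n m"
  note nn = nilD[OF n] and mm = nilD[OF m]
  have expand: "((unit + n) \<star> (unit + m)) \<star> (unit + n) = smul (1 - B n m) unit + smul (2 - B n m) n + m"
    if "nil n" "nil m" for n m
  proof -
    note nn = nilD[OF that(1)] and mm = nilD[OF that(2)]
    have "n \<star> m + m \<star> n = - smul (B n m) unit" "(n \<star> m) \<star> n = - smul (B n m) n"
      using pure_linearized(3)[OF nn(2) mm(2)] pure_linearized(2)[OF nn(2) mm(2), of n] nn(4)
      by (simp_all add: mul_simps)
    moreover have "((unit + n) \<star> (unit + m)) \<star> (unit + n) =
        unit + (n + n) + m + (n \<star> m + m \<star> n) + (n \<star> m) \<star> n"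
      by (simp add: mul_simps unit_left unit_right nn algebra_simps)
    moreover have "smul 2 n = n + n"
      using scale_left_distrib[of 1 1 n] by simp
    ultimately show ?thesis
      by (simp add: scale_left_diff_distrib algebra_simps)
  qed
  have e1: "((unit + n) \<star> (unit + m)) \<star> (unit + n) = smul (1 - b) unit + smul (2 - b) n + m"
    and e2: "((unit + m) \<star> (unit + n)) \<star> (unit + m) = smul (1 - b) unit + smul (2 - b) m + n"
    using expand[OF n m] expand[OF m n] B_sym[of m n] by (simp_all add: b_def)
  show ?thesis
    unfolding e1 e2 b_def[symmetric]
  proof (intro iffI conjI)
    assume b: "b = 1"
    show "n \<noteq> m"
      using b nn B_self[of n] by (auto simp: b_def)
    show "pm (smul (1 - b) unit + smul (2 - b) n + m) (smul (1 - b) unit + smul (2 - b) m + n)"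
      using b by (simp add: add.commute)
  next
    assume a: "n \<noteq> m \<and> pm (smul (1 - b) unit + smul (2 - b) n + m) (smul (1 - b) unit + smul (2 - b) m + n)"
    have eq: "b = 1" if e: "smul (1 - b) unit + smul (2 - b) n + m = smul (1 - b) unit + smul (2 - b) m + n"
    proof -
      have "smul (1 - b) (n - m) = (smul (1 - b) unit + smul (2 - b) n + m) - (smul (1 - b) unit + smul (2 - b) m + n)"
        using scale_left_distrib[of "1 - b" 1 n] scale_left_distrib[of "1 - b" 1 m]
        by (simp add: scale_right_diff_distrib algebra_simps)
      also have "\<dots> = 0" by (simp only: e diff_self)
      finally show "b = 1" using a by simp
    qed
    show "b = 1"
    proof (cases "(2::'a) = 0")
      case True
      then show ?thesis using a eq minus_eq_self[OF True] unfolding pm_def by metis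
    next
      case False
      then have four: "(4::'a) \<noteq> 0"
        by (simp add: four_eq_0)
      show ?thesis
      proof (cases "smul (1 - b) unit + smul (2 - b) n + m = smul (1 - b) unit + smul (2 - b) m + n")
        case True
        then show ?thesis by (rule eq)
      next
        case False
        then have "smul (1 - b) unit + smul (2 - b) n + m = - (smul (1 - b) unit + smul (2 - b) m + n)"
          using a by (simp add: pm_def)
        then have "B (smul (1 - b) unit + smul (2 - b) n + m) unit = - B (smul (1 - b) unit + smul (2 - b) m + n) unit"
          by (simp only: B_simps)
        then have "(1 - b) * 2 = - ((1 - b) * 2)"
          using nn mm by (simp add: B_simps)
        then have "(1 - b) * 2 + (1 - b) * 2 = 0"
          by (simp only: eq_neg_iff_add_eq_0)
        then have "4 * (1 - b) = 0" by (simp add: algebra_simps)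
        then show ?thesis using four by simp
      qed
    qed
  qed
qed

subsection \<open>The action on nilpotent elements\<close>

lemma cnj_unit_add: "nil n \<Longrightarrow> cnj (unit + n) = unit - n"
  using scale_left_distrib[of 1 1 unit] by (simp add: cnj_def B_simps nilD)

text \<open>Orthogonality is what keeps the trace of the product equal to 2.\<close>

lemma nil_add_mul:
  assumes n: "nil n" and m: "nil m" and orth: "B n m = 0"
  shows "(unit + n) \<star> (unit + m) = unit + (n + m + n \<star> m)" "nil (n + m + n \<star> m)"
proof -
  show eq: "(unit + n) \<star> (unit + m) = unit + (n + m + n \<star> m)"
    by (simp add: mul_simps unit_left unit_right algebra_simps)
  show "nil (n + m + n \<star> m)"
  proof (rule nil_if_unit_add)
    show "N (unit + (n + m + n \<star> m)) = 1"
      unfolding eq[symmetric] norm_mul using unit_add_nil(1)[OF n] unit_add_nil(1)[OF m] by simp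
    have "B (n \<star> m) unit = 0"
      using orth nilD[OF m] by (simp add: N_mul_unit B_simps)
    then show "B (unit + (n + m + n \<star> m)) unit = 2"
      using nilD[OF n] nilD[OF m] by (simp add: B_simps)
  qed
qed

text \<open>The difference w between m and its projection is orthogonal to the hexad. The isotropy
  condition says that the projection has norm 0; then w also has norm 0 and vanishes by
  \<open>isotropic_orthogonal_hexad\<close>.\<close>

lemma isotropic_hexad_expansion:
  assumes y: "hexad y" and m: "nil m"
    and iso: "B m (y True I1) * B m (y False I1) + B m (y True I2) * B m (y False I2)
      + B m (y True I3) * B m (y False I3) = 0"
  shows "m = smul (B m (y False I1)) (y True I1) + smul (B m (y False I2)) (y True I2)
     + smul (B m (y False I3)) (y True I3) + smul (B m (y True I1)) (y False I1)
     + smul (B m (y True I2)) (y False I2) + smul (B m (y True I3)) (y False I3)" (is "m = ?s")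
proof -
  note h = hexadD[OF y]
  define w where "w = m - ?s"
  have "B w unit = 0"
    using m by (simp add: w_def B_simps h nilD)
  moreover have wy: "B w (y s i) = 0" for s i
    by (cases s; cases i) (simp_all add: w_def B_simps h(4))
  moreover have "N w = 0"
  proof -
    have "N ?s = 0" "B ?s m = 0 + 0"
      using iso by (simp_all add: N_add norm_scale B_simps h(1,4) B_sym[of _ m] algebra_simps)
    moreover have "m = w + ?s" by (simp add: w_def)
    moreover have "B w ?s = 0"
      by (simp add: B_simps wy)
    ultimately show ?thesis
      using N_add[of w ?s] nilD[OF m] by simp
  qed
  ultimately have "w = 0"
    by (intro isotropic_orthogonal_hexad[OF y])
  then show ?thesis by (simp add: w_def)
qed

context
  fixes R :: "'b \<Rightarrow> 'b \<Rightarrow> bool"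
  assumes R: "loop_rel R"
begin

text \<open>The choice is unique by \<open>pm_unit_add_nil\<close>.\<close>

definition rho :: "'b \<Rightarrow> 'b" where
  "rho n = (SOME n'. nil n' \<and> R (unit + n) (unit + n'))"

lemma rho:
  assumes n: "nil n"
  shows "nil (rho n)" "R (unit + n) (unit + rho n)"
proof -
  note r = loop_relD[OF R]
  obtain y where y: "R (unit + n) y"
    using r(3) unit_add_nil(1)[OF n] by blast
  have "unip y"
    using loop_rel_unip[OF R y unip_nil[OF n]] .
  then obtain n' where n': "nil n'" "pm y (unit + n')"
    using unip_imp_nil by blast
  then have "nil n' \<and> R (unit + n) (unit + n')"
    using r(7)[OF y pm_simps(1) n'(2)] by blast
  then have "nil (rho n) \<and> R (unit + n) (unit + rho n)"
    unfolding rho_def by (rule someI)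
  then show "nil (rho n)" "R (unit + n) (unit + rho n)" by blast+
qed

lemma rho_eqI:
  assumes "nil n" "nil n'" "R (unit + n) (unit + n')"
  shows "rho n = n'"
  using loop_relD(5)[OF R rho(2)[OF assms(1)] assms(3)] pm_unit_add_nil[OF rho(1)[OF assms(1)] assms(2)]
  by simp

lemma rho_inj:
  assumes "nil n" "nil m" "rho n = rho m"
  shows "n = m"
proof -
  have "R (unit + m) (unit + rho n)"
    using rho(2)[OF assms(2)] assms(3) by simp
  from loop_relD(5)[OF R rho(2)[OF assms(1)] this] show ?thesis
    using pm_unit_add_nil[OF assms(1,2)] by simp
qed

lemma rho_surj:
  assumes n': "nil n'"
  shows "\<exists>n. nil n \<and> rho n = n'"
proof -
  note r = loop_relD[OF R]
  obtain x where x: "R x (unit + n')"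
    using r(4) unit_add_nil(1)[OF n'] by blast
  have "unip x"
    using loop_rel_unip[OF loop_rel_converse[OF R] x unip_nil[OF n']] .
  then obtain n where n: "nil n" "pm x (unit + n)"
    using unip_imp_nil by blast
  then have "R (unit + n) (unit + n')"
    using r(7)[OF x n(2) pm_simps(1)] by blast
  then show ?thesis
    using rho_eqI[OF n(1) n'] n(1) by blast
qed

lemma rho_zero: "rho 0 = 0"
proof -
  have "nil 0" by (simp add: nil_def B_simps)
  then show ?thesis
    using loop_rel_unit[OF R] by (intro rho_eqI) simp_all
qed

text \<open>For nilpotent m the inverse of 1 + m is 1 - m, and inverses are preserved.\<close>

lemma rho_minus:
  assumes m: "nil m"
  shows "rho (- m) = - rho m"
proof -
  note r = loop_relD[OF R] and k = rho[OF m] and k' = rho[OF nil_minus[OF m]]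
  have "(unit + m) \<star> (unit + - m) = unit"
    using nil_add_mul(1)[OF m nil_minus[OF m]] nilD[OF m] by (simp add: B_simps B_self mul_simps)
  then have "R unit ((unit + rho m) \<star> (unit + rho (- m)))"
    using r(6)[OF k(2) k'(2)] by simp
  from r(5)[OF this loop_rel_unit[OF R]]
  have "pm ((unit + rho m) \<star> (unit + rho (- m))) unit" by simp
  from pm_mul[OF pm_simps(1)[of "cnj (unit + rho m)"] this, unfolded cnj_cancel(1) unit_right]
  have "pm (unit + rho (- m)) (unit + - rho m)"
    unfolding cnj_unit_add[OF k(1)] unit_add_nil(1)[OF k(1)] by simp
  then show ?thesis
    by (rule pm_unit_add_nil[OF k'(1) nil_minus[OF k(1)]])
qed

lemma rho_orthogonal:
  assumes n: "nil n" and m: "nil m" and orth: "B n m = 0"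
  shows "B (rho n) (rho m) = 0"
proof -
  note r = loop_relD[OF R]
  have minus: "R (unit - m) (unit - rho m)"
    using rho(2)[OF nil_minus[OF m]] rho_minus[OF m] by simp
  have "unip ((unit + n) \<star> (unit + m))" "unip ((unit + n) \<star> (unit - m))"
    using nil_orthogonal_iff[OF n m] orth by simp_all
  then have "unip ((unit + rho n) \<star> (unit + rho m))" "unip ((unit + rho n) \<star> (unit - rho m))"
    using loop_rel_unip[OF R r(6)[OF rho(2)[OF n] rho(2)[OF m]]]
      loop_rel_unip[OF R r(6)[OF rho(2)[OF n] minus]] by simp_all
  then show ?thesis
    using nil_orthogonal_iff[OF rho(1)[OF n] rho(1)[OF m]] by simp
qed

lemma rho_dual:
  assumes n: "nil n" and m: "nil m" and dual: "B n m = 1"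
  shows "B (rho n) (rho m) = 1"
proof -
  note r = loop_relD[OF R] and kn = rho(2)[OF n] and km = rho(2)[OF m]
  have "n \<noteq> m" "pm (((unit + n) \<star> (unit + m)) \<star> (unit + n)) (((unit + m) \<star> (unit + n)) \<star> (unit + m))"
    using nil_braid_iff[OF n m] dual by simp_all
  moreover from this(1) have "rho n \<noteq> rho m"
    using rho_inj[OF n m] by blast
  ultimately show ?thesis
    using r(5)[OF r(6)[OF r(6)[OF kn km] kn] r(6)[OF r(6)[OF km kn] km]]
      nil_braid_iff[OF rho(1)[OF n] rho(1)[OF m]] by simp
qed

text \<open>The substitute for additivity, restricted to orthogonal arguments.\<close>

lemma rho_add_mul:
  assumes n: "nil n" and m: "nil m" and orth: "B n m = 0"
  shows "rho (n + m + n \<star> m) = rho n + rho m + rho n \<star> rho m"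
proof (rule rho_eqI)
  note orth' = rho_orthogonal[OF n m orth]
  show "nil (n + m + n \<star> m)" "nil (rho n + rho m + rho n \<star> rho m)"
    using nil_add_mul(2)[OF n m orth] nil_add_mul(2)[OF rho(1)[OF n] rho(1)[OF m] orth'] .
  show "R (unit + (n + m + n \<star> m)) (unit + (rho n + rho m + rho n \<star> rho m))"
    using loop_relD(6)[OF R rho(2)[OF n] rho(2)[OF m]]
    unfolding nil_add_mul(1)[OF n m orth] nil_add_mul(1)[OF rho(1)[OF n] rho(1)[OF m] orth'] .
qed

section \<open>The image of a Zorn basis and its coordinate maps\<close>

context
  fixes x :: "bool \<Rightarrow> tri \<Rightarrow> 'b"
  assumes x: "zorn x"
begin

definition hexad_image :: "bool \<Rightarrow> tri \<Rightarrow> 'b" where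
  "hexad_image s i = rho (x s i)"

definition coord_map :: "bool \<Rightarrow> tri \<Rightarrow> 'a \<Rightarrow> 'a" where
  "coord_map s i a = B (rho (smul a (x s i))) (hexad_image (\<not> s) i)"

lemma x_hexad: "hexad x" and x_nil: "nil (x s i)" and x_nil': "nil (smul a (x s i))"
  using zornD(1)[OF x] nil_scale by (auto simp: hexad_def)

lemma x_gram: "B (x s i) (x t j) = (if s \<noteq> t \<and> i = j then 1 else 0)"
  using hexadD(4)[OF x_hexad] .

lemma image_hexad: "hexad hexad_image"
proof -
  have "B (hexad_image s i) (hexad_image t j) = (if s \<noteq> t \<and> i = j then 1 else 0)" for s t i j
  proof (cases "s \<noteq> t \<and> i = j")
    case True
    then show ?thesis
      unfolding hexad_image_def using rho_dual[OF x_nil x_nil] x_gram by simp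
  next
    case False
    then show ?thesis
      unfolding hexad_image_def using rho_orthogonal[OF x_nil x_nil] x_gram by simp
  qed
  then show ?thesis
    unfolding hexad_def using rho(1)[OF x_nil] by (simp add: hexad_image_def)
qed

text \<open>A multiple of a basis vector is orthogonal to all of the hexad except the opposite
  vector, and so is its image; the isotropy condition holds and one term survives.\<close>

lemma rho_scale: "rho (smul a (x s i)) = smul (coord_map s i a) (hexad_image s i)"
proof -
  have zero: "B (rho (smul a (x s i))) (hexad_image t j) = 0" if "\<not> (s \<noteq> t \<and> i = j)" for t j
  proof -
    have "B (smul a (x s i)) (x t j) = 0"
      using that by (auto simp: B_simps x_gram)
    then show ?thesis
      unfolding hexad_image_def by (rule rho_orthogonal[OF x_nil' x_nil])
  qed
  have self: "B (rho (smul a (x s i))) (hexad_image (\<not> s) i) = coord_map s i a"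
    by (simp add: coord_map_def)
  have "rho (smul a (x s i)) = smul (B (rho (smul a (x s i))) (hexad_image False I1)) (hexad_image True I1)
      + smul (B (rho (smul a (x s i))) (hexad_image False I2)) (hexad_image True I2)
      + smul (B (rho (smul a (x s i))) (hexad_image False I3)) (hexad_image True I3)
      + smul (B (rho (smul a (x s i))) (hexad_image True I1)) (hexad_image False I1)
      + smul (B (rho (smul a (x s i))) (hexad_image True I2)) (hexad_image False I2)
      + smul (B (rho (smul a (x s i))) (hexad_image True I3)) (hexad_image False I3)"
    by (rule isotropic_hexad_expansion[OF image_hexad rho(1)[OF x_nil']])
      (use zero in \<open>cases s; cases i; simp\<close>)
  also have "\<dots> = smul (coord_map s i a) (hexad_image s i)"
    using zero self by (cases s; cases i) simp_all
  finally show ?thesis .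
qed

lemma coord_map_inverse: "a \<noteq> 0 \<Longrightarrow> coord_map s i a * coord_map (\<not> s) i (1 / a) = 1"
  using rho_dual[OF x_nil'[of a s i] x_nil'[of "1 / a" "\<not> s" i]] hexadD(4)[OF image_hexad]
  by (simp add: B_simps x_gram rho_scale mult.commute)

lemma coord_map_zero: "coord_map s i 0 = 0"
  by (simp add: coord_map_def rho_zero B_simps)

lemma coord_map_one: "coord_map s i 1 = 1"
  using hexadD(4)[OF image_hexad, of s i "\<not> s" i] by (simp add: coord_map_def hexad_image_def)

text \<open>Scaling the opposite vector turns a nonzero value of B into 1, which \<open>rho\<close>
  preserves; \<open>coord_map_inverse\<close> undoes the scaling.\<close>

lemma B_rho:
  assumes m: "nil m"
  shows "B (rho m) (hexad_image (\<not> s) i) = coord_map s i (B m (x (\<not> s) i))"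
proof (cases "B m (x (\<not> s) i) = 0")
  case True
  then show ?thesis
    unfolding hexad_image_def using rho_orthogonal[OF m x_nil] by (simp add: coord_map_zero)
next
  case False
  define b where "b = B m (x (\<not> s) i)"
  have "B (rho m) (rho (smul (1 / b) (x (\<not> s) i))) = 1"
    using False by (intro rho_dual m x_nil') (simp add: B_simps b_def)
  then have 1: "coord_map (\<not> s) i (1 / b) * B (rho m) (hexad_image (\<not> s) i) = 1"
    by (simp add: rho_scale B_simps)
  have "coord_map s i b * coord_map (\<not> s) i (1 / b) = 1"
    using coord_map_inverse False by (simp add: b_def)
  then have "coord_map s i b * (coord_map (\<not> s) i (1 / b) * B (rho m) (hexad_image (\<not> s) i)) = B (rho m) (hexad_image (\<not> s) i)"
    by (simp only: mult.assoc[symmetric] mult_1_left)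
  then have "coord_map s i b * 1 = B (rho m) (hexad_image (\<not> s) i)"
    unfolding 1 .
  then show ?thesis
    by (simp add: b_def)
qed

text \<open>Two multiples of one nilpotent element are orthogonal with product zero, so
  \<open>rho_add_mul\<close> is plain additivity on the line.\<close>

lemma coord_map_add: "coord_map s i (a + b) = coord_map s i a + coord_map s i b"
proof -
  have sq: "x s i \<star> x s i = 0" "hexad_image s i \<star> hexad_image s i = 0"
    using nilD(4)[OF x_nil] nilD(4)[OF rho(1)[OF x_nil]] by (simp_all add: hexad_image_def)
  have "rho (smul a (x s i) + smul b (x s i) + smul a (x s i) \<star> smul b (x s i))
      = rho (smul a (x s i)) + rho (smul b (x s i)) + rho (smul a (x s i)) \<star> rho (smul b (x s i))"
    by (intro rho_add_mul x_nil') (simp add: B_simps x_gram)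
  then have "rho (smul (a + b) (x s i)) = smul (coord_map s i a) (hexad_image s i) + smul (coord_map s i b) (hexad_image s i)"
    by (simp add: mul_simps sq rho_scale scale_left_distrib)
  then show ?thesis
    unfolding coord_map_def[of s i "a + b"] using hexadD(4)[OF image_hexad, of s i "\<not> s" i] by (simp add: B_simps)
qed

text \<open>Isotropy is demanded for each pair separately, since at this point the coordinate maps
  are only known to preserve 0, not to respect sums of products.\<close>

lemma rho_hexad_expansion:
  assumes m: "nil m"
    and iso: "\<And>i. B m (x True i) = 0 \<or> B m (x False i) = 0"
  shows "rho m = smul (coord_map True I1 (B m (x False I1))) (hexad_image True I1)
     + smul (coord_map True I2 (B m (x False I2))) (hexad_image True I2) + smul (coord_map True I3 (B m (x False I3))) (hexad_image True I3)
     + smul (coord_map False I1 (B m (x True I1))) (hexad_image False I1) + smul (coord_map False I2 (B m (x True I2))) (hexad_image False I2)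
     + smul (coord_map False I3 (B m (x True I3))) (hexad_image False I3)"
proof -
  have B: "B (rho m) (hexad_image False i) = coord_map True i (B m (x False i))"
    "B (rho m) (hexad_image True i) = coord_map False i (B m (x True i))" for i
    using B_rho[OF m, of True i] B_rho[OF m, of False i] by simp_all
  have zero: "coord_map False i (B m (x True i)) * coord_map True i (B m (x False i)) = 0" for i
    using iso[of i] coord_map_zero by auto
  show ?thesis
    by (rule isotropic_hexad_expansion[OF image_hexad rho(1)[OF m], unfolded B])
      (simp only: zero add_0)
qed

text \<open>The product of the two basis vectors is zero, so m is their sum. Comparing
  \<open>rho_add_mul\<close> with the coordinates of \<open>rho m\<close> shows that the product of
  the images is zero as well.\<close>

lemma rho_opposite_product:
  assumes "i \<noteq> j"
  shows "hexad_image s i \<star> hexad_image (\<not> s) j = 0"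
proof -
  define m where "m = x s i + x (\<not> s) j"
  have zero: "x s i \<star> x (\<not> s) j = 0"
    using zornD(3)[OF x assms] .
  have orth: "B (x s i) (x (\<not> s) j) = 0"
    using assms by (simp add: x_gram)
  have m: "nil m" "rho m = hexad_image s i + hexad_image (\<not> s) j + hexad_image s i \<star> hexad_image (\<not> s) j"
    using nil_add_mul(2)[OF x_nil x_nil orth] rho_add_mul[OF x_nil x_nil orth]
    by (simp_all add: m_def zero hexad_image_def)
  have "rho m = hexad_image s i + hexad_image (\<not> s) j"
  proof -
    have Bm: "B m (x t l) = (if t \<noteq> s \<and> l = i then 1 else 0) + (if t = s \<and> l = j then 1 else 0)" for t l
      by (auto simp: m_def B_simps x_gram)
    have iso: "B m (x True l) = 0 \<or> B m (x False l) = 0" for l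
      unfolding Bm using assms by (cases s) auto
    show ?thesis
      unfolding rho_hexad_expansion[OF m(1) iso] Bm using assms
      by (cases s; cases i; cases j) (simp_all add: coord_map_zero coord_map_one)
  qed
  then show ?thesis using m(2) by simp
qed

text \<open>The element n + k + n k is a combination of three basis vectors with distinct indices;
  its image is computed by \<open>rho_add_mul\<close> and by coordinates. The case a = b = 1 gives
  the product rule, the general case multiplicativity.\<close>

lemma rho_product:
  shows "hexad_image s i \<star> hexad_image s (nxt i) = hexad_image (\<not> s) (nxt (nxt i))"
    and "coord_map (\<not> s) (nxt (nxt i)) (a * b) = coord_map s i a * coord_map s (nxt i) b"
proof -
  have main: "smul (coord_map (\<not> s) (nxt (nxt i)) (a * b)) (hexad_image (\<not> s) (nxt (nxt i))) =
      smul (coord_map s i a * coord_map s (nxt i) b) (hexad_image s i \<star> hexad_image s (nxt i))" for a b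
  proof -
    define n where "n = smul a (x s i)"
    define k where "k = smul b (x s (nxt i))"
    define m where "m = n + k + n \<star> k"
    have orth: "B n k = 0"
      by (simp add: n_def k_def B_simps x_gram)
    have nil: "nil n" "nil k"
      unfolding n_def k_def by (rule x_nil')+
    have nk: "n \<star> k = smul (a * b) (x (\<not> s) (nxt (nxt i)))"
      using zornD(2)[OF x] by (simp add: n_def k_def mul_simps mult.commute)
    have m: "nil m" "rho m = rho n + rho k + rho n \<star> rho k"
      unfolding m_def by (rule nil_add_mul(2)[OF nil orth], rule rho_add_mul[OF nil orth])
    have "B n (x t j) + B k (x t j) + B (n \<star> k) (x t j) = (if t \<noteq> s \<and> j = i then a else 0) + (if t \<noteq> s \<and> j = nxt i then b else 0)
        + (if t = s \<and> j = nxt (nxt i) then a * b else 0)" for t j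
      unfolding nk by (auto simp: n_def k_def B_simps x_gram)
    then have Bm: "B m (x t j) = (if t \<noteq> s \<and> j = i then a else 0) + (if t \<noteq> s \<and> j = nxt i then b else 0)
        + (if t = s \<and> j = nxt (nxt i) then a * b else 0)" for t j
      by (simp only: m_def B_simps)
    have iso: "B m (x True j) = 0 \<or> B m (x False j) = 0" for j
      unfolding Bm by (cases s; cases i; cases j) simp_all
    have "rho m = smul (coord_map s i a) (hexad_image s i) + smul (coord_map s (nxt i) b) (hexad_image s (nxt i))
        + smul (coord_map (\<not> s) (nxt (nxt i)) (a * b)) (hexad_image (\<not> s) (nxt (nxt i)))"
      unfolding rho_hexad_expansion[OF m(1) iso] Bm
      by (cases s; cases i) (simp_all add: coord_map_zero)
    then show ?thesis
      using m(2) by (simp add: n_def k_def rho_scale mul_simps mult.commute)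
  qed
  show *: "hexad_image s i \<star> hexad_image s (nxt i) = hexad_image (\<not> s) (nxt (nxt i))"
    using main[of 1 1] by (simp add: coord_map_one)
  have "B (smul (coord_map (\<not> s) (nxt (nxt i)) (a * b)) (hexad_image (\<not> s) (nxt (nxt i)))) (hexad_image s (nxt (nxt i)))
      = B (smul (coord_map s i a * coord_map s (nxt i) b) (hexad_image (\<not> s) (nxt (nxt i)))) (hexad_image s (nxt (nxt i)))"
    using main[of a b] unfolding * by (simp only:)
  then show "coord_map (\<not> s) (nxt (nxt i)) (a * b) = coord_map s i a * coord_map s (nxt i) b"
    using hexadD(4)[OF image_hexad] by (simp add: B_simps)
qed

lemma image_zorn: "zorn hexad_image"
  unfolding zorn_def using image_hexad rho_product(1) rho_opposite_product by blast

definition sigma :: "'a \<Rightarrow> 'a" where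
  "sigma = coord_map True I1"

text \<open>Setting one factor to 1 in \<open>rho_product\<close> identifies neighbouring coordinate
  maps, and these identifications link all six.\<close>

lemma coord_map_eq: "coord_map s i = sigma"
proof -
  have 1: "coord_map (\<not> s) (nxt (nxt i)) a = coord_map s i a" and 2: "coord_map (\<not> s) (nxt (nxt i)) a = coord_map s (nxt i) a" for s i a
    using rho_product(2)[of s i a 1] rho_product(2)[of s i 1 a] by (simp_all add: coord_map_one)
  have same: "coord_map s (nxt i) a = coord_map s i a" for s i a
    using 1[of s i a] 2[of s i a] by simp
  have s: "coord_map s i a = coord_map s I1 a" for s i a
    using same[of s I1 a] same[of s I2 a] by (cases i) simp_all
  have "coord_map (\<not> s) I1 a = coord_map s I1 a" for s a
    using 1[of s I1 a] s[of "\<not> s" I3 a] by simp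
  from this[of True] have "coord_map False I1 a = coord_map True I1 a" for a by simp
  then show ?thesis
    unfolding sigma_def using s[of s i] by (cases s) (simp_all add: fun_eq_iff)
qed

lemma sigma_field_aut: "sigma \<in> field_automorphisms"
proof -
  have add: "sigma (a + b) = sigma a + sigma b" for a b
    using coord_map_add[of True I1] by (simp add: sigma_def)
  have mul: "sigma (a * b) = sigma a * sigma b" for a b
    using rho_product(2)[of True I1 a b] by (simp only: coord_map_eq)
  have nonzero: "sigma a \<noteq> 0" if "a \<noteq> 0" for a
    using coord_map_inverse[OF that, of True I1] by (auto simp: sigma_def)
  have "inj sigma"
  proof (rule injI)
    fix a b
    assume "sigma a = sigma b"
    then have "sigma (a - b) = 0"
      using add[of "a - b" b] by simp
    then show "a = b" using nonzero[of "a - b"] by auto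
  qed
  \<comment> \<open>A preimage under \<open>rho\<close> of c times an image vector has a coordinate
    which \<open>sigma\<close> sends to c.\<close>
  moreover have "\<exists>a. c = sigma a" for c
  proof -
    have "nil (smul c (hexad_image True I1))"
      unfolding hexad_image_def by (rule nil_scale[OF rho(1)[OF x_nil]])
    then obtain n where n: "nil n" "rho n = smul c (hexad_image True I1)"
      using rho_surj by blast
    have "coord_map True I1 (B n (x False I1)) = B (rho n) (hexad_image False I1)"
      using B_rho[OF n(1), of True I1] by simp
    also have "\<dots> = c"
      using hexadD(4)[OF image_hexad] by (simp add: n(2) B_simps)
    finally show ?thesis by (auto simp: sigma_def)
  qed
  ultimately have "bij sigma"
    by (simp add: bij_def surj_def)
  then show ?thesis
    using add mul by (simp add: field_automorphisms_def)
qed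

lemma loop_rel_zmap:
  assumes "oct_norm z = 1" "R (zmap x z) w"
  shows "pm w (zmap hexad_image (oct_map sigma z))"
proof -
  note r = loop_relD[OF R]
  note s = field_autD[OF sigma_field_aut]
  \<comment> \<open>Norm one is part of the induction claim because only then do both factors have
    partners under \<open>R\<close>.\<close>
  define P where "P z \<longleftrightarrow> oct_norm z = 1 \<and> (\<forall>w. R (zmap x z) w \<longrightarrow> pm w (zmap hexad_image (oct_map sigma z)))" for z
  have map_mul: "oct_map sigma (omul u v) = omul (oct_map sigma u) (oct_map sigma v)" for u v
    using acts_oct_map[OF sigma_field_aut] unfolding acts_def oct_aut_def by blast
  have "P z"
  proof (rule norm_one_induct[OF _ _ _ _ _ _ _ assms(1)])
    fix z1 z2
    assume 1: "P z1" and 2: "P z2"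
    then have N: "N (zmap x z1) = 1" "N (zmap x z2) = 1"
      by (simp_all add: P_def zmap_norm[OF x])
    obtain w1 w2 where w: "R (zmap x z1) w1" "R (zmap x z2) w2"
      using r(3) N by blast
    have pm: "pm w1 (zmap hexad_image (oct_map sigma z1))" "pm w2 (zmap hexad_image (oct_map sigma z2))"
      using 1 2 w unfolding P_def by blast+
    have "oct_norm (omul z1 z2) = 1"
      using N norm_mul[of "zmap x z1" "zmap x z2"]
      by (simp only: zmap_mul[OF x, symmetric] zmap_norm[OF x]) simp
    moreover have "pm w' (zmap hexad_image (oct_map sigma (omul z1 z2)))" if "R (zmap x (omul z1 z2)) w'" for w'
    proof -
      have "pm w' (w1 \<star> w2)"
        using r(5)[OF that[unfolded zmap_mul[OF x]] r(6)[OF w]] by simp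
      moreover have "pm (w1 \<star> w2) (zmap hexad_image (oct_map sigma (omul z1 z2)))"
        unfolding map_mul zmap_mul[OF image_zorn] by (rule pm_mul[OF pm])
      ultimately show ?thesis by (rule pm_trans)
    qed
    ultimately show "P (omul z1 z2)" by (simp only: P_def) blast
  next
    have gen: "P z" if "oct_norm z = 1" "zmap x z = unit + smul c (x s i)"
        "zmap hexad_image (oct_map sigma z) = unit + smul (sigma c) (hexad_image s i)" for z c s i
    proof -
      have Rc: "R (unit + smul c (x s i)) (unit + smul (sigma c) (hexad_image s i))"
        using rho(2)[OF x_nil'] by (simp only: rho_scale coord_map_eq)
      have "pm w (zmap hexad_image (oct_map sigma z))" if "R (zmap x z) w" for w
        unfolding \<open>zmap hexad_image (oct_map sigma z) = _\<close>
        using r(5)[OF that[unfolded \<open>zmap x z = _\<close>] Rc] by simp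
      then show ?thesis
        unfolding P_def using \<open>oct_norm z = 1\<close> by (intro conjI allI impI)
    qed
    fix c
    show "P (1, 1, c, 0, 0, 0, 0, 0)" by (rule gen[of _ c True I1]) (simp_all add: s)
    show "P (1, 1, 0, c, 0, 0, 0, 0)" by (rule gen[of _ c True I2]) (simp_all add: s)
    show "P (1, 1, 0, 0, c, 0, 0, 0)" by (rule gen[of _ c True I3]) (simp_all add: s)
    show "P (1, 1, 0, 0, 0, c, 0, 0)" by (rule gen[of _ c False I1]) (simp_all add: s)
    show "P (1, 1, 0, 0, 0, 0, c, 0)" by (rule gen[of _ c False I2]) (simp_all add: s)
    show "P (1, 1, 0, 0, 0, 0, 0, c)" by (rule gen[of _ c False I3]) (simp_all add: s)
  qed
  then have "\<forall>w. R (zmap x z) w \<longrightarrow> pm w (zmap hexad_image (oct_map sigma z))"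
    unfolding P_def by (rule conjunct2)
  from this[rule_format, OF assms(2)] show ?thesis .
qed

end

end

subsection \<open>The automorphism group of the loop\<close>

abbreviation loop :: "'b set monoid" where
  "loop \<equiv> moufang_loop mul unit N"

lemma carrier_moufang_loop: "carrier loop = {{x, - x} | x. N x = 1}"
proof -
  have "{unit, - unit} #>\<^bsub>norm_one_loop mul unit N\<^esub> x = {x, - x}" for x
    by (simp add: r_coset_def norm_one_loop_def unit_left mul_simps insert_commute)
  then show ?thesis
    by (auto simp: moufang_loop_def FactGroup_def RCOSETS_def norm_one_loop_def)
qed

lemma sign_class_carrier: "N x = 1 \<Longrightarrow> {x, - x} \<in> carrier loop"
  unfolding carrier_moufang_loop by blast

lemma sign_classE:
  assumes "X \<in> {{x, - x} | x. N x = 1}"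
  obtains x where "N x = 1" "X = {x, - x}"
  using assms by (elim CollectE exE conjE) (rule that)

lemma mult_moufang_loop:
  "{x, - x} \<otimes>\<^bsub>loop\<^esub> {y, - y} = {x \<star> y, - (x \<star> y)}"
  by (auto simp: moufang_loop_def FactGroup_def set_mult_def norm_one_loop_def mul_simps)

lemma sign_class_eq: "{x, - x} = {y, - y} \<longleftrightarrow> pm x y"
  by (auto simp: pm_def doubleton_eq_iff)

lemma auto_moufangD:
  assumes "f \<in> carrier (AutoGroup loop)"
  shows "f \<in> extensional {{x, - x} | x. N x = 1}"
    "bij_betw f {{x, - x} | x. N x = 1} {{x, - x} | x. N x = 1}"
    "N x = 1 \<Longrightarrow> N y = 1 \<Longrightarrow>
      f {x \<star> y, - (x \<star> y)} = f {x, - x} \<otimes>\<^bsub>loop\<^esub> f {y, - y}"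
proof -
  show "f \<in> extensional {{x, - x} | x. N x = 1}"
    "bij_betw f {{x, - x} | x. N x = 1} {{x, - x} | x. N x = 1}"
    using assms by (auto simp: AutoGroup_def auto_def Bij_def carrier_moufang_loop)
  have hom: "f \<in> hom loop loop"
    using assms by (simp add: AutoGroup_def auto_def)
  assume "N x = 1" "N y = 1"
  then have "{x, - x} \<in> carrier loop" "{y, - y} \<in> carrier loop"
    unfolding carrier_moufang_loop by blast+
  from hom_mult[OF hom this]
  show "f {x \<star> y, - (x \<star> y)} = f {x, - x} \<otimes>\<^bsub>loop\<^esub> f {y, - y}"
    unfolding mult_moufang_loop .
qed

lemma auto_loop_rel:
  assumes f: "f \<in> carrier (AutoGroup loop)"
  shows "loop_rel (\<lambda>x y. N x = 1 \<and> N y = 1 \<and> f {x, - x} = {y, - y})"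
proof -
  let ?C = "{{x, - x} | x. N x = 1}"
  note bij = auto_moufangD(2)[OF f]
  have onto: "f ` ?C = ?C" and inj: "inj_on f ?C"
    using bij unfolding bij_betw_def by blast+
  have C: "{x, - x} \<in> ?C" if "N x = 1" for x
    using that by blast
  show ?thesis
    unfolding loop_rel_def
  proof (intro conjI allI impI)
    fix x
    assume x: "N x = 1"
    then have "f {x, - x} \<in> ?C" using onto by blast
    then show "\<exists>y. N x = 1 \<and> N y = 1 \<and> f {x, - x} = {y, - y}" using x by blast
    have "{x, - x} \<in> f ` ?C" unfolding onto using x by blast
    then show "\<exists>y. N y = 1 \<and> N x = 1 \<and> f {y, - y} = {x, - x}" using x by auto
  next
    fix x y x' y'
    assume 1: "N x = 1 \<and> N y = 1 \<and> f {x, - x} = {y, - y}"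
      and 2: "N x' = 1 \<and> N y' = 1 \<and> f {x', - x'} = {y', - y'}"
    have "f {x, - x} = f {x', - x'} \<longleftrightarrow> {x, - x} = {x', - x'}"
      using 1 2 by (intro inj_on_eq_iff[OF inj C C]) simp_all
    moreover have "f {x, - x} = {y, - y}" "f {x', - x'} = {y', - y'}"
      using 1 2 by simp_all
    ultimately show "pm x x' = pm y y'"
      by (simp only: sign_class_eq)
    show "f {x \<star> x', - (x \<star> x')} = {y \<star> y', - (y \<star> y')}"
      using auto_moufangD(3)[OF f, of x x'] 1 2 by (simp only: mult_moufang_loop)
    show "N (x \<star> x') = 1" "N (y \<star> y') = 1"
      using 1 2 by (simp_all add: norm_mul)
  qed (auto simp: insert_commute)
qed

lemma semilinear_induces:
  assumes bij: "bij \<alpha>" and add: "\<And>u v. \<alpha> (u + v) = \<alpha> u + \<alpha> v"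
    and mul: "\<And>u v. \<alpha> (u \<star> v) = \<alpha> u \<star> \<alpha> v" and norm: "\<And>u. N (\<alpha> u) = 1 \<longleftrightarrow> N u = 1"
  shows "\<exists>f \<in> carrier (AutoGroup loop). induced_by N \<alpha> f"
proof -
  let ?C = "{{x, - x} | x. N x = 1}"
  have zero: "\<alpha> 0 = 0" using add[of 0 0] by simp
  have minus: "\<alpha> (- u) = - \<alpha> u" for u
    using add[of u "- u"] zero by (simp add: eq_neg_iff_add_eq_0 add.commute)
  have img: "\<alpha> ` {x, - x} = {\<alpha> x, - \<alpha> x}" for x
    by (simp add: minus)
  \<comment> \<open>Elements of \<open>AutoGroup\<close> are extensional, hence the restriction to
    the carrier.\<close>
  define f where "f = restrict (image \<alpha>) ?C"
  have f: "f {x, - x} = {\<alpha> x, - \<alpha> x}" if "N x = 1" for x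
    unfolding f_def restrict_def using that img by auto
  have "inj_on f ?C"
  proof (rule inj_onI)
    fix X Y
    assume "X \<in> ?C" "Y \<in> ?C" "f X = f Y"
    then have "\<alpha> ` X = \<alpha> ` Y" by (simp add: f_def)
    then show "X = Y" using bij_is_inj[OF bij] by (simp add: inj_image_eq_iff)
  qed
  moreover have "f ` ?C = ?C"
  proof
    show "f ` ?C \<subseteq> ?C" using f norm by fastforce
    show "?C \<subseteq> f ` ?C"
    proof
      fix X
      assume "X \<in> ?C"
      then obtain x where x: "N x = 1" "X = {x, - x}" by (rule sign_classE)
      obtain u where u: "x = \<alpha> u"
        using surjD[OF bij_is_surj[OF bij], of x] by (elim exE) (rule that)
      then have "N u = 1" using norm x(1) by simp
      then show "X \<in> f ` ?C" using f[of u] x(2) u by (intro image_eqI[of _ _ "{u, - u}"]) auto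
    qed
  qed
  ultimately have "f \<in> Bij ?C"
    by (simp add: Bij_def bij_betw_def f_def)
  moreover have "f \<in> hom loop loop"
  proof (rule homI)
    fix X
    assume "X \<in> carrier loop"
    then have "f X \<in> f ` ?C"
      unfolding carrier_moufang_loop by (rule imageI)
    then show "f X \<in> carrier loop"
      unfolding carrier_moufang_loop \<open>f ` ?C = ?C\<close> .
  next
    fix X Y
    assume X: "X \<in> carrier loop" and Y: "Y \<in> carrier loop"
    obtain x where x: "N x = 1" "X = {x, - x}"
      using X unfolding carrier_moufang_loop by (rule sign_classE)
    obtain y where y: "N y = 1" "Y = {y, - y}"
      using Y unfolding carrier_moufang_loop by (rule sign_classE)
    show "f (X \<otimes>\<^bsub>loop\<^esub> Y) = f X \<otimes>\<^bsub>loop\<^esub> f Y"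
      unfolding x(2) y(2) f[OF x(1)] f[OF y(1)] mult_moufang_loop
      using f[of "x \<star> y"] x(1) y(1) by (simp add: norm_mul mul)
  qed
  ultimately have "f \<in> carrier (AutoGroup loop)"
    by (simp add: AutoGroup_def auto_def carrier_moufang_loop)
  then show ?thesis
    using f by (auto simp: induced_by_def)
qed

section \<open>Loop automorphisms and pairs of a matrix and a field automorphism\<close>

context
  fixes \<phi> :: "'a oct \<Rightarrow> 'b"
  assumes \<phi>: "oct_iso \<phi>"
begin

lemma phi:
  "bij \<phi>" "\<phi> (u + v) = \<phi> u + \<phi> v" "\<phi> (oscale c u) = smul c (\<phi> u)" "\<phi> (omul u v) = \<phi> u \<star> \<phi> v"
  "N (\<phi> u) = oct_norm u" "\<phi> u = \<phi> v \<longleftrightarrow> u = v"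
  using \<phi> by (auto simp: oct_iso_def bij_is_inj inj_eq)

lemma phi_onto: obtains u where "x = \<phi> u"
  using surjD[OF bij_is_surj[OF phi(1)], of x] by (elim exE) (rule that)

text \<open>A relation instead of a map, so that totality, uniqueness and multiplicativity can be
  shown separately and assembled by \<open>iso_from_relation\<close>.\<close>

definition represents :: "('b set \<Rightarrow> 'b set) \<Rightarrow> 'a ^ g2_basis ^ g2_basis \<Rightarrow> ('a \<Rightarrow> 'a) \<Rightarrow> bool" where
  "represents f A \<theta> \<longleftrightarrow> \<theta> \<in> field_automorphisms \<and>
     (\<exists>\<beta>. acts \<beta> A \<theta> \<and> (\<forall>z. oct_norm z = 1 \<longrightarrow> f {\<phi> z, - \<phi> z} = {\<phi> (\<beta> z), - \<phi> (\<beta> z)}))"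

lemma semilinear_conj:
  assumes \<theta>: "\<theta> \<in> field_automorphisms" and \<beta>: "oct_aut \<theta> \<beta>"
  defines "\<alpha> \<equiv> \<phi> \<circ> \<beta> \<circ> inv_into UNIV \<phi>"
  shows "\<alpha> (\<phi> u) = \<phi> (\<beta> u)" "semilinear_automorphism smul mul \<alpha>" "N (\<alpha> x) = 1 \<longleftrightarrow> N x = 1"
proof -
  show conj: "\<alpha> (\<phi> u) = \<phi> (\<beta> u)" for u
    using phi(1) by (simp add: \<alpha>_def bij_is_inj)
  note \<beta>' = oct_autD[OF \<beta>]
  have "bij \<alpha>"
    unfolding \<alpha>_def by (intro bij_comp phi(1) \<beta>'(1) bij_imp_bij_inv)
  moreover have "\<alpha> (x + y) = \<alpha> x + \<alpha> y" for x y
  proof -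
    obtain u where "x = \<phi> u" by (rule phi_onto)
    moreover obtain v where "y = \<phi> v" by (rule phi_onto)
    ultimately show ?thesis by (simp only: phi(2)[symmetric] conj \<beta>'(2))
  qed
  moreover have "\<alpha> (x \<star> y) = \<alpha> x \<star> \<alpha> y" for x y
  proof -
    obtain u where "x = \<phi> u" by (rule phi_onto)
    moreover obtain v where "y = \<phi> v" by (rule phi_onto)
    ultimately show ?thesis by (simp only: phi(4)[symmetric] conj \<beta>'(4))
  qed
  moreover have "\<alpha> (smul c x) = smul (\<theta> c) (\<alpha> x)" for c x
  proof -
    obtain u where "x = \<phi> u" by (rule phi_onto)
    then show ?thesis by (simp only: phi(3)[symmetric] conj \<beta>'(3))
  qed
  ultimately show "semilinear_automorphism smul mul \<alpha>"
    using \<theta> unfolding semilinear_automorphism_def by blast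
  obtain u where u: "x = \<phi> u" by (rule phi_onto)
  have "\<theta> (oct_norm u) = 1 \<longleftrightarrow> oct_norm u = 1"
    using field_autD(5)[OF \<theta>] inj_eq[OF bij_is_inj[OF field_autD(1)[OF \<theta>]], of "oct_norm u" 1] by simp
  then show "N (\<alpha> x) = 1 \<longleftrightarrow> N x = 1"
    by (simp only: u conj phi(5) oct_aut_norm[OF \<beta> \<theta>])
qed

text \<open>The class of 1 + u determines the image of a nilpotent u without sign ambiguity.
  Multiples of u_1 then determine \<theta>, and e = - u_1 v_1 together with the u_i determines
  \<beta>.\<close>

lemma represents_unique:
  assumes "represents f A \<theta>" "represents f A' \<theta>'"
  shows "A = A' \<and> \<theta> = \<theta>'"
proof -
  obtain \<beta> where \<theta>: "\<theta> \<in> field_automorphisms" and \<beta>: "acts \<beta> A \<theta>"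
      "\<And>z. oct_norm z = 1 \<Longrightarrow> f {\<phi> z, - \<phi> z} = {\<phi> (\<beta> z), - \<phi> (\<beta> z)}"
    using assms(1) unfolding represents_def by blast
  obtain \<beta>' where \<theta>': "\<theta>' \<in> field_automorphisms" and \<beta>': "acts \<beta>' A' \<theta>'"
      "\<And>z. oct_norm z = 1 \<Longrightarrow> f {\<phi> z, - \<phi> z} = {\<phi> (\<beta>' z), - \<phi> (\<beta>' z)}"
    using assms(2) unfolding represents_def by blast
  have aut: "oct_aut \<theta> \<beta>" "oct_aut \<theta>' \<beta>'"
    using \<beta>(1) \<beta>'(1) by (auto simp: acts_def)
  have one: "\<phi> (1, 1, 0, 0, 0, 0, 0, 0) = unit"
  proof -
    have "omul (1, 1, 0, 0, 0, 0, 0, 0) u = u" for u :: "'a oct"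
      by (cases u rule: oct_cases) simp
    then have "\<phi> (1, 1, 0, 0, 0, 0, 0, 0) \<star> \<phi> u = \<phi> u" for u
      by (simp only: phi(4)[symmetric])
    moreover obtain u where u: "unit = \<phi> u" by (rule phi_onto)
    ultimately have "\<phi> (1, 1, 0, 0, 0, 0, 0, 0) \<star> unit = unit" by (simp only: u)
    then show ?thesis by (simp only: unit_right)
  qed
  have nil: "nil (\<phi> (\<kappa> u))" "unit + \<phi> (\<kappa> u) = \<phi> (\<kappa> ((1, 1, 0, 0, 0, 0, 0, 0) + u))"
    if \<kappa>: "oct_aut \<eta> \<kappa>" "\<eta> \<in> field_automorphisms" and u: "oct_norm u = 0" "oct_norm ((1, 1, 0, 0, 0, 0, 0, 0) + u) = 1"
    for \<kappa> \<eta> u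
  proof -
    show eq: "unit + \<phi> (\<kappa> u) = \<phi> (\<kappa> ((1, 1, 0, 0, 0, 0, 0, 0) + u))"
      by (simp only: oct_autD(2)[OF \<kappa>(1)] oct_aut_one[OF \<kappa>(1)] phi(2) one)
    have "N (unit + \<phi> (\<kappa> u)) = 1" "N (\<phi> (\<kappa> u)) = 0"
      unfolding eq phi(5) oct_aut_norm[OF \<kappa>] u using field_autD[OF \<kappa>(2)] by simp_all
    then show "nil (\<phi> (\<kappa> u))"
      using B_sym[of unit] by (simp add: nil_def N_add)
  qed
  have agree: "\<beta> u = \<beta>' u" if u: "oct_norm u = 0" "oct_norm ((1, 1, 0, 0, 0, 0, 0, 0) + u) = 1" for u
  proof -
    have "{unit + \<phi> (\<beta> u), - (unit + \<phi> (\<beta> u))} = {unit + \<phi> (\<beta>' u), - (unit + \<phi> (\<beta>' u))}"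
      unfolding nil(2)[OF aut(1) \<theta> u] nil(2)[OF aut(2) \<theta>' u] \<beta>(2)[OF u(2), symmetric] \<beta>'(2)[OF u(2), symmetric] ..
    then have "\<phi> (\<beta> u) = \<phi> (\<beta>' u)"
      unfolding sign_class_eq
      by (rule pm_unit_add_nil[OF nil(1)[OF aut(1) \<theta> u] nil(1)[OF aut(2) \<theta>' u]])
    then show ?thesis by (simp only: phi(6))
  qed
  have u: "\<beta> (0, 0, c, 0, 0, 0, 0, 0) = \<beta>' (0, 0, c, 0, 0, 0, 0, 0)" "\<beta> ou2 = \<beta>' ou2" "\<beta> ou3 = \<beta>' ou3" "\<beta> ov1 = \<beta>' ov1" for c
    by (rule agree; simp)+
  have "\<theta> = \<theta>'"
  proof
    fix c
    have "oscale (\<theta> c) (\<beta> ou1) = \<beta> (0, 0, c, 0, 0, 0, 0, 0)"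
      using oct_autD(3)[OF aut(1), of c ou1] by simp
    also have "\<dots> = oscale (\<theta>' c) (\<beta> ou1)"
      using oct_autD(3)[OF aut(2), of c ou1] u(1)[of c] u(1)[of 1] by simp
    finally have eq: "oscale (\<theta> c) (\<beta> ou1) = oscale (\<theta>' c) (\<beta> ou1)" .
    show "\<theta> c = \<theta>' c"
    proof (rule ccontr)
      assume ne: "\<theta> c \<noteq> \<theta>' c"
      have "oscale (\<theta> c - \<theta>' c) (\<beta> ou1) = 0"
        using oscale_add[of "\<theta> c - \<theta>' c" "\<theta>' c" "\<beta> ou1"] eq by simp
      then have "oscale (1 / (\<theta> c - \<theta>' c)) (oscale (\<theta> c - \<theta>' c) (\<beta> ou1)) = 0"
        by (simp only: oscale_simps)
      then have "\<beta> ou1 = 0"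
        using ne by (simp add: oscale_oscale)
      then have "ou1 = (0 :: 'a oct)"
        using oct_aut_inj[OF aut(1), of ou1 0] by (simp only: oct_aut_zero[OF aut(1)] simp_thms)
      then show False by (simp add: zero_prod_def)
    qed
  qed
  moreover have "\<beta> oe = \<beta>' oe"
  proof -
    have *: "oe = - omul ou1 (ov1 :: 'a oct)" by simp
    show ?thesis
      unfolding * oct_aut_uminus[OF aut(1)] oct_aut_uminus[OF aut(2)] oct_autD(4)[OF aut(1)]
        oct_autD(4)[OF aut(2)] u ..
  qed
  ultimately have "\<beta> = \<beta>'"
    using aut u by (intro oct_aut_cong_generators[of \<theta> \<beta> \<beta>']) simp_all
  then show ?thesis
    using acts_unique_matrix \<beta>(1) \<beta>'(1) \<open>\<theta> = \<theta>'\<close> by blast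
qed

lemma represents_determines:
  assumes "represents f A \<theta>" "represents g A \<theta>"
    and "f \<in> carrier (AutoGroup loop)" "g \<in> carrier (AutoGroup loop)"
  shows "f = g"
proof -
  obtain \<beta> where \<theta>: "\<theta> \<in> field_automorphisms" and \<beta>: "acts \<beta> A \<theta>"
      "\<And>z. oct_norm z = 1 \<Longrightarrow> f {\<phi> z, - \<phi> z} = {\<phi> (\<beta> z), - \<phi> (\<beta> z)}"
    using assms(1) unfolding represents_def by blast
  obtain \<beta>' where \<beta>': "acts \<beta>' A \<theta>"
      "\<And>z. oct_norm z = 1 \<Longrightarrow> g {\<phi> z, - \<phi> z} = {\<phi> (\<beta>' z), - \<phi> (\<beta>' z)}"
    using assms(2) unfolding represents_def by blast
  have "\<beta> = \<beta>'"
    by (rule acts_unique_map[OF \<beta>(1) \<beta>'(1) \<theta>])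
  have "f X = g X" if X: "X \<in> {{x, - x} | x. N x = 1}" for X
  proof -
    obtain x where x: "N x = 1" "X = {x, - x}" using X by (rule sign_classE)
    obtain z where z: "x = \<phi> z" by (rule phi_onto)
    then have "oct_norm z = 1" using x(1) by (simp only: phi(5))
    then show ?thesis
      unfolding x(2) z using \<beta>(2) \<beta>'(2) \<open>\<beta> = \<beta>'\<close> by simp
  qed
  then show ?thesis
    by (rule extensionalityI[OF auto_moufangD(1)[OF assms(3)] auto_moufangD(1)[OF assms(4)]])
qed

lemma represents_compose:
  assumes f: "represents f A \<theta>" and g: "represents g A' \<theta>'"
    and fg: "f \<in> carrier (AutoGroup loop)" "g \<in> carrier (AutoGroup loop)"
  shows "represents (f \<otimes>\<^bsub>AutoGroup loop\<^esub> g) (A ** map_matrix \<theta> A') (\<theta> \<circ> \<theta>')"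
proof -
  obtain \<beta> where \<theta>: "\<theta> \<in> field_automorphisms" and \<beta>: "acts \<beta> A \<theta>"
      "\<And>z. oct_norm z = 1 \<Longrightarrow> f {\<phi> z, - \<phi> z} = {\<phi> (\<beta> z), - \<phi> (\<beta> z)}"
    using f unfolding represents_def by blast
  obtain \<beta>' where \<theta>': "\<theta>' \<in> field_automorphisms" and \<beta>': "acts \<beta>' A' \<theta>'"
      "\<And>z. oct_norm z = 1 \<Longrightarrow> g {\<phi> z, - \<phi> z} = {\<phi> (\<beta>' z), - \<phi> (\<beta>' z)}"
    using g unfolding represents_def by blast
  have "\<theta> \<circ> \<theta>' \<in> field_automorphisms"
    using \<theta> \<theta>' by (auto simp: field_automorphisms_def intro: bij_comp)
  moreover have "acts (\<beta> \<circ> \<beta>') (A ** map_matrix \<theta> A') (\<theta> \<circ> \<theta>')"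
    by (rule acts_comp[OF \<beta>(1) \<beta>'(1)])
  moreover have "(f \<otimes>\<^bsub>AutoGroup loop\<^esub> g) {\<phi> z, - \<phi> z}
      = {\<phi> ((\<beta> \<circ> \<beta>') z), - \<phi> ((\<beta> \<circ> \<beta>') z)}" if z: "oct_norm z = 1" for z
  proof -
    have fg': "f \<in> Bij (carrier loop)" "g \<in> Bij (carrier loop)"
      using fg by (auto simp: AutoGroup_def auto_def)
    have "f \<otimes>\<^bsub>AutoGroup loop\<^esub> g = compose (carrier loop) f g"
      using fg' by (simp add: AutoGroup_def BijGroup_def)
    moreover have "{\<phi> z, - \<phi> z} \<in> carrier loop"
      by (rule sign_class_carrier) (simp only: phi(5) z)
    moreover have "oct_norm (\<beta>' z) = 1"
      using oct_aut_norm[OF _ \<theta>', of \<beta>' z] \<beta>'(1) z field_autD(5)[OF \<theta>'] by (simp add: acts_def)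
    ultimately show ?thesis
      using \<beta>(2)[of "\<beta>' z"] \<beta>'(2)[OF z] by (simp add: compose_def)
  qed
  ultimately show ?thesis
    unfolding represents_def by blast
qed

end

lemma oct_iso_transition:
  assumes "oct_iso \<phi>" "oct_iso \<psi>"
  shows "oct_aut id (inv_into UNIV \<phi> \<circ> \<psi>)"
proof -
  note p = phi[OF assms(1)] and q = phi[OF assms(2)]
  define \<beta> where "\<beta> = inv_into UNIV \<phi> \<circ> \<psi>"
  have \<beta>: "\<phi> (\<beta> u) = \<psi> u" for u
    using surj_f_inv_f[OF bij_is_surj[OF p(1)]] by (simp add: \<beta>_def)
  have eqI: "u = v" if "\<phi> u = \<phi> v" for u v
    using that p(6) by blast
  have "bij \<beta>"
    unfolding \<beta>_def by (intro bij_comp q(1) bij_imp_bij_inv p(1))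
  moreover have "\<beta> (u + v) = \<beta> u + \<beta> v" for u v
    by (rule eqI) (simp only: p(2) \<beta> q(2))
  moreover have "\<beta> (oscale c u) = oscale (id c) (\<beta> u)" for c u
    by (rule eqI) (simp only: p(3) \<beta> q(3) id_apply)
  moreover have "\<beta> (omul u v) = omul (\<beta> u) (\<beta> v)" for u v
    by (rule eqI) (simp only: p(4) \<beta> q(4))
  ultimately have "oct_aut id \<beta>"
    unfolding oct_aut_def by (intro conjI allI)
  then show ?thesis by (simp only: \<beta>_def)
qed

lemma auto_represented:
  assumes f: "f \<in> carrier (AutoGroup loop)" and x: "zorn x"
  shows "\<exists>A\<in>carrier G2_group. \<exists>\<theta>. represents (zmap x) f A \<theta>"
proof -
  define R where "R = (\<lambda>x y. N x = 1 \<and> N y = 1 \<and> f {x, - x} = {y, - y})"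
  have R: "loop_rel R"
    unfolding R_def by (rule auto_loop_rel[OF f])
  define \<theta> where "\<theta> = sigma R x"
  define \<psi> where "\<psi> = zmap (hexad_image R x)"
  note iso = zmap_iso[OF x] and iso' = zmap_iso[OF image_zorn[OF R x], folded \<psi>_def]
  have \<theta>: "\<theta> \<in> field_automorphisms"
    unfolding \<theta>_def by (rule sigma_field_aut[OF R x])
  \<comment> \<open>Coordinatewise \<theta>, followed by the linear change from the image Zorn basis
    back to the coordinates of \<open>x\<close>.\<close>
  define \<beta> where "\<beta> = (inv_into UNIV (zmap x) \<circ> \<psi>) \<circ> oct_map \<theta>"
  have "oct_aut \<theta> (oct_map \<theta>)"
    using acts_oct_map[OF \<theta>] by (simp only: acts_def)
  from oct_aut_comp[OF oct_iso_transition[OF iso iso'] this] have "oct_aut \<theta> \<beta>"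
    by (simp only: \<beta>_def id_comp)
  from oct_aut_acts[OF this \<theta>] obtain A where A: "A \<in> carrier G2_group" "acts \<beta> A \<theta>"
    by (elim bexE)
  have "f {zmap x z, - zmap x z} = {zmap x (\<beta> z), - zmap x (\<beta> z)}" if z: "oct_norm z = 1" for z
  proof -
    obtain w where w: "R (zmap x z) w"
      using loop_relD(3)[OF R, of "zmap x z"] z zmap_norm[OF x] by auto
    have "zmap x (\<beta> z) = \<psi> (oct_map \<theta> z)"
      using surj_f_inv_f[OF bij_is_surj[OF phi(1)[OF iso]]] by (simp only: \<beta>_def comp_apply)
    moreover have "pm w (\<psi> (oct_map \<theta> z))"
      unfolding \<psi>_def \<theta>_def by (rule loop_rel_zmap[OF R x z w])
    ultimately have "{w, - w} = {zmap x (\<beta> z), - zmap x (\<beta> z)}"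
      unfolding sign_class_eq by (simp only:)
    then show ?thesis
      using w by (simp only: R_def)
  qed
  then have "represents (zmap x) f A \<theta>"
    unfolding represents_def[OF iso] using \<theta> A(2) by blast
  then show ?thesis using A(1) by blast
qed

lemma represented_semilinear:
  assumes iso: "oct_iso \<phi>" and f: "represents \<phi> f A \<theta>"
  shows "\<exists>\<alpha>. semilinear_automorphism smul mul \<alpha> \<and> induced_by N \<alpha> f"
proof -
  obtain \<beta> where \<theta>: "\<theta> \<in> field_automorphisms" and \<beta>: "acts \<beta> A \<theta>"
      "\<And>z. oct_norm z = 1 \<Longrightarrow> f {\<phi> z, - \<phi> z} = {\<phi> (\<beta> z), - \<phi> (\<beta> z)}"
    using f unfolding represents_def[OF iso] by blast
  have aut: "oct_aut \<theta> \<beta>" using \<beta>(1) by (simp only: acts_def)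
  define \<alpha> where "\<alpha> = \<phi> \<circ> \<beta> \<circ> inv_into UNIV \<phi>"
  note \<alpha> = semilinear_conj[OF iso \<theta> aut, folded \<alpha>_def]
  have "f {x, - x} = {\<alpha> x, - \<alpha> x}" if x: "N x = 1" for x
  proof -
    obtain u where u: "x = \<phi> u" by (rule phi_onto[OF iso])
    then have "oct_norm u = 1" using x by (simp only: phi(5)[OF iso])
    then show ?thesis
      using \<beta>(2)[of u] by (simp only: u \<alpha>(1))
  qed
  then show ?thesis
    using \<alpha>(2) unfolding induced_by_def by blast
qed

lemma represented_onto:
  assumes iso: "oct_iso \<phi>" and A: "A \<in> carrier G2_group" and \<theta>: "\<theta> \<in> field_automorphisms"
  shows "\<exists>f\<in>carrier (AutoGroup loop). represents \<phi> f A \<theta>"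
proof -
  obtain \<gamma> where \<gamma>: "acts \<gamma> A id" using G2_acts[OF A] by blast
  define \<beta> where "\<beta> = \<gamma> \<circ> oct_map \<theta>"
  have \<beta>: "acts \<beta> A \<theta>"
    using acts_comp[OF \<gamma> acts_oct_map[OF \<theta>]] by (simp only: \<beta>_def map_matrix_id matrix_mul_rid id_comp)
  then have aut: "oct_aut \<theta> \<beta>" by (simp only: acts_def)
  define \<alpha> where "\<alpha> = \<phi> \<circ> \<beta> \<circ> inv_into UNIV \<phi>"
  note \<alpha> = semilinear_conj[OF iso \<theta> aut, folded \<alpha>_def]
  obtain f where f: "f \<in> carrier (AutoGroup loop)" "induced_by N \<alpha> f"
    using semilinear_induces[of \<alpha>] \<alpha>(2,3) unfolding semilinear_automorphism_def by blast
  have "f {\<phi> z, - \<phi> z} = {\<phi> (\<beta> z), - \<phi> (\<beta> z)}" if "oct_norm z = 1" for z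
    using f(2) that unfolding induced_by_def by (simp only: phi(5)[OF iso] \<alpha>(1)[symmetric])
  then have "represents \<phi> f A \<theta>"
    unfolding represents_def[OF iso] using \<theta> \<beta> by blast
  then show ?thesis using f(1) by blast
qed

text \<open>A left zero divisor has norm 0. If its trace is nonzero, it scales to an e of trace 1;
  for a nonzero a orthogonal to 1 and e, either e a is nonzero and nilpotent, or e a = 0 and a
  itself is nilpotent.\<close>

lemma exists_nil:
  assumes "u \<noteq> 0" "v \<noteq> 0" "u \<star> v = 0"
  shows "\<exists>n. nil n \<and> n \<noteq> 0"
proof -
  have Nu: "N u = 0"
    using cnj_cancel(1)[of u v] assms by (simp add: mul_simps)
  show ?thesis
  proof (cases "B u unit = 0")
    case True
    then show ?thesis using Nu assms(1) by (auto simp: nil_def)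
  next
    case False
    define e where "e = smul (1 / B u unit) u"
    have e: "N e = 0" "B e unit = 1" "B unit e = 1"
      using Nu False by (simp_all add: e_def norm_scale B_simps B_sym[of unit])
    have "\<not> UNIV \<subseteq> span {unit, e}"
    proof
      assume "UNIV \<subseteq> span {unit, e}"
      then have "dim (UNIV :: 'b set) \<le> card {unit, e}"
        by (rule dim_le_card) simp
      also have "\<dots> \<le> 2"
        using card_length[of "[unit, e]"] by simp
      finally show False using dim_8 by simp
    qed
    then obtain w where w: "w \<notin> span {unit, e}" by blast
    \<comment> \<open>The coefficients invert the Gram matrix of 1 and e, with rows (2, 1) and (1,
      0).\<close>
    define a where "a = w - (smul (B w e) unit + smul (B w unit - 2 * B w e) e)"
    have Ba: "B a unit = 0" "B a e = 0"
      using e by (simp_all add: a_def B_simps B_self)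
    have "a \<noteq> 0"
    proof
      assume "a = 0"
      then have "w = smul (B w e) unit + smul (B w unit - 2 * B w e) e"
        by (simp add: a_def)
      also have "\<dots> \<in> span {unit, e}"
        by (intro span_add span_scale span_base) simp_all
      finally show False using w by simp
    qed
    show ?thesis
    proof (cases "e \<star> a = 0")
      case True
      have "N (unit - e) = 0"
        using e by (simp add: N_diff)
      then have "N ((unit - e) \<star> a) = 0"
        by (simp add: norm_mul)
      then have "N a = 0"
        using True by (simp add: mul_simps unit_left)
      then show ?thesis using Ba \<open>a \<noteq> 0\<close> by (auto simp: nil_def)
    next
      case False
      have "B (e \<star> a) unit = 0"
        using e Ba by (simp add: B_adjoint_left unit_right cnj_def B_simps)
      then have "nil (e \<star> a)"
        using e by (simp add: nil_def norm_mul)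
      then show ?thesis using False by blast
    qed
  qed
qed

end

lemma iso_from_relation:
  assumes total: "\<And>f. f \<in> carrier G \<Longrightarrow> \<exists>p\<in>carrier K. Q f p"
    and onto: "\<And>p. p \<in> carrier K \<Longrightarrow> \<exists>f\<in>carrier G. Q f p"
    and unique: "\<And>f p q. f \<in> carrier G \<Longrightarrow> Q f p \<Longrightarrow> Q f q \<Longrightarrow> p = q"
    and inj: "\<And>f g p. f \<in> carrier G \<Longrightarrow> g \<in> carrier G \<Longrightarrow> Q f p \<Longrightarrow> Q g p \<Longrightarrow> f = g"
    and mult: "\<And>f g p q. f \<in> carrier G \<Longrightarrow> g \<in> carrier G \<Longrightarrow> Q f p \<Longrightarrow> Q g q \<Longrightarrow>
      f \<otimes>\<^bsub>G\<^esub> g \<in> carrier G \<and> Q (f \<otimes>\<^bsub>G\<^esub> g) (p \<otimes>\<^bsub>K\<^esub> q)"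
  shows "G \<cong> K"
proof -
  define h where "h f = (THE p. Q f p)" for f
  have h_eq: "h f = p" if "f \<in> carrier G" "Q f p" for f p
    unfolding h_def using that unique by (intro the_equality) blast+
  have h: "h f \<in> carrier K" "Q f (h f)" if f: "f \<in> carrier G" for f
  proof -
    obtain p where "p \<in> carrier K" "Q f p" using total[OF f] by blast
    then show "h f \<in> carrier K" "Q f (h f)" using h_eq[OF f] by auto
  qed
  have "h \<in> hom G K"
  proof (rule homI)
    show "h f \<in> carrier K" if "f \<in> carrier G" for f
      using h(1)[OF that] .
    show "h (f \<otimes>\<^bsub>G\<^esub> g) = h f \<otimes>\<^bsub>K\<^esub> h g" if "f \<in> carrier G" "g \<in> carrier G" for f g
      using mult[OF that h(2) h(2)] that by (intro h_eq) simp_all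
  qed
  moreover have "bij_betw h (carrier G) (carrier K)"
    unfolding bij_betw_def
  proof
    show "inj_on h (carrier G)"
    proof (rule inj_onI)
      fix f g
      assume fg: "f \<in> carrier G" "g \<in> carrier G" and "h f = h g"
      then have "Q g (h f)" using h(2)[OF fg(2)] by simp
      then show "f = g" by (rule inj[OF fg h(2)[OF fg(1)]])
    qed
    show "h ` carrier G = carrier K"
    proof
      show "h ` carrier G \<subseteq> carrier K"
        using h(1) by blast
      show "carrier K \<subseteq> h ` carrier G"
      proof
        fix p
        assume "p \<in> carrier K"
        from onto[OF this] obtain f where f: "f \<in> carrier G" "Q f p" by blast
        then show "p \<in> h ` carrier G"
          using h_eq[OF f] by blast
      qed
    qed
  qed
  ultimately show ?thesis
    by (intro is_isoI) (simp add: iso_def)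
qed

theorem theorem2p3:
  fixes smul :: "'f::field \<Rightarrow> 'c::ab_group_add \<Rightarrow> 'c"
    and mul :: "'c \<Rightarrow> 'c \<Rightarrow> 'c" and unit :: 'c and N :: "'c \<Rightarrow> 'f"
  assumes "perfect_field TYPE('f)"
    and "split_octonion_algebra smul mul unit N"
  shows "AutoGroup (moufang_loop mul unit N) \<cong>
           (G2_semidirect_Aut :: (('f ^ g2_basis ^ g2_basis) \<times> ('f \<Rightarrow> 'f)) monoid) \<and>
         (\<forall>f \<in> carrier (AutoGroup (moufang_loop mul unit N)).
           \<exists>\<alpha>. semilinear_automorphism smul mul \<alpha> \<and> induced_by N \<alpha> f)"
proof -
  interpret split_octonion_algebra smul mul unit N by (rule assms(2))
  let ?G = "AutoGroup (moufang_loop mul unit N)"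
  obtain n where "nil n" "n \<noteq> 0"
    using zero_divisors exists_nil by blast
  then obtain x where x: "zorn x"
    using zorn_extends_nil by blast
  note iso = zmap_iso[OF x]
  define Q where "Q f p = represents (zmap x) f (fst p) (snd p)" for f p
  have mult_semidirect: "p \<otimes>\<^bsub>G2_semidirect_Aut\<^esub> q = (fst p ** map_matrix (snd p) (fst q), snd p \<circ> snd q)"
    for p q :: "('f ^ g2_basis ^ g2_basis) \<times> ('f \<Rightarrow> 'f)"
    by (simp add: G2_semidirect_Aut_def semidirect_product_def G2_group_def GL_group_def field_Aut_def
        case_prod_unfold)
  have carrier_semidirect: "carrier (G2_semidirect_Aut :: (('f ^ g2_basis ^ g2_basis) \<times> ('f \<Rightarrow> 'f)) monoid)
      = carrier G2_group \<times> field_automorphisms"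
    by (simp add: G2_semidirect_Aut_def semidirect_product_def field_Aut_def)
  have field_aut: "\<theta> \<in> field_automorphisms" if "represents (zmap x) f A \<theta>" for f A \<theta>
    using that unfolding represents_def[OF iso] by blast
  \<comment> \<open>The loop is not a group, so closure under composition is derived directly from
    \<open>hom\<close> and \<open>Bij\<close>.\<close>
  have closed: "f \<otimes>\<^bsub>?G\<^esub> g \<in> carrier ?G" if f: "f \<in> carrier ?G" and g: "g \<in> carrier ?G" for f g
  proof -
    obtain A \<theta> A' \<theta>' where "represents (zmap x) f A \<theta>" "represents (zmap x) g A' \<theta>'"
      using auto_represented[OF f x] auto_represented[OF g x] by blast
    note fg = represents_compose[OF iso this f g]
    let ?L = "moufang_loop mul unit N"
    have "f \<in> hom ?L ?L" "g \<in> hom ?L ?L" "f \<in> Bij (carrier ?L)" "g \<in> Bij (carrier ?L)"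
      using f g by (simp_all add: AutoGroup_def auto_def)
    moreover have "compose (carrier ?L) f g \<in> hom ?L ?L"
    proof (rule homI)
      fix X Y
      assume X: "X \<in> carrier ?L" and Y: "Y \<in> carrier ?L"
      have gX: "g X \<in> carrier ?L" "g Y \<in> carrier ?L"
        using X Y \<open>g \<in> hom ?L ?L\<close> by (auto simp: hom_def)
      show "compose (carrier ?L) f g X \<in> carrier ?L"
        using X gX \<open>f \<in> hom ?L ?L\<close> by (auto simp: compose_def hom_def)
      have "X \<otimes>\<^bsub>?L\<^esub> Y \<in> carrier ?L"
      proof -
        obtain a where a: "N a = 1" "X = {a, - a}"
          using X unfolding carrier_moufang_loop by (rule sign_classE)
        obtain b where b: "N b = 1" "Y = {b, - b}"
          using Y unfolding carrier_moufang_loop by (rule sign_classE)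
        from a b have "X \<otimes>\<^bsub>?L\<^esub> Y = {mul a b, - mul a b}" "N (mul a b) = 1"
          by (simp_all only: mult_moufang_loop norm_mul mult_1_left)
        then show ?thesis by (simp only: sign_class_carrier)
      qed
      then show "compose (carrier ?L) f g (X \<otimes>\<^bsub>?L\<^esub> Y) =
          compose (carrier ?L) f g X \<otimes>\<^bsub>?L\<^esub> compose (carrier ?L) f g Y"
        using X Y gX \<open>f \<in> hom ?L ?L\<close> \<open>g \<in> hom ?L ?L\<close> by (simp add: compose_def hom_mult)
    qed
    ultimately show ?thesis
      by (simp add: AutoGroup_def auto_def BijGroup_def compose_Bij)
  qed
  have "?G \<cong> (G2_semidirect_Aut :: (('f ^ g2_basis ^ g2_basis) \<times> ('f \<Rightarrow> 'f)) monoid)"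
  proof (rule iso_from_relation[of _ _ Q])
    show "\<exists>p\<in>carrier G2_semidirect_Aut. Q f p" if f: "f \<in> carrier ?G" for f
    proof -
      obtain A \<theta> where A: "A \<in> carrier G2_group" "represents (zmap x) f A \<theta>"
        using auto_represented[OF f x] by blast
      then show ?thesis
        unfolding carrier_semidirect Q_def using field_aut[OF A(2)] by (intro bexI[of _ "(A, \<theta>)"]) simp_all
    qed
    show "\<exists>f\<in>carrier ?G. Q f p" if "p \<in> carrier G2_semidirect_Aut" for p
      using represented_onto[OF iso, of "fst p" "snd p"] that unfolding carrier_semidirect Q_def by auto
    show "p = q" if "Q f p" "Q f q" for f p q
      using represents_unique[OF iso that[unfolded Q_def]] by (simp add: prod_eq_iff)
    show "f = g" if "f \<in> carrier ?G" "g \<in> carrier ?G" "Q f p" "Q g p" for f g p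
      by (rule represents_determines[OF iso that(3)[unfolded Q_def] that(4)[unfolded Q_def] that(1,2)])
    show "f \<otimes>\<^bsub>?G\<^esub> g \<in> carrier ?G \<and> Q (f \<otimes>\<^bsub>?G\<^esub> g) (p \<otimes>\<^bsub>G2_semidirect_Aut\<^esub> q)"
      if "f \<in> carrier ?G" "g \<in> carrier ?G" "Q f p" "Q g q" for f g p q
      using closed[OF that(1,2)] represents_compose[OF iso that(3)[unfolded Q_def] that(4)[unfolded Q_def] that(1,2)]
      by (simp add: Q_def mult_semidirect)
  qed
  moreover have "\<exists>\<alpha>. semilinear_automorphism smul mul \<alpha> \<and> induced_by N \<alpha> f" if "f \<in> carrier ?G" for f
    using auto_represented[OF that x] represented_semilinear[OF iso] by blast
  ultimately show ?thesis by blast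
qed

end
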